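(* The circle $S^1$, with its standard diffeology as a smooth manifold, is a cofibrant diffeological space.
   Context: A diffeological space is a set $X$ together with, for each $n\in\mathbb{N}$ and each open $U\subseteq\mathbb{R}^n$, a specified set of functions $U\to X$ called plots, such that: every constant map is a plot; if $U\to X$ is a plot and $V\to U$ is a smooth map between open subsets of Euclidean spaces then the composite $V\to X$ is a plot; and a function $U\to X$ whose restriction to each member of some open cover of $U$ is a plot is itself a plot. A map $f:X\to Y$ is smooth if $f\circ p$ is a plot of $Y$ for every plot $p$ of $X$; $C^\infty(X,Y)$ is the set of smooth maps. A smooth manifold has the standard diffeology, whose plots are the usual smooth maps. A subset $A\subseteq X$ has the sub-diffeology: $U\to A$ is a plot iff $U\to A\hookrightarrow X$ is. Let $\mathbb{A}^n=\{(x_0,\dots,x_n)\in\mathbb{R}^{n+1}\mid\sum x_i=1\}$ with the sub-diffeology from $\mathbb{R}^{n+1}$. A map $f:\{0,\dots,n\}\to\{0,\dots,m\}$ in the simplicial category induces $f_*:\mathbb{A}^n\to\mathbb{A}^m$, $f_*(x)_j=\sum_{i\in f^{-1}(j)}x_i$. $S^D(X)$ is the simplicial set with $S^D_n(X)=C^\infty(\mathbb{A}^n,X)$ and structure maps given by precomposition. A smooth map $f$ is a weak equivalence (resp. fibration) if $S^D(f)$ is a weak equivalence (i.e. its geometric realization is a homotopy equivalence) (resp. a Kan fibration) of simplicial sets. A cofibration is a smooth map with the left lifting property with respect to all smooth maps that are both weak equivalences and fibrations. $X$ is cofibrant if $\emptyset\to X$ is a cofibration. *)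

theory Defs
  imports "HOL-Analysis.Analysis" "HOL-Homology.Simplices"
begin

section \<open>Smooth maps between open subsets of Euclidean spaces\<close>

text \<open>
  Diffeologies quantify over the dimension, so \<open>\<real>\<^sup>n\<close> is rendered as \<^const>\<open>Euclidean_space\<close> \<open>n\<close>,
  whose points are the \<open>x :: nat \<Rightarrow> real\<close> with \<open>x i = 0\<close> for \<open>i \<ge> n\<close>.
  A function is \<open>C\<^sup>k\<close> if it is continuous and, for \<open>k > 0\<close>, all its partial
  derivatives exist on \<open>U\<close> and are \<open>C\<^sup>k\<^sup>-\<^sup>1\<close>.
\<close>

fun Ck_on :: "nat \<Rightarrow> nat \<Rightarrow> (nat \<Rightarrow> real) set \<Rightarrow> ((nat \<Rightarrow> real) \<Rightarrow> real) \<Rightarrow> bool" where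
  "Ck_on 0 n U f \<longleftrightarrow> continuous_map (subtopology (Euclidean_space n) U) euclideanreal f"
| "Ck_on (Suc k) n U f \<longleftrightarrow>
     continuous_map (subtopology (Euclidean_space n) U) euclideanreal f \<and>
     (\<forall>i<n. \<exists>g. (\<forall>x\<in>U. ((\<lambda>t. f (x(i := t))) has_real_derivative g x) (at (x i))) \<and>
                Ck_on k n U g)"

definition smooth_on :: "nat \<Rightarrow> (nat \<Rightarrow> real) set \<Rightarrow> ((nat \<Rightarrow> real) \<Rightarrow> real) \<Rightarrow> bool" where
  "smooth_on n U f \<longleftrightarrow> (\<forall>k. Ck_on k n U f)"

definition smooth_open_map ::
  "nat \<Rightarrow> (nat \<Rightarrow> real) set \<Rightarrow> nat \<Rightarrow> (nat \<Rightarrow> real) set \<Rightarrow>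
   ((nat \<Rightarrow> real) \<Rightarrow> (nat \<Rightarrow> real)) \<Rightarrow> bool" where
  "smooth_open_map m U n V f \<longleftrightarrow>
     openin (Euclidean_space m) U \<and> openin (Euclidean_space n) V \<and>
     f \<in> U \<rightarrow> V \<and> (\<forall>j<n. smooth_on m U (\<lambda>x. f x j))"


section \<open>Diffeological spaces\<close>

text \<open>
  A map \<open>U \<rightarrow> X\<close> is represented by a total function whose values outside \<open>U\<close> are irrelevant;
  the second axiom of \<open>diffeological_space\<close> expresses this.
\<close>

record 'a diffeology =
  points :: "'a set"
  plots :: "nat \<Rightarrow> (nat \<Rightarrow> real) set \<Rightarrow> ((nat \<Rightarrow> real) \<Rightarrow> 'a) set"

definition diffeological_space :: "'a diffeology \<Rightarrow> bool" where
  "diffeological_space X \<longleftrightarrow>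
     (\<forall>n U. \<forall>p\<in>plots X n U. openin (Euclidean_space n) U \<and> p \<in> U \<rightarrow> points X) \<and>
     (\<forall>n U p q. p \<in> plots X n U \<longrightarrow> (\<forall>u\<in>U. p u = q u) \<longrightarrow> q \<in> plots X n U) \<and>
     (\<forall>n U. openin (Euclidean_space n) U \<longrightarrow> (\<forall>x\<in>points X. (\<lambda>_. x) \<in> plots X n U)) \<and>
     (\<forall>n U p m V g. p \<in> plots X n U \<longrightarrow> smooth_open_map m V n U g \<longrightarrow> p \<circ> g \<in> plots X m V) \<and>
     (\<forall>n U p \<V>. (\<forall>V\<in>\<V>. openin (Euclidean_space n) V \<and> p \<in> plots X n V) \<longrightarrow> \<Union>\<V> = U
        \<longrightarrow> p \<in> plots X n U)"

definition smooth_map :: "'a diffeology \<Rightarrow> 'b diffeology \<Rightarrow> ('a \<Rightarrow> 'b) \<Rightarrow> bool" where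
  "smooth_map X Y f \<longleftrightarrow>
     f \<in> points X \<rightarrow> points Y \<and> (\<forall>n U. \<forall>p\<in>plots X n U. f \<circ> p \<in> plots Y n U)"

definition sub_diffeology :: "'a diffeology \<Rightarrow> 'a set \<Rightarrow> 'a diffeology" where
  "sub_diffeology X A =
     \<lparr>points = points X \<inter> A, plots = \<lambda>n U. {p \<in> plots X n U. p \<in> U \<rightarrow> A}\<rparr>"

definition empty_diffeology :: "'a diffeology" where
  "empty_diffeology = \<lparr>points = {}, plots = \<lambda>n U. {p. U = {}}\<rparr>"

definition euclidean_diffeology :: "nat \<Rightarrow> (nat \<Rightarrow> real) diffeology" where
  "euclidean_diffeology n =
     \<lparr>points = topspace (Euclidean_space n),
      plots = \<lambda>m U. {p. smooth_open_map m U n (topspace (Euclidean_space n)) p}\<rparr>"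

text \<open>
  The standard diffeology of a \<open>d\<close>-dimensional manifold with underlying space \<open>M\<close> and an
  atlas of charts \<open>(D, \<phi>)\<close>, \<open>\<phi> : D \<rightarrow> \<real>\<^sup>d\<close>: the plots are the continuous maps that are
  smooth in every chart.
\<close>

definition manifold_diffeology ::
  "nat \<Rightarrow> 'a topology \<Rightarrow> ('a set \<times> ('a \<Rightarrow> nat \<Rightarrow> real)) set \<Rightarrow> 'a diffeology" where
  "manifold_diffeology d M atlas =
     \<lparr>points = topspace M,
      plots = \<lambda>n U. {p. openin (Euclidean_space n) U \<and>
        continuous_map (subtopology (Euclidean_space n) U) M p \<and>
        (\<forall>(D, \<phi>)\<in>atlas.
           smooth_open_map n {u \<in> U. p u \<in> D} d (topspace (Euclidean_space d)) (\<phi> \<circ> p))}\<rparr>"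

text \<open>The unit circle in \<open>\<real>\<^sup>2\<close>, with the two stereographic projections from \<open>(0, 1)\<close> and \<open>(0, -1)\<close>.\<close>

definition circle_atlas :: "((nat \<Rightarrow> real) set \<times> ((nat \<Rightarrow> real) \<Rightarrow> nat \<Rightarrow> real)) set" where
  "circle_atlas =
     {({x \<in> topspace (nsphere 1). x 1 \<noteq> 1}, \<lambda>x i. if i = 0 then x 0 / (1 - x 1) else 0),
      ({x \<in> topspace (nsphere 1). x 1 \<noteq> -1}, \<lambda>x i. if i = 0 then x 0 / (1 + x 1) else 0)}"

definition circle :: "(nat \<Rightarrow> real) diffeology" where
  "circle = manifold_diffeology 1 (nsphere 1) circle_atlas"


section \<open>Simplicial sets\<close>

text \<open>\<open>simplex_ops m n\<close> is the set of morphisms \<open>{0,\<dots>,m} \<rightarrow> {0,\<dots>,n}\<close> of the simplicial category.\<close>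

definition simplex_ops :: "nat \<Rightarrow> nat \<Rightarrow> (nat \<Rightarrow> nat) set" where
  "simplex_ops m n = {\<theta> \<in> {..m} \<rightarrow>\<^sub>E {..n}. mono_on {..m} \<theta>}"

text \<open>For \<open>\<theta> \<in> simplex_ops m n\<close>, \<open>act X m n \<theta>\<close> is the structure map \<open>X\<^sub>n \<rightarrow> X\<^sub>m\<close>.\<close>

record 'a sset =
  simps :: "nat \<Rightarrow> 'a set"
  act :: "nat \<Rightarrow> nat \<Rightarrow> (nat \<Rightarrow> nat) \<Rightarrow> 'a \<Rightarrow> 'a"

definition simplicial_map :: "'a sset \<Rightarrow> 'b sset \<Rightarrow> (nat \<Rightarrow> 'a \<Rightarrow> 'b) \<Rightarrow> bool" where
  "simplicial_map X Y \<phi> \<longleftrightarrow>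
     (\<forall>n. \<phi> n \<in> simps X n \<rightarrow> simps Y n) \<and>
     (\<forall>m n. \<forall>\<theta>\<in>simplex_ops m n. \<forall>x\<in>simps X n.
        \<phi> m (act X m n \<theta> x) = act Y m n \<theta> (\<phi> n x))"

definition simplex_sset :: "nat \<Rightarrow> (nat \<Rightarrow> nat) sset" where
  "simplex_sset n =
     \<lparr>simps = \<lambda>m. simplex_ops m n, act = \<lambda>m m' \<theta> \<alpha>. compose {..m} \<alpha> \<theta>\<rparr>"

text \<open>The horn \<open>\<Lambda>\<^sup>n\<^sub>k\<close> is the union of the faces of \<open>\<Delta>\<^sup>n\<close> opposite to the vertices \<open>i \<noteq> k\<close>.\<close>

definition horn_sset :: "nat \<Rightarrow> nat \<Rightarrow> (nat \<Rightarrow> nat) sset" where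
  "horn_sset n k =
     \<lparr>simps = \<lambda>m. {\<alpha> \<in> simplex_ops m n. \<exists>i\<le>n. i \<noteq> k \<and> i \<notin> \<alpha> ` {..m}},
      act = act (simplex_sset n)\<rparr>"

definition Kan_fibration :: "'a sset \<Rightarrow> 'b sset \<Rightarrow> (nat \<Rightarrow> 'a \<Rightarrow> 'b) \<Rightarrow> bool" where
  "Kan_fibration X Y \<phi> \<longleftrightarrow>
     simplicial_map X Y \<phi> \<and>
     (\<forall>n k u v.
        1 \<le> n \<longrightarrow> k \<le> n \<longrightarrow>
        simplicial_map (horn_sset n k) X u \<longrightarrow> simplicial_map (simplex_sset n) Y v \<longrightarrow>
        (\<forall>m. \<forall>\<alpha>\<in>simps (horn_sset n k) m. \<phi> m (u m \<alpha>) = v m \<alpha>) \<longrightarrow>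
        (\<exists>w. simplicial_map (simplex_sset n) X w \<and>
             (\<forall>m. \<forall>\<alpha>\<in>simps (horn_sset n k) m. w m \<alpha> = u m \<alpha>) \<and>
             (\<forall>m. \<forall>\<alpha>\<in>simps (simplex_sset n) m. \<phi> m (w m \<alpha>) = v m \<alpha>)))"


section \<open>Geometric realization\<close>

text \<open>The map \<open>\<theta>\<^sub>*\<close> induced by \<open>\<theta> : {0,\<dots>,m} \<rightarrow> {0,\<dots>,n}\<close> on barycentric coordinates.\<close>

definition simplex_push :: "nat \<Rightarrow> (nat \<Rightarrow> nat) \<Rightarrow> (nat \<Rightarrow> real) \<Rightarrow> (nat \<Rightarrow> real)" where
  "simplex_push m \<theta> x = (\<lambda>j. \<Sum>i\<in>{i. i \<le> m \<and> \<theta> i = j}. x i)"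

definition quotient_topology :: "'a topology \<Rightarrow> ('a \<Rightarrow> 'b) \<Rightarrow> 'b topology" where
  "quotient_topology T q =
     topology (\<lambda>U. U \<subseteq> q ` topspace T \<and> openin T {x \<in> topspace T. q x \<in> U})"

lemma openin_quotient_topology:
  "openin (quotient_topology T q) U \<longleftrightarrow>
     U \<subseteq> q ` topspace T \<and> openin T {x \<in> topspace T. q x \<in> U}"
proof -
  have "istopology (\<lambda>U. U \<subseteq> q ` topspace T \<and> openin T {x \<in> topspace T. q x \<in> U})"
    unfolding istopology_def
  proof (intro conjI allI impI)
    fix S S'
    assume S: "S \<subseteq> q ` topspace T \<and> openin T {x \<in> topspace T. q x \<in> S}"
      and S': "S' \<subseteq> q ` topspace T \<and> openin T {x \<in> topspace T. q x \<in> S'}"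
    show "S \<inter> S' \<subseteq> q ` topspace T" using S by blast
    have eq: "{x \<in> topspace T. q x \<in> S \<inter> S'} =
        {x \<in> topspace T. q x \<in> S} \<inter> {x \<in> topspace T. q x \<in> S'}" by blast
    show "openin T {x \<in> topspace T. q x \<in> S \<inter> S'}"
      unfolding eq using S S' by (intro openin_Int) blast+
  next
    fix \<K> assume K: "\<forall>K\<in>\<K>. K \<subseteq> q ` topspace T \<and> openin T {x \<in> topspace T. q x \<in> K}"
    then show "\<Union>\<K> \<subseteq> q ` topspace T" by blast
    have eq: "{x \<in> topspace T. q x \<in> \<Union>\<K>} = (\<Union>K\<in>\<K>. {x \<in> topspace T. q x \<in> K})" by blast
    show "openin T {x \<in> topspace T. q x \<in> \<Union>\<K>}"
      unfolding eq using K by (intro openin_Union) blast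
  qed
  then show ?thesis by (simp add: quotient_topology_def)
qed

lemma topspace_quotient_topology: "topspace (quotient_topology T q) = q ` topspace T"
proof
  show "topspace (quotient_topology T q) \<subseteq> q ` topspace T"
    using openin_topspace[of "quotient_topology T q"] by (simp only: openin_quotient_topology)
  have "{x \<in> topspace T. q x \<in> q ` topspace T} = topspace T" by auto
  then have "openin (quotient_topology T q) (q ` topspace T)"
    by (simp add: openin_quotient_topology)
  then show "q ` topspace T \<subseteq> topspace (quotient_topology T q)" by (rule openin_subset)
qed

lemma quotient_map_quotient_topology: "quotient_map T (quotient_topology T q) q"
  by (simp add: quotient_map_def topspace_quotient_topology openin_quotient_topology)

text \<open>
  \<open>|X|\<close> is the quotient of \<open>\<Coprod>\<^sub>n X\<^sub>n \<times> \<Delta>\<^sup>n\<close>, with \<open>X\<^sub>n\<close> discrete, by the equivalence relation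
  generated by \<open>(\<theta>\<^sup>* x, t) \<sim> (x, \<theta>\<^sub>* t)\<close>. The point \<open>(x, t)\<close> of \<open>X\<^sub>n \<times> \<Delta>\<^sup>n\<close> is written \<open>((n, x), t)\<close>,
  and the coproduct is indexed by all pairs \<open>(n, x)\<close>.
\<close>

definition prerealization :: "'a sset \<Rightarrow> ((nat \<times> 'a) \<times> (nat \<Rightarrow> real)) topology" where
  "prerealization X =
     sum_topology (\<lambda>(n, x). subtopology (powertop_real UNIV) (standard_simplex n))
       {(n, x). x \<in> simps X n}"

definition realization_gen ::
  "'a sset \<Rightarrow> (((nat \<times> 'a) \<times> (nat \<Rightarrow> real)) \<times> ((nat \<times> 'a) \<times> (nat \<Rightarrow> real))) set" where
  "realization_gen X =
     {(((m, act X m n \<theta> x), t), ((n, x), simplex_push m \<theta> t)) | m n \<theta> x t.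
        \<theta> \<in> simplex_ops m n \<and> x \<in> simps X n \<and> t \<in> standard_simplex m}"

definition realization_rel ::
  "'a sset \<Rightarrow> (((nat \<times> 'a) \<times> (nat \<Rightarrow> real)) \<times> ((nat \<times> 'a) \<times> (nat \<Rightarrow> real))) set" where
  "realization_rel X =
     (realization_gen X \<union> (realization_gen X)\<inverse>)\<^sup>* \<inter>
     (topspace (prerealization X) \<times> topspace (prerealization X))"

definition realization :: "'a sset \<Rightarrow> ((nat \<times> 'a) \<times> (nat \<Rightarrow> real)) set topology" where
  "realization X = quotient_topology (prerealization X) (\<lambda>z. realization_rel X `` {z})"

text \<open>
  Points of \<open>|X|\<close> are equivalence classes \<open>c\<close>; \<open>|\<phi>|(c)\<close> is the class containing the image of \<open>c\<close>
  under \<open>(x, t) \<mapsto> (\<phi> x, t)\<close>.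
\<close>

definition realization_map ::
  "'b sset \<Rightarrow> (nat \<Rightarrow> 'a \<Rightarrow> 'b) \<Rightarrow> ((nat \<times> 'a) \<times> (nat \<Rightarrow> real)) set \<Rightarrow>
   ((nat \<times> 'b) \<times> (nat \<Rightarrow> real)) set" where
  "realization_map Y \<phi> c = realization_rel Y `` {((n, \<phi> n x), t) | n x t. ((n, x), t) \<in> c}"

definition homotopy_equivalence :: "'a topology \<Rightarrow> 'b topology \<Rightarrow> ('a \<Rightarrow> 'b) \<Rightarrow> bool" where
  "homotopy_equivalence S T f \<longleftrightarrow>
     continuous_map S T f \<and>
     (\<exists>g. continuous_map T S g \<and>
          homotopic_with (\<lambda>_. True) S S (g \<circ> f) id \<and>
          homotopic_with (\<lambda>_. True) T T (f \<circ> g) id)"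

definition sset_weak_equivalence :: "'a sset \<Rightarrow> 'b sset \<Rightarrow> (nat \<Rightarrow> 'a \<Rightarrow> 'b) \<Rightarrow> bool" where
  "sset_weak_equivalence X Y \<phi> \<longleftrightarrow>
     simplicial_map X Y \<phi> \<and>
     homotopy_equivalence (realization X) (realization Y) (realization_map Y \<phi>)"


section \<open>The smooth singular simplicial set\<close>

definition affine_simplex :: "nat \<Rightarrow> (nat \<Rightarrow> real) diffeology" where
  "affine_simplex n = sub_diffeology (euclidean_diffeology (Suc n)) {x. (\<Sum>i\<le>n. x i) = 1}"

text \<open>
  Smooth maps \<open>\<bbbA>\<^sup>n \<rightarrow> X\<close> are normalised to be undefined outside \<open>\<bbbA>\<^sup>n\<close>, so that equality
  of simplices is equality of functions.
\<close>

definition SD :: "'a diffeology \<Rightarrow> ((nat \<Rightarrow> real) \<Rightarrow> 'a) sset" where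
  "SD X =
     \<lparr>simps = \<lambda>n. {\<sigma> \<in> extensional (points (affine_simplex n)). smooth_map (affine_simplex n) X \<sigma>},
      act = \<lambda>m n \<theta> \<sigma>. restrict (\<sigma> \<circ> simplex_push m \<theta>) (points (affine_simplex m))\<rparr>"

definition SD_map ::
  "('a \<Rightarrow> 'b) \<Rightarrow> nat \<Rightarrow> ((nat \<Rightarrow> real) \<Rightarrow> 'a) \<Rightarrow> ((nat \<Rightarrow> real) \<Rightarrow> 'b)" where
  "SD_map f n \<sigma> = restrict (f \<circ> \<sigma>) (points (affine_simplex n))"


section \<open>Weak equivalences, fibrations and cofibrations\<close>

definition weak_equivalence :: "'a diffeology \<Rightarrow> 'b diffeology \<Rightarrow> ('a \<Rightarrow> 'b) \<Rightarrow> bool" where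
  "weak_equivalence X Y f \<longleftrightarrow>
     smooth_map X Y f \<and> sset_weak_equivalence (SD X) (SD Y) (SD_map f)"

definition fibration :: "'a diffeology \<Rightarrow> 'b diffeology \<Rightarrow> ('a \<Rightarrow> 'b) \<Rightarrow> bool" where
  "fibration X Y f \<longleftrightarrow> smooth_map X Y f \<and> Kan_fibration (SD X) (SD Y) (SD_map f)"

definition left_lifting ::
  "'a diffeology \<Rightarrow> 'x diffeology \<Rightarrow> ('a \<Rightarrow> 'x) \<Rightarrow>
   'e diffeology \<Rightarrow> 'b diffeology \<Rightarrow> ('e \<Rightarrow> 'b) \<Rightarrow> bool" where
  "left_lifting A X i E B p \<longleftrightarrow>
     (\<forall>u v. smooth_map A E u \<longrightarrow> smooth_map X B v \<longrightarrow> (\<forall>a\<in>points A. p (u a) = v (i a)) \<longrightarrow>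
        (\<exists>h. smooth_map X E h \<and>
             (\<forall>a\<in>points A. h (i a) = u a) \<and> (\<forall>x\<in>points X. p (h x) = v x)))"

text \<open>
  HOL cannot quantify over types inside a formula, so the types that carry the total space \<open>E\<close> and
  the base \<open>B\<close> of the test maps are parameters. A theorem in which \<open>'e\<close> and \<open>'b\<close> are type variables
  asserts the lifting property against all trivial fibrations \<open>E \<rightarrow> B\<close>.
\<close>

definition cofibration ::
  "'e itself \<Rightarrow> 'b itself \<Rightarrow> 'a diffeology \<Rightarrow> 'x diffeology \<Rightarrow> ('a \<Rightarrow> 'x) \<Rightarrow> bool" where
  "cofibration _ _ A X i \<longleftrightarrow>
     smooth_map A X i \<and>
     (\<forall>(E :: 'e diffeology) (B :: 'b diffeology) p.
        diffeological_space E \<longrightarrow> diffeological_space B \<longrightarrow>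
        weak_equivalence E B p \<longrightarrow> fibration E B p \<longrightarrow> left_lifting A X i E B p)"

text \<open>The empty space is carried by the type of \<open>X\<close>, so the unique map to \<open>X\<close> is represented by \<open>id\<close>.\<close>

definition cofibrant :: "'e itself \<Rightarrow> 'b itself \<Rightarrow> 'x diffeology \<Rightarrow> bool" where
  "cofibrant TE TB X \<longleftrightarrow> cofibration TE TB (empty_diffeology :: 'x diffeology) X id"

end

theory Submission
  imports Defs "HOL-Computational_Algebra.Polynomial"
begin

text \<open>
  Let \<open>p : E \<rightarrow> B\<close> be a trivial fibration and \<open>v : S\<^sup>1 \<rightarrow> B\<close> smooth. Pulled back along the exponential,
  \<open>v\<close> is an edge of \<open>S\<^sup>D(B)\<close> with equal end points. The fibrewise path components of the Kan fibration
  \<open>S\<^sup>D(p)\<close> form a covering of \<open>S\<^sup>D(B)\<close>, whose realization is a covering space. As \<open>|S\<^sup>D(p)|\<close> has a right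
  inverse up to homotopy, the edge lifts to a closed path in this covering, and hence to an edge
  \<open>a : \<real> \<rightarrow> E\<close> with \<open>a(0) = a(1)\<close>. The ends of \<open>a\<close> agree only to order zero. But \<open>a(t)\<close> and \<open>a(t - 1)\<close> lift the
  same path and agree at \<open>t = 1\<close>, so they form a horn in \<open>\<bbbA>\<^sup>2\<close> over \<open>B\<close>. In a filler, a path that follows
  \<open>a(t)\<close> near \<open>t = 0\<close> and \<open>a(t - 1)\<close> near \<open>t = 1\<close> descends to a smooth lift of \<open>v\<close>.
\<close>

section \<open>Lifting squares along covering maps\<close>

text \<open>The obstacle is that a weak equivalence is known only through realizations, while the
  lift that is wanted is made of smooth simplices. Turning a continuous map back into simplices
  calls in general for simplicial approximation. Over a covering this is not necessary: paths lift
  uniquely, so the lift of the path traced by an edge is again the path of an edge. What returns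
  from the topology is therefore only a component of the fibre that is fixed by transport around the
  loop; the one- and two-dimensional Kan conditions turn this into a closed edge. The gluing at the
  end rests on \<open>\<bbbA>\<close> being the whole affine space and not a simplex. An edge is a
  path on all of the real line, so it can be shifted by one turn, and there is room on both sides of
  the point where the circle closes up.\<close>

locale sheeted_map =
  fixes C :: "'c topology" and Z :: "'z topology" and p :: "'c \<Rightarrow> 'z"
  assumes cont: "continuous_map C Z p"
    and opn: "open_map C Z p"
    and sheets: "\<And>z. z \<in> topspace Z \<Longrightarrow>
      \<exists>W \<O>. openin Z W \<and> z \<in> W \<and> disjoint \<O> \<and>
        (\<forall>Q\<in>\<O>. openin C Q \<and> inj_on p Q \<and> W \<subseteq> p ` Q) \<and> {w \<in> topspace C. p w \<in> W} \<subseteq> \<Union>\<O>"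
begin

text \<open>The set where the lifts agree is open because \<open>p\<close> is injective on each
  sheet. The set where they differ is open because distinct points of one fibre lie in different,
  hence disjoint, sheets.\<close>

lemma lift_unique:
  assumes K: "connected_space K"
    and l: "continuous_map K C l" and l': "continuous_map K C l'"
    and eq: "\<And>x. x \<in> topspace K \<Longrightarrow> p (l x) = p (l' x)"
    and x0: "x0 \<in> topspace K" "l x0 = l' x0" and x: "x \<in> topspace K"
  shows "l x = l' x"
proof -
  let ?E = "{x \<in> topspace K. l x = l' x}"
  let ?D = "{x \<in> topspace K. l x \<noteq> l' x}"
  have sheet: "\<exists>O1 O2. openin C O1 \<and> openin C O2 \<and> l x \<in> O1 \<and> l' x \<in> O2 \<and>
      inj_on p O1 \<and> (O1 = O2 \<or> O1 \<inter> O2 = {})" if x: "x \<in> topspace K" for x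
  proof -
    have lx: "l x \<in> topspace C" "l' x \<in> topspace C"
      using l l' x by (auto simp: continuous_map_def)
    then have "p (l x) \<in> topspace Z" using cont by (auto simp: continuous_map_def)
    from sheets[OF this] obtain W \<O> where W: "p (l x) \<in> W" "disjoint \<O>"
      "\<forall>Q\<in>\<O>. openin C Q \<and> inj_on p Q \<and> W \<subseteq> p ` Q" "{w \<in> topspace C. p w \<in> W} \<subseteq> \<Union>\<O>"
      by blast
    have "l x \<in> \<Union>\<O>" "l' x \<in> \<Union>\<O>" using W(1,4) lx eq[OF x] by auto
    then obtain O1 O2 where "O1 \<in> \<O>" "O2 \<in> \<O>" "l x \<in> O1" "l' x \<in> O2" by blast
    then show ?thesis using W(2,3) by (metis disjointD)
  qed
  have "openin K ?E"
  proof (subst openin_subopen, intro ballI)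
    fix x assume "x \<in> ?E"
    then have x: "x \<in> topspace K" "l x = l' x" by auto
    obtain O1 where Q: "openin C O1" "l x \<in> O1" "inj_on p O1" using sheet[OF x(1)] by blast
    let ?T = "{y \<in> topspace K. l y \<in> O1} \<inter> {y \<in> topspace K. l' y \<in> O1}"
    have "openin K ?T"
      by (intro openin_Int openin_continuous_map_preimage[OF l] openin_continuous_map_preimage[OF l'] Q)
    moreover have "x \<in> ?T" using x Q by auto
    moreover have "?T \<subseteq> ?E" using Q(3) eq by (auto simp: inj_on_def)
    ultimately show "\<exists>T. openin K T \<and> x \<in> T \<and> T \<subseteq> ?E" by blast
  qed
  moreover have "openin K ?D"
  proof (subst openin_subopen, intro ballI)
    fix x assume "x \<in> ?D"
    then have x: "x \<in> topspace K" "l x \<noteq> l' x" by auto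
    obtain O1 O2 where Q: "openin C O1" "openin C O2" "l x \<in> O1" "l' x \<in> O2" "inj_on p O1"
      "O1 = O2 \<or> O1 \<inter> O2 = {}" using sheet[OF x(1)] by metis
    have d: "O1 \<inter> O2 = {}" using Q x eq[OF x(1)] by (auto simp: inj_on_def)
    let ?T = "{y \<in> topspace K. l y \<in> O1} \<inter> {y \<in> topspace K. l' y \<in> O2}"
    have "openin K ?T"
      by (intro openin_Int openin_continuous_map_preimage[OF l] openin_continuous_map_preimage[OF l'] Q)
    moreover have "x \<in> ?T" using x Q by auto
    moreover have "?T \<subseteq> ?D" using d by auto
    ultimately show "\<exists>T. openin K T \<and> x \<in> T \<and> T \<subseteq> ?D" by blast
  qed
  ultimately have "?D = {}"
    using K x0 unfolding connected_space_def by (smt (verit) disjoint_iff empty_iff mem_Collect_eq subsetI UnI1 UnI2)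
  with x show ?thesis by blast
qed

text \<open>Openness of \<open>p\<close> makes the inverse continuous: the preimage of
  \<open>V\<close> is the part of \<open>W\<close> inside the image of
  \<open>V \<inter> Q\<close>.\<close>

lemma continuous_sheet_inverse:
  assumes W: "openin Z W" and Q: "openin C Q" "inj_on p Q" "W \<subseteq> p ` Q"
  shows "continuous_map (subtopology Z W) C (inv_into Q p)"
proof -
  have 1: "inv_into Q p z \<in> Q" "p (inv_into Q p z) = z" if "z \<in> W" for z
    using Q that by (auto intro: inv_into_into f_inv_into_f)
  show ?thesis unfolding continuous_map_def
  proof (intro conjI allI impI)
    show "inv_into Q p \<in> topspace (subtopology Z W) \<rightarrow> topspace C"
      using 1 openin_subset[OF Q(1)] by auto
    fix V assume V: "openin C V"
    have "inv_into Q p z \<in> V \<longleftrightarrow> z \<in> p ` (V \<inter> Q)" if "z \<in> W" for z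
    proof
      assume "inv_into Q p z \<in> V"
      then show "z \<in> p ` (V \<inter> Q)" using 1[OF that] by (metis IntI imageI)
    next
      assume "z \<in> p ` (V \<inter> Q)"
      then show "inv_into Q p z \<in> V" using inv_into_f_f[OF Q(2)] by auto
    qed
    then have "{z \<in> topspace (subtopology Z W). inv_into Q p z \<in> V} = W \<inter> p ` (V \<inter> Q)"
      using openin_subset[OF W] by auto
    moreover have "openin Z (p ` (V \<inter> Q))" using opn V Q by (auto simp: open_map_def)
    ultimately show "openin (subtopology Z W) {z \<in> topspace (subtopology Z W). inv_into Q p z \<in> V}"
      by (metis openin_subtopology_Int2 inf_commute)
  qed
qed

section \<open>Lifting of rectangles and of closed paths\<close>

definition lift_on :: "(real \<times> real \<Rightarrow> 'z) \<Rightarrow> (real \<times> real) set \<Rightarrow> (real \<times> real \<Rightarrow> 'c) \<Rightarrow> bool" where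
  "lift_on R S l \<longleftrightarrow> continuous_map (top_of_set S) C l \<and> (\<forall>y\<in>S. p (l y) = R y)"

text \<open>The value is prescribed at an arbitrary point of \<open>S\<close>, not at a fixed base
  point. The property then passes to subsets, and two pieces can be matched starting from either
  one.\<close>

definition liftable :: "(real \<times> real \<Rightarrow> 'z) \<Rightarrow> (real \<times> real) set \<Rightarrow> bool" where
  "liftable R S \<longleftrightarrow> (\<forall>x\<in>S. \<forall>w\<in>topspace C. p w = R x \<longrightarrow> (\<exists>l. lift_on R S l \<and> l x = w))"

lemma lift_on_mono: "lift_on R S l \<Longrightarrow> S' \<subseteq> S \<Longrightarrow> lift_on R S' l"
  unfolding lift_on_def by (metis continuous_map_from_subtopology_mono subsetD)

lemma lift_on_values:
  assumes "lift_on R S l" "y \<in> S"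
  shows "l y \<in> topspace C" "p (l y) = R y"
proof -
  have "continuous_map (top_of_set S) C l" using assms(1) by (simp add: lift_on_def)
  then show "l y \<in> topspace C" using continuous_map_funspace assms(2) by fastforce
  show "p (l y) = R y" using assms by (simp add: lift_on_def)
qed

lemma liftable_mono:
  assumes "liftable R S" "S' \<subseteq> S"
  shows "liftable R S'"
  unfolding liftable_def
proof (intro ballI impI)
  fix x w assume x: "x \<in> S'" "w \<in> topspace C" "p w = R x"
  then have "x \<in> S" using assms(2) by auto
  then show "\<exists>l. lift_on R S' l \<and> l x = w"
    using assms x(2,3) lift_on_mono unfolding liftable_def by blast
qed

lemma liftable_evenly_covered:
  assumes W: "openin Z W" and R: "continuous_map (top_of_set S) Z R" "R ` S \<subseteq> W"
    and \<O>: "\<forall>Q\<in>\<O>. openin C Q \<and> inj_on p Q \<and> W \<subseteq> p ` Q" "{w \<in> topspace C. p w \<in> W} \<subseteq> \<Union>\<O>"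
  shows "liftable R S"
  unfolding liftable_def
proof (intro ballI impI)
  fix x w assume x: "x \<in> S" "w \<in> topspace C" "p w = R x"
  then have "w \<in> \<Union>\<O>" using \<O>(2) R(2) by blast
  then obtain Q where Q: "Q \<in> \<O>" "w \<in> Q" by blast
  have "continuous_map (top_of_set S) (subtopology Z W) R"
    using R by (simp add: continuous_map_in_subtopology image_subset_iff_funcset)
  then have "continuous_map (top_of_set S) C (inv_into Q p \<circ> R)"
    using continuous_sheet_inverse[OF W, of Q] \<O>(1) Q(1) by (blast intro: continuous_map_compose)
  moreover have "\<forall>y\<in>S. p ((inv_into Q p \<circ> R) y) = R y"
    using R \<O> Q by (auto intro!: f_inv_into_f)
  moreover have "(inv_into Q p \<circ> R) x = w"
    using x Q \<O> by (metis comp_apply inv_into_f_f)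
  ultimately show "\<exists>l. lift_on R S l \<and> l x = w" unfolding lift_on_def by blast
qed

text \<open>A lift on one piece is continued by the lift on the other piece that has the same value
  at one point \<open>b\<close> of the common level set. Uniqueness of lifts over this connected set
  makes them agree on all of it.\<close>

lemma liftable_Un:
  fixes u :: "real \<times> real \<Rightarrow> real"
  assumes S1: "liftable R {y \<in> S. u y \<le> m}" and S2: "liftable R {y \<in> S. m \<le> u y}"
    and u: "continuous_on S u"
    and conn: "connected {y \<in> S. u y = m}" and ne: "{y \<in> S. u y = m} \<noteq> {}"
  shows "liftable R S"
proof -
  let ?S1 = "{y \<in> S. u y \<le> m}" and ?S2 = "{y \<in> S. m \<le> u y}" and ?S0 = "{y \<in> S. u y = m}"
  obtain b where b: "b \<in> S" "u b = m" using ne by blast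
  have b12: "b \<in> ?S1" "b \<in> ?S2" using b by auto
  have glue: "\<exists>l. lift_on R S l \<and> (\<forall>y\<in>S. (u y \<le> m \<longrightarrow> l y = l1 y) \<and> (m \<le> u y \<longrightarrow> l y = l2 y))"
    if l1: "lift_on R ?S1 l1" and l2: "lift_on R ?S2 l2" and eq: "l1 b = l2 b" for l1 l2
  proof -
    have c0: "lift_on R ?S0 l1" "lift_on R ?S0 l2"
      by (rule lift_on_mono[OF l1], force, rule lift_on_mono[OF l2], force)
    have agree: "l1 y = l2 y" if "y \<in> S" "u y = m" for y
    proof (rule lift_unique[of "top_of_set ?S0" l1 l2 b y])
      show "connected_space (top_of_set ?S0)" using conn by (simp add: connected_space_subtopology)
      show "p (l1 x) = p (l2 x)" if "x \<in> topspace (top_of_set ?S0)" for x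
        using that lift_on_values(2)[OF c0(1)] lift_on_values(2)[OF c0(2)] by simp
    qed (use that b eq c0 in \<open>auto simp: lift_on_def\<close>)
    let ?l = "\<lambda>y. if u y \<le> m then l1 y else l2 y"
    have "continuous_map (top_of_set S) C ?l"
    proof (rule continuous_map_cases_le)
      have e: "{x \<in> topspace (top_of_set S). u x \<le> m} = ?S1"
        "{x \<in> topspace (top_of_set S). m \<le> u x} = ?S2" by auto
      have s: "S \<inter> {y \<in> S. Q y} = {y \<in> S. Q y}" for Q by auto
      show "continuous_map (subtopology (top_of_set S) {x \<in> topspace (top_of_set S). u x \<le> m}) C l1"
        "continuous_map (subtopology (top_of_set S) {x \<in> topspace (top_of_set S). m \<le> u x}) C l2"
        unfolding e subtopology_subtopology s using l1 l2 by (simp_all add: lift_on_def)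
    qed (use u agree in auto)
    moreover have "\<forall>y\<in>S. p (?l y) = R y"
      using lift_on_values(2)[OF l1] lift_on_values(2)[OF l2] by auto
    moreover have "\<forall>y\<in>S. (u y \<le> m \<longrightarrow> ?l y = l1 y) \<and> (m \<le> u y \<longrightarrow> ?l y = l2 y)"
      using agree by auto
    ultimately show ?thesis unfolding lift_on_def by blast
  qed
  have extend: "\<exists>l'. lift_on R T' l' \<and> l' b = l b" if "liftable R T'" "b \<in> T'" "lift_on R T l" "b \<in> T" for T T' l
    using that(1,2) lift_on_values[OF that(3,4)] unfolding liftable_def by blast
  show ?thesis unfolding liftable_def
  proof (intro ballI impI)
    fix x w assume x: "x \<in> S" "w \<in> topspace C" "p w = R x"
    show "\<exists>l. lift_on R S l \<and> l x = w"
    proof (cases "u x \<le> m")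
      case True
      with S1 x obtain l1 where l1: "lift_on R ?S1 l1" "l1 x = w" unfolding liftable_def by blast
      obtain l2 where l2: "lift_on R ?S2 l2" "l2 b = l1 b" using extend[OF S2 b12(2) l1(1) b12(1)] by blast
      from glue[OF l1(1) l2(1) l2(2)[symmetric]] show ?thesis using True x(1) l1(2) by metis
    next
      case False
      then have "x \<in> ?S2" using x(1) by simp
      with S2 x obtain l2 where l2: "lift_on R ?S2 l2" "l2 x = w" unfolding liftable_def by blast
      obtain l1 where l1: "lift_on R ?S1 l1" "l1 b = l2 b" using extend[OF S1 b12(1) l2(1) b12(2)] by blast
      from glue[OF l1(1) l2(1) l1(2)] show ?thesis using False x(1) l2(2) by (metis linear)
    qed
  qed
qed

text \<open>Compactness enters as bisection by \<open>Bolzano\<close>: small squares are liftable,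
  squares are joined along horizontal segments into a column, and columns along vertical segments
  into the rectangle.\<close>

lemma liftable_rectangle:
  assumes R: "continuous_map euclidean Z R" and "a \<le> b" "c \<le> d"
  shows "liftable R ({a..b} \<times> {c..d})"
proof -
  have RS: "continuous_map (top_of_set S) Z R" for S
    using R by (rule continuous_map_from_subtopology)
  have loc: "\<exists>e>0. liftable R (cball s e \<times> cball r e)" for s r
  proof -
    have "R (s, r) \<in> topspace Z" using R by (auto simp: continuous_map_def)
    from sheets[OF this] obtain W \<O> where W: "openin Z W" "R (s, r) \<in> W"
      "\<forall>Q\<in>\<O>. openin C Q \<and> inj_on p Q \<and> W \<subseteq> p ` Q" "{w \<in> topspace C. p w \<in> W} \<subseteq> \<Union>\<O>"
      by blast
    have "open (R -` W)" using R W by (auto simp: continuous_map_def vimage_def)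
    then obtain A B where AB: "open A" "open B" "s \<in> A" "r \<in> B" "A \<times> B \<subseteq> R -` W"
      using W(2) by (elim open_prod_elim[of _ "(s, r)"]) auto
    obtain e1 e2 where e: "e1 > 0" "cball s e1 \<subseteq> A" "e2 > 0" "cball r e2 \<subseteq> B"
      using AB by (metis open_contains_cball)
    have "cball s (min e1 e2) \<times> cball r (min e1 e2) \<subseteq> A \<times> B" using e by fastforce
    then have "R ` (cball s (min e1 e2) \<times> cball r (min e1 e2)) \<subseteq> W" using AB by blast
    then show ?thesis using liftable_evenly_covered[OF W(1) RS _ W(3,4)] e by (metis min_less_iff_conj)
  qed
  have col: "\<exists>e>0. liftable R (cball s e \<times> {c..d})" for s
    using \<open>c \<le> d\<close>
  proof (induct rule: Bolzano)
    case (trans c1 c2 c3)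
    then obtain e1 e2 where e: "e1 > 0" "liftable R (cball s e1 \<times> {c1..c2})"
        "e2 > 0" "liftable R (cball s e2 \<times> {c2..c3})" by blast
    let ?e = "min e1 e2"
    let ?S = "cball s ?e \<times> {c1..c3}"
    have "liftable R ?S"
    proof (rule liftable_Un[where u = snd and m = c2])
      show "liftable R {y \<in> ?S. snd y \<le> c2}" by (rule liftable_mono[OF e(2)]) auto
      show "liftable R {y \<in> ?S. c2 \<le> snd y}" by (rule liftable_mono[OF e(4)]) auto
      have *: "{y \<in> ?S. snd y = c2} = cball s ?e \<times> {c2}" using trans by auto
      show "connected {y \<in> ?S. snd y = c2}" unfolding * by (intro connected_Times) auto
      show "{y \<in> ?S. snd y = c2} \<noteq> {}" unfolding * using e by (auto simp: less_imp_le)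
    qed (intro continuous_on_snd continuous_on_id)
    then show ?case using e by (metis min_less_iff_conj)
  next
    case (local r)
    obtain e where e: "e > 0" "liftable R (cball s e \<times> cball r e)" using loc by blast
    have "liftable R (cball s e \<times> {a..b})" if "a \<le> r \<and> r \<le> b \<and> b - a < e" for a b
      by (rule liftable_mono[OF e(2)]) (use that in \<open>auto simp: dist_real_def\<close>)
    then show ?case using e(1) by blast
  qed
  show ?thesis using \<open>a \<le> b\<close>
  proof (induct rule: Bolzano)
    case (trans a1 a2 a3)
    let ?S = "{a1..a3} \<times> {c..d}"
    show ?case
    proof (rule liftable_Un[where u = fst and m = a2])
      show "liftable R {y \<in> ?S. fst y \<le> a2}" by (rule liftable_mono[OF trans(1)]) auto
      show "liftable R {y \<in> ?S. a2 \<le> fst y}" by (rule liftable_mono[OF trans(2)]) auto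
      have *: "{y \<in> ?S. fst y = a2} = {a2} \<times> {c..d}" using trans by auto
      show "connected {y \<in> ?S. fst y = a2}" unfolding * by (intro connected_Times) auto
      show "{y \<in> ?S. fst y = a2} \<noteq> {}" unfolding * using \<open>c \<le> d\<close> by auto
    qed (intro continuous_on_fst continuous_on_id)
  next
    case (local s)
    obtain e where e: "e > 0" "liftable R (cball s e \<times> {c..d})" using col by blast
    have "liftable R ({a..b} \<times> {c..d})" if "a \<le> s \<and> s \<le> b \<and> b - a < e" for a b
      by (rule liftable_mono[OF e(2)]) (use that in \<open>auto simp: dist_real_def\<close>)
    then show ?case using e(1) by blast
  qed
qed

text \<open>The lift of the square that starts at \<open>l0 0\<close> reproduces \<open>l0\<close>
  on the bottom side. As \<open>l0\<close> is closed, the lifts of the two vertical sides start at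
  the same point, hence agree, and the lift of the top side is closed.\<close>

lemma loop_lift:
  fixes R :: "real \<times> real \<Rightarrow> 'z"
  assumes R: "continuous_map (top_of_set ({0..1} \<times> {0..1})) Z R"
    and sides: "\<And>r. r \<in> {0..1} \<Longrightarrow> R (0, r) = R (1, r)"
    and l0: "continuous_map (top_of_set {0..1}) C l0" "\<And>s. s \<in> {0..1} \<Longrightarrow> p (l0 s) = R (s, 0)"
      "l0 0 = l0 1"
  obtains l where "continuous_map (top_of_set {0..1}) C l"
    "\<And>s. s \<in> {0..1} \<Longrightarrow> p (l s) = R (s, 1)" "l 0 = l (1 :: real)"
proof -
  let ?I = "{0..1} :: real set"
  \<comment> \<open>Clamping both coordinates extends \<open>R\<close> to the whole plane, where
    \<open>liftable_rectangle\<close> expects it.\<close>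
  define cl where "cl x = max 0 (min 1 x)" for x :: real
  have cl: "cl x \<in> ?I" "x \<in> ?I \<Longrightarrow> cl x = x" for x by (auto simp: cl_def)
  define cl2 where "cl2 x = (cl (fst x), cl (snd x))" for x :: "real \<times> real"
  have "continuous_on UNIV cl2"
    unfolding cl2_def cl_def by (intro continuous_intros)
  moreover have "cl2 x \<in> ?I \<times> ?I" for x using cl(1) by (simp add: cl2_def del: atLeastAtMost_iff)
  ultimately have "continuous_map euclidean (top_of_set (?I \<times> ?I)) cl2"
    by (simp add: continuous_map_in_subtopology image_subset_iff_funcset Pi_def)
  from continuous_map_compose[OF this R]
  have R': "continuous_map euclidean Z (R \<circ> cl2)" .
  define R' where "R' = R \<circ> cl2"
  note R' = R'[folded R'_def]
  have R'_eq: "R' (s, r) = R (s, r)" if "s \<in> ?I" "r \<in> ?I" for s r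
    using cl(2)[OF that(1)] cl(2)[OF that(2)] by (simp add: R'_def cl2_def)
  have "liftable R' (?I \<times> ?I)" using liftable_rectangle[OF R', of 0 1 0 1] by simp
  moreover have "(0, 0) \<in> ?I \<times> ?I" by simp
  moreover have "l0 0 \<in> topspace C" using continuous_map_funspace[OF l0(1)] by auto
  moreover have "p (l0 0) = R' (0, 0)" using l0(2) R'_eq by simp
  ultimately obtain L where L: "continuous_map (top_of_set (?I \<times> ?I)) C L"
    "\<forall>y\<in>?I \<times> ?I. p (L y) = R' y" "L (0, 0) = l0 0"
    unfolding liftable_def lift_on_def by blast
  have pL: "p (L (s, r)) = R (s, r)" if "s \<in> ?I" "r \<in> ?I" for s r
    using L(2) R'_eq[OF that] that by simp
  have conn: "connected_space (top_of_set ?I)"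
    by (simp add: connected_space_subtopology)
  have path: "continuous_map (top_of_set ?I) C (\<lambda>s. L (f s))"
    if "continuous_on ?I f" "f \<in> ?I \<rightarrow> ?I \<times> ?I" for f
    using continuous_map_compose[OF _ L(1), of "top_of_set ?I" f] that
    by (simp add: o_def image_subset_iff_funcset)
  have bottom: "L (s, 0) = l0 s" if "s \<in> ?I" for s
    by (rule lift_unique[OF conn, of "\<lambda>s. L (s, 0)" l0 0])
      (use l0 L(3) pL that in \<open>auto intro!: path continuous_intros\<close>)
  have sides': "L (0, r) = L (1, r)" if "r \<in> ?I" for r
    by (rule lift_unique[OF conn, of "\<lambda>r. L (0, r)" "\<lambda>r. L (1, r)" 0])
      (use sides pL bottom l0(3) that in \<open>auto intro!: path continuous_intros\<close>)
  show ?thesis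
    by (rule that[of "\<lambda>s. L (s, 1)"]) (use pL sides' in \<open>auto intro!: path continuous_intros\<close>)
qed

end

section \<open>Simplicial sets and their realizations\<close>

lemma simplex_opsI:
  assumes "\<And>i. i \<le> m \<Longrightarrow> f i \<le> n" "\<And>i j. i \<le> j \<Longrightarrow> j \<le> m \<Longrightarrow> f i \<le> f j"
  shows "restrict f {..m} \<in> simplex_ops m n"
  using assms by (auto simp: simplex_ops_def mono_on_def)

lemma simplex_ops_le: "\<theta> \<in> simplex_ops m n \<Longrightarrow> i \<le> m \<Longrightarrow> \<theta> i \<le> n"
  by (auto simp: simplex_ops_def PiE_def Pi_def)

lemma simplex_ops_mono: "\<theta> \<in> simplex_ops m n \<Longrightarrow> i \<le> j \<Longrightarrow> j \<le> m \<Longrightarrow> \<theta> i \<le> \<theta> j"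
  by (auto simp: simplex_ops_def mono_on_def)

lemma simplex_ops_ext: "\<theta> \<in> simplex_ops m n \<Longrightarrow> \<theta> \<in> extensional {..m}"
  by (auto simp: simplex_ops_def PiE_def)

lemma simplex_ops_eqI:
  assumes "\<theta> \<in> simplex_ops m n" "\<theta>' \<in> simplex_ops m n'" "\<And>i. i \<le> m \<Longrightarrow> \<theta> i = \<theta>' i"
  shows "\<theta> = \<theta>'"
  using assms by (intro extensionalityI[OF simplex_ops_ext simplex_ops_ext]) auto

lemma simplex_ops_compose:
  "\<theta> \<in> simplex_ops m n \<Longrightarrow> \<eta> \<in> simplex_ops l m \<Longrightarrow> compose {..l} \<theta> \<eta> \<in> simplex_ops l n"
  unfolding compose_def
  by (rule simplex_opsI) (auto intro: simplex_ops_le simplex_ops_mono)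

lemma finite_simplex_ops: "finite (simplex_ops m n)"
  unfolding simplex_ops_def by (rule finite_subset[of _ "{..m} \<rightarrow>\<^sub>E {..n}"]) (auto intro: finite_PiE)

lemma simplex_push_compose:
  assumes \<eta>: "\<eta> \<in> simplex_ops l m"
  shows "simplex_push m \<theta> (simplex_push l \<eta> x) = simplex_push l (compose {..l} \<theta> \<eta>) x"
proof
  fix j
  let ?S = "{h. h \<le> l \<and> compose {..l} \<theta> \<eta> h = j}" and ?T = "{i. i \<le> m \<and> \<theta> i = j}"
  have "(\<Sum>i\<in>?T. \<Sum>h | h \<in> ?S \<and> \<eta> h = i. x h) = sum x ?S"
    by (rule sum.group) (auto simp: compose_def simplex_ops_le[OF \<eta>])
  moreover have "{h. h \<in> ?S \<and> \<eta> h = i} = {h. h \<le> l \<and> \<eta> h = i}" if "i \<in> ?T" for i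
    using that by (auto simp: compose_def)
  ultimately show "simplex_push m \<theta> (simplex_push l \<eta> x) j = simplex_push l (compose {..l} \<theta> \<eta>) x j"
    by (simp add: simplex_push_def)
qed

lemma simplex_push_id:
  assumes "\<And>i. i > n \<Longrightarrow> x i = 0"
  shows "simplex_push n (restrict id {..n}) x = x"
proof
  fix j
  have "{i. i \<le> n \<and> restrict id {..n} i = j} = (if j \<le> n then {j} else {})" by auto
  then show "simplex_push n (restrict id {..n}) x j = x j" using assms by (simp add: simplex_push_def)
qed

lemma simplex_push_zero:
  assumes "\<theta> \<in> simplex_ops m n" "j > n"
  shows "simplex_push m \<theta> x j = 0"
proof -
  have "{i. i \<le> m \<and> \<theta> i = j} = {}" using simplex_ops_le[OF assms(1)] assms(2) by force
  then show ?thesis by (simp only: simplex_push_def sum.empty)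
qed

lemma sum_simplex_push:
  assumes "\<theta> \<in> simplex_ops m n"
  shows "(\<Sum>j\<le>n. simplex_push m \<theta> x j) = (\<Sum>i\<le>m. x i)"
proof -
  have "(\<Sum>j\<in>{..n}. \<Sum>i | i \<in> {..m} \<and> \<theta> i = j. x i) = sum x {..m}"
    by (rule sum.group) (auto simp: simplex_ops_le[OF assms])
  then show ?thesis by (simp add: simplex_push_def)
qed

lemma standard_simplexI:
  assumes "\<And>i. i \<le> n \<Longrightarrow> 0 \<le> x i" "\<And>i. i > n \<Longrightarrow> x i = 0" "(\<Sum>i\<le>n. x i) = 1"
  shows "x \<in> standard_simplex n"
proof -
  have "x i \<le> 1" if "i \<le> n" for i
    using member_le_sum[of i "{..n}" x] that assms by auto
  then show ?thesis using assms unfolding standard_simplex_def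
    by (smt (verit, best) linorder_not_less mem_Collect_eq)
qed

lemma simplex_push_standard_simplex:
  assumes "\<theta> \<in> simplex_ops m n" "t \<in> standard_simplex m"
  shows "simplex_push m \<theta> t \<in> standard_simplex n"
proof (rule standard_simplexI)
  show "(\<Sum>j\<le>n. simplex_push m \<theta> t j) = 1"
    using assms by (simp add: sum_simplex_push standard_simplex_def)
  show "0 \<le> simplex_push m \<theta> t j" for j
    using assms by (auto simp: simplex_push_def standard_simplex_def intro: sum_nonneg)
qed (rule simplex_push_zero[OF assms(1)])

locale simplicial_set =
  fixes X :: "'a sset"
  assumes act_closed: "\<theta> \<in> simplex_ops m n \<Longrightarrow> x \<in> simps X n \<Longrightarrow> act X m n \<theta> x \<in> simps X m"
    and act_id: "x \<in> simps X n \<Longrightarrow> act X n n (restrict id {..n}) x = x"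
    and act_compose: "\<theta> \<in> simplex_ops m n \<Longrightarrow> \<eta> \<in> simplex_ops l m \<Longrightarrow> x \<in> simps X n \<Longrightarrow>
      act X l m \<eta> (act X m n \<theta> x) = act X l n (compose {..l} \<theta> \<eta>) x"

abbreviation simplex_topology :: "nat \<Rightarrow> (nat \<Rightarrow> real) topology" where
  "simplex_topology n \<equiv> subtopology (powertop_real UNIV) (standard_simplex n)"

definition cell :: "'a sset \<Rightarrow> nat \<Rightarrow> 'a \<Rightarrow> (nat \<Rightarrow> real) \<Rightarrow> ((nat \<times> 'a) \<times> (nat \<Rightarrow> real)) set" where
  "cell X n x t = realization_rel X `` {((n, x), t)}"

lemma topspace_prerealization:
  "topspace (prerealization X) = {((n, x), t) | n x t. x \<in> simps X n \<and> t \<in> standard_simplex n}"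
  by (auto simp: prerealization_def)

lemma topspace_realization:
  "topspace (realization X) = {cell X n x t | n x t. x \<in> simps X n \<and> t \<in> standard_simplex n}"
  by (auto simp: realization_def topspace_quotient_topology topspace_prerealization cell_def image_iff)

lemma topspace_realizationE:
  assumes "c \<in> topspace (realization X)"
  obtains n x t where "x \<in> simps X n" "t \<in> standard_simplex n" "c = cell X n x t"
  using assms by (auto simp: topspace_realization)

lemma openin_realization:
  "openin (realization X) U \<longleftrightarrow> U \<subseteq> topspace (realization X) \<and>
     (\<forall>n. \<forall>x\<in>simps X n. openin (simplex_topology n) {t \<in> standard_simplex n. cell X n x t \<in> U})"
proof -
  show ?thesis
    unfolding realization_def openin_quotient_topology topspace_quotient_topology
    unfolding prerealization_def openin_sum_topology cell_def
    by (auto cong: conj_cong)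
qed

lemma continuous_map_cell:
  assumes "x \<in> simps X n"
  shows "continuous_map (simplex_topology n) (realization X) (cell X n x)"
  unfolding continuous_map_def
proof (intro conjI allI impI)
  show "cell X n x \<in> topspace (simplex_topology n) \<rightarrow> topspace (realization X)"
    using assms by (auto simp: topspace_realization)
  fix U assume "openin (realization X) U"
  then show "openin (simplex_topology n) {t \<in> topspace (simplex_topology n). cell X n x t \<in> U}"
    using assms unfolding openin_realization by simp
qed

lemma continuous_map_from_realization:
  assumes "\<And>n x. x \<in> simps X n \<Longrightarrow> continuous_map (simplex_topology n) Z (\<lambda>t. f (cell X n x t))"
  shows "continuous_map (realization X) Z f"
  unfolding continuous_map_def
proof (intro conjI allI impI)
  show "f \<in> topspace (realization X) \<rightarrow> topspace Z"
    using continuous_map_funspace[OF assms] by (auto simp: topspace_realization Pi_def)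
  fix U assume U: "openin Z U"
  show "openin (realization X) {c \<in> topspace (realization X). f c \<in> U}"
    unfolding openin_realization
  proof (intro conjI allI ballI)
    fix n x assume x: "x \<in> simps X n"
    have "{t \<in> standard_simplex n. cell X n x t \<in> {c \<in> topspace (realization X). f c \<in> U}} =
      {t \<in> topspace (simplex_topology n). f (cell X n x t) \<in> U}"
      using x by (auto simp: topspace_realization)
    then show "openin (simplex_topology n) {t \<in> standard_simplex n. cell X n x t \<in> {c \<in> topspace (realization X). f c \<in> U}}"
      using openin_continuous_map_preimage[OF assms[OF x] U] by simp
  qed auto
qed

section \<open>Equality of points in the realization\<close>

context simplicial_set
begin

lemma realization_gen_topspace:
  "realization_gen X \<subseteq> topspace (prerealization X) \<times> topspace (prerealization X)"
  using act_closed simplex_push_standard_simplex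
  by (fastforce simp: realization_gen_def topspace_prerealization)

lemma equiv_realization_rel: "equiv (topspace (prerealization X)) (realization_rel X)"
proof -
  have "sym ((realization_gen X \<union> (realization_gen X)\<inverse>)\<^sup>*)"
    by (intro sym_rtrancl) (auto simp: sym_def)
  moreover have "trans ((realization_gen X \<union> (realization_gen X)\<inverse>)\<^sup>*)" by (rule trans_rtrancl)
  ultimately show ?thesis
    unfolding equiv_def realization_rel_def refl_on_def sym_def trans_def by blast
qed

lemma realization_rel_invariant:
  assumes "(z, z') \<in> realization_rel X" and "\<And>z z'. (z, z') \<in> realization_gen X \<Longrightarrow> Q z \<longleftrightarrow> Q z'"
  shows "Q z \<longleftrightarrow> Q z'"
proof -
  have "(z, z') \<in> (realization_gen X \<union> (realization_gen X)\<inverse>)\<^sup>*"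
    using assms(1) by (auto simp: realization_rel_def)
  then show ?thesis by induction (use assms(2) in blast)+
qed

lemma cell_eq_iff:
  assumes "x \<in> simps X n" "t \<in> standard_simplex n" "x' \<in> simps X n'" "t' \<in> standard_simplex n'"
  shows "cell X n x t = cell X n' x' t' \<longleftrightarrow> (((n, x), t), ((n', x'), t')) \<in> realization_rel X"
  unfolding cell_def using assms
  by (intro eq_equiv_class_iff[OF equiv_realization_rel, unfolded quotient_def]
     eq_equiv_class_iff2[OF equiv_realization_rel]) (auto simp: topspace_prerealization)

text \<open>The equivalence relation is generated by single structure maps, so a property is
  constant on classes as soon as each generator preserves it. Later well-definedness arguments on
  realizations use this rule in place of a normal form for points.\<close>

lemma cell_eq_invariant:
  assumes "cell X n x t = cell X n' x' t'"
    and "x \<in> simps X n" "t \<in> standard_simplex n" "x' \<in> simps X n'" "t' \<in> standard_simplex n'"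
    and "\<And>m n \<theta> x t. \<theta> \<in> simplex_ops m n \<Longrightarrow> x \<in> simps X n \<Longrightarrow> t \<in> standard_simplex m \<Longrightarrow>
      Q m (act X m n \<theta> x) t \<longleftrightarrow> Q n x (simplex_push m \<theta> t)"
  shows "Q n x t \<longleftrightarrow> Q n' x' t'"
proof -
  have "(case ((n, x), t) of ((n, x), t) \<Rightarrow> Q n x t) \<longleftrightarrow> (case ((n', x'), t') of ((n, x), t) \<Rightarrow> Q n x t)"
    by (rule realization_rel_invariant[of "((n, x), t)" "((n', x'), t')"])
      (use assms cell_eq_iff in \<open>auto simp: realization_gen_def\<close>)
  then show ?thesis by simp
qed

lemma cell_act:
  assumes "\<theta> \<in> simplex_ops m n" "x \<in> simps X n" "t \<in> standard_simplex m"
  shows "cell X m (act X m n \<theta> x) t = cell X n x (simplex_push m \<theta> t)"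
proof -
  have "(((m, act X m n \<theta> x), t), ((n, x), simplex_push m \<theta> t)) \<in> realization_gen X"
    using assms by (auto simp: realization_gen_def)
  then show ?thesis
    using assms act_closed simplex_push_standard_simplex realization_gen_topspace
    by (subst cell_eq_iff) (auto simp: realization_rel_def)
qed

lemma mem_cell:
  assumes "x \<in> simps X n" "t \<in> standard_simplex n"
  shows "((n, x), t) \<in> cell X n x t"
  using assms equiv_realization_rel unfolding cell_def
  by (intro equiv_class_self) (auto simp: topspace_prerealization)

lemma mem_cellD:
  assumes "((n', x'), t') \<in> cell X n x t"
  shows "x' \<in> simps X n'" "t' \<in> standard_simplex n'" "x \<in> simps X n" "t \<in> standard_simplex n"
    "cell X n' x' t' = cell X n x t"
proof -
  have r: "(((n, x), t), ((n', x'), t')) \<in> realization_rel X" using assms by (simp add: cell_def)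
  then show *: "x' \<in> simps X n'" "t' \<in> standard_simplex n'" "x \<in> simps X n" "t \<in> standard_simplex n"
    by (auto simp: realization_rel_def topspace_prerealization)
  show "cell X n' x' t' = cell X n x t" using r * cell_eq_iff by metis
qed

end

text \<open>\<open>realization_map\<close> unites the classes of the images of all members of a
  class. Related members have related images, so these classes coincide, and \<open>mem_cell\<close>
  shows that there is at least one.\<close>

lemma realization_map_cell:
  assumes X: "simplicial_set X" and Y: "simplicial_set Y" and f: "simplicial_map X Y f"
    and x: "x \<in> simps X n" "t \<in> standard_simplex n"
  shows "realization_map Y f (cell X n x t) = cell Y n (f n x) t"
proof -
  interpret X: simplicial_set X by fact
  interpret Y: simplicial_set Y by fact
  have f1: "f n x \<in> simps Y n" if "x \<in> simps X n" for n x
    using f that by (auto simp: simplicial_map_def)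
  have *: "cell Y n' (f n' x') t' = cell Y n (f n x) t" if "((n', x'), t') \<in> cell X n x t" for n' x' t'
  proof -
    note mem = X.mem_cellD[OF that]
    have inv: "(cell Y m (f m (act X m k \<theta> y)) s = cell Y n (f n x) t) =
        (cell Y k (f k y) (simplex_push m \<theta> s) = cell Y n (f n x) t)"
      if "\<theta> \<in> simplex_ops m k" "y \<in> simps X k" "s \<in> standard_simplex m" for m k \<theta> y s
    proof -
      have "f m (act X m k \<theta> y) = act Y m k \<theta> (f k y)"
        using f that by (auto simp: simplicial_map_def)
      then show ?thesis using Y.cell_act[OF that(1) f1[OF that(2)] that(3)] by simp
    qed
    show ?thesis
      using X.cell_eq_invariant[OF mem(5) mem(1,2) x,
          of "\<lambda>n' x' t'. cell Y n' (f n' x') t' = cell Y n (f n x) t"] inv by blast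
  qed
  have "realization_map Y f (cell X n x t) = (\<Union>z\<in>cell X n x t. case z of ((n', x'), t') \<Rightarrow> cell Y n' (f n' x') t')"
    unfolding realization_map_def by (auto simp: cell_def)
  also have "\<dots> = (\<Union>z\<in>cell X n x t. cell Y n (f n x) t)"
    using * by (intro SUP_cong) auto
  also have "\<dots> = cell Y n (f n x) t" using X.mem_cell[OF x] by auto
  finally show ?thesis .
qed

lemma continuous_realization_map:
  assumes X: "simplicial_set X" and Y: "simplicial_set Y" and f: "simplicial_map X Y f"
  shows "continuous_map (realization X) (realization Y) (realization_map Y f)"
proof (rule continuous_map_from_realization)
  fix n x assume x: "x \<in> simps X n"
  have "f n x \<in> simps Y n" using f x by (auto simp: simplicial_map_def)
  from continuous_map_cell[OF this]
  show "continuous_map (simplex_topology n) (realization Y) (\<lambda>t. realization_map Y f (cell X n x t))"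
    by (rule continuous_map_eq) (simp add: realization_map_cell[OF X Y f x])
qed

section \<open>Weights of faces and nondegenerate simplices\<close>

definition faces :: "nat \<Rightarrow> nat \<Rightarrow> (nat \<Rightarrow> nat) set" where
  "faces k n = {J \<in> simplex_ops k n. inj_on J {..k}}"

lemma finite_faces: "finite (faces k n)"
  using finite_simplex_ops[of k n] by (simp add: faces_def)

text \<open>The weight that the point \<open>t\<close> gives to the face \<open>J\<close>. It is
  polynomial in the barycentric coordinates and, on the simplex, positive exactly where all vertices
  of \<open>J\<close> have positive coordinates.\<close>

abbreviation cprod :: "nat \<Rightarrow> (nat \<Rightarrow> real) \<Rightarrow> (nat \<Rightarrow> nat) \<Rightarrow> real" where
  "cprod k t J \<equiv> \<Prod>i\<le>k. t (J i)"

lemma cprod_nonneg: "t \<in> standard_simplex n \<Longrightarrow> 0 \<le> cprod k t J"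
  by (auto simp: standard_simplex_def intro: prod_nonneg)

definition nondegenerate :: "'a sset \<Rightarrow> nat \<Rightarrow> 'a \<Rightarrow> bool" where
  "nondegenerate X k \<sigma> \<longleftrightarrow> (\<forall>m<k. \<forall>\<theta>\<in>simplex_ops k m. \<forall>\<rho>\<in>simps X m. act X k m \<theta> \<rho> \<noteq> \<sigma>)"

text \<open>By \<open>prod_sum_PiE\<close> the product of sums expands over all choices of
  \<open>J i\<close> above \<open>I i\<close>. As \<open>\<theta>\<close> is monotone and
  \<open>I\<close> is monotone and injective, each such choice is itself monotone and injective.
  Hence the weight of \<open>I\<close> at the pushed point is the total weight of the faces that
  \<open>\<theta>\<close> sends to \<open>I\<close>.\<close>

lemma sum_faces_push:
  assumes \<theta>: "\<theta> \<in> simplex_ops m n"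
  shows "(\<Sum>J | J \<in> faces k m \<and> compose {..k} \<theta> J \<in> faces k n \<and> Q (compose {..k} \<theta> J). \<Prod>i\<le>k. t (J i)) =
    (\<Sum>I | I \<in> faces k n \<and> Q I. \<Prod>i\<le>k. simplex_push m \<theta> t (I i))"
proof -
  let ?S = "{J. J \<in> faces k m \<and> compose {..k} \<theta> J \<in> faces k n \<and> Q (compose {..k} \<theta> J)}"
  let ?T = "{I. I \<in> faces k n \<and> Q I}"
  have fib: "{J \<in> ?S. compose {..k} \<theta> J = I} = (\<Pi>\<^sub>E i\<in>{..k}. {j. j \<le> m \<and> \<theta> j = I i})" if I: "I \<in> ?T" for I
  proof (intro subset_antisym subsetI)
    fix J assume J: "J \<in> {J \<in> ?S. compose {..k} \<theta> J = I}"
    then have "\<theta> (J i) = I i" "J i \<le> m" if "i \<le> k" for i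
      using that by (auto simp: compose_def faces_def intro: simplex_ops_le)
    moreover have "J \<in> extensional {..k}" using J by (auto simp: faces_def intro: simplex_ops_ext)
    ultimately show "J \<in> (\<Pi>\<^sub>E i\<in>{..k}. {j. j \<le> m \<and> \<theta> j = I i})" by (auto simp: PiE_def)
  next
    fix J assume J: "J \<in> (\<Pi>\<^sub>E i\<in>{..k}. {j. j \<le> m \<and> \<theta> j = I i})"
    then have J1: "J i \<le> m" "\<theta> (J i) = I i" if "i \<le> k" for i using that by (auto simp: PiE_def Pi_def)
    have Iops: "I \<in> simplex_ops k n" "inj_on I {..k}" using I by (auto simp: faces_def)
    have Jmono: "J i \<le> J i'" if "i \<le> i'" "i' \<le> k" for i i'
    proof (rule ccontr)
      assume "\<not> J i \<le> J i'"
      then have "\<theta> (J i') \<le> \<theta> (J i)" using J1 that by (intro simplex_ops_mono[OF \<theta>]) auto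
      then have "I i = I i'" using J1 that simplex_ops_mono[OF Iops(1) that] by auto
      then have "i = i'" using Iops that by (auto simp: inj_on_def)
      with \<open>\<not> J i \<le> J i'\<close> show False by simp
    qed
    have Jext: "J \<in> extensional {..k}" using J by (auto simp: PiE_def)
    have "J \<in> simplex_ops k m"
      using simplex_opsI[of k J m, OF J1(1) Jmono] extensional_restrict[OF Jext] by simp
    moreover have "inj_on J {..k}"
    proof (rule inj_onI)
      fix i i' assume "i \<in> {..k}" "i' \<in> {..k}" "J i = J i'"
      then show "i = i'" using J1(2)[of i] J1(2)[of i'] Iops(2) by (simp add: inj_on_def)
    qed
    ultimately have "J \<in> faces k m" by (simp add: faces_def)
    moreover have "compose {..k} \<theta> J = I"
      by (rule extensionalityI[of _ "{..k}"]) (auto simp: compose_def J1 simplex_ops_ext[OF Iops(1)])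
    ultimately show "J \<in> {J \<in> ?S. compose {..k} \<theta> J = I}" using I by auto
  qed
  have "(\<Sum>J\<in>?S. \<Prod>i\<le>k. t (J i)) = (\<Sum>I\<in>?T. \<Sum>J | J \<in> ?S \<and> compose {..k} \<theta> J = I. \<Prod>i\<le>k. t (J i))"
    by (rule sum.group[symmetric]) (auto intro: finite_subset[OF _ finite_faces[of k m]] finite_subset[OF _ finite_faces[of k n]])
  also have "\<dots> = (\<Sum>I\<in>?T. \<Prod>i\<le>k. simplex_push m \<theta> t (I i))"
  proof (rule sum.cong[OF refl])
    fix I assume I: "I \<in> ?T"
    have "(\<Prod>i\<le>k. simplex_push m \<theta> t (I i)) = (\<Sum>J\<in>(\<Pi>\<^sub>E i\<in>{..k}. {j. j \<le> m \<and> \<theta> j = I i}). \<Prod>i\<le>k. t (J i))"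
      unfolding simplex_push_def by (rule prod_sum_PiE) auto
    then show "(\<Sum>J | J \<in> ?S \<and> compose {..k} \<theta> J = I. \<Prod>i\<le>k. t (J i)) = (\<Prod>i\<le>k. simplex_push m \<theta> t (I i))"
      using fib[OF I] by simp
  qed
  finally show ?thesis .
qed

lemma continuous_map_coordinates:
  fixes k :: nat and F :: "(nat \<Rightarrow> nat) set"
  shows "continuous_map (simplex_topology n) euclideanreal (\<lambda>t. sum (cprod k t) F)"
proof -
  have "continuous_map (simplex_topology n) euclideanreal (\<lambda>t. t i)" for i
    by (intro continuous_map_from_subtopology continuous_map_product_projection) auto
  then show ?thesis
  proof (cases "finite F")
    case True then show ?thesis
      by (intro continuous_map_sum continuous_map_prod) (auto intro: \<open>\<And>i. continuous_map _ _ (\<lambda>t. t i)\<close>)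
  qed simp
qed

context simplicial_set
begin

text \<open>Otherwise monotonicity gives two neighbours \<open>a\<close> and \<open>Suc a\<close>
  with the same image, so \<open>\<alpha>\<close> factors through the map \<open>?\<beta>\<close>
  that merges them, and \<open>\<sigma>\<close> would be degenerate.\<close>

lemma nondegenerate_inj:
  assumes nd: "nondegenerate X k \<sigma>" and \<alpha>: "\<alpha> \<in> simplex_ops k n" and x: "x \<in> simps X n"
    and eq: "act X k n \<alpha> x = \<sigma>"
  shows "\<alpha> \<in> faces k n"
proof -
  have "inj_on \<alpha> {..k}"
  proof (rule ccontr)
    assume "\<not> inj_on \<alpha> {..k}"
    then obtain a b where ab: "a < b" "b \<le> k" "\<alpha> a = \<alpha> b"
      unfolding inj_on_def by (metis atMost_iff nat_neq_iff)
    then have i: "\<alpha> a = \<alpha> (Suc a)" "Suc a \<le> k"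
      using simplex_ops_mono[OF \<alpha>, of a "Suc a"] simplex_ops_mono[OF \<alpha>, of "Suc a" b] by auto
    let ?\<beta> = "restrict (\<lambda>j. if j \<le> a then j else j - 1) {..k}"
    let ?\<delta> = "restrict (\<lambda>j. if j \<le> a then \<alpha> j else \<alpha> (Suc j)) {..k - 1}"
    have \<beta>: "?\<beta> \<in> simplex_ops k (k - 1)" using i by (intro simplex_opsI) auto
    have \<delta>: "?\<delta> \<in> simplex_ops (k - 1) n"
    proof (rule simplex_opsI)
      show "(if j \<le> a then \<alpha> j else \<alpha> (Suc j)) \<le> n" if "j \<le> k - 1" for j
        using that i by (auto intro: simplex_ops_le[OF \<alpha>])
      show "(if j \<le> a then \<alpha> j else \<alpha> (Suc j)) \<le> (if j' \<le> a then \<alpha> j' else \<alpha> (Suc j'))"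
        if "j \<le> j'" "j' \<le> k - 1" for j j'
        using that i by (auto intro: simplex_ops_mono[OF \<alpha>])
    qed
    have "compose {..k} ?\<delta> ?\<beta> = \<alpha>"
    proof (rule simplex_ops_eqI[OF simplex_ops_compose[OF \<delta> \<beta>] \<alpha>])
      fix j assume "j \<le> k"
      then show "compose {..k} ?\<delta> ?\<beta> j = \<alpha> j"
        using i by (cases "j = Suc a") (auto simp: compose_def)
    qed
    then have "act X k (k - 1) ?\<beta> (act X (k - 1) n ?\<delta> x) = \<sigma>"
      using act_compose[OF \<delta> \<beta> x] eq by simp
    moreover have "k - 1 < k" using i by simp
    ultimately show False
      using nd \<beta> act_closed[OF \<delta> x] unfolding nondegenerate_def by blast
  qed
  then show ?thesis using \<alpha> by (simp add: faces_def)
qed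

text \<open>In a representative of least dimension the simplex is nondegenerate and no coordinate
  vanishes, since either defect yields a representative of smaller dimension.\<close>

lemma nondegenerate_representative:
  assumes "c \<in> topspace (realization X)"
  obtains k \<sigma> t where "\<sigma> \<in> simps X k" "nondegenerate X k \<sigma>" "t \<in> standard_simplex k"
    "\<And>i. i \<le> k \<Longrightarrow> 0 < t i" "c = cell X k \<sigma> t"
proof -
  define P where "P k \<longleftrightarrow> (\<exists>\<sigma> t. \<sigma> \<in> simps X k \<and> t \<in> standard_simplex k \<and> c = cell X k \<sigma> t)" for k
  have "\<exists>k. P k" using assms by (auto simp: P_def topspace_realization)
  then obtain k where k: "P k" "\<And>j. j < k \<Longrightarrow> \<not> P j" using exists_least_iff[of P] by blast
  then obtain \<sigma> t where s: "\<sigma> \<in> simps X k" "t \<in> standard_simplex k" "c = cell X k \<sigma> t"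
    by (auto simp: P_def)
  have "nondegenerate X k \<sigma>" unfolding nondegenerate_def
  proof (intro allI impI ballI notI)
    fix m \<theta> \<rho> assume *: "m < k" "\<theta> \<in> simplex_ops k m" "\<rho> \<in> simps X m" "act X k m \<theta> \<rho> = \<sigma>"
    then have "c = cell X m \<rho> (simplex_push k \<theta> t)" using cell_act s by metis
    then have "P m" using * s(2) simplex_push_standard_simplex unfolding P_def by blast
    with k * show False by blast
  qed
  moreover have "0 < t i" if "i \<le> k" for i
  proof (rule ccontr)
    assume "\<not> 0 < t i"
    then have ti: "t i = 0" using s by (auto simp: standard_simplex_def intro: order_antisym)
    have "k \<noteq> 0"
    proof
      assume "k = 0"
      then show False using s(2) ti that by (simp add: standard_simplex_def)
    qed
    \<comment> \<open>\<open>?d\<close> is the face opposite to the vertex \<open>i\<close>, and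
      \<open>?t\<close> drops the vanishing coordinate \<open>t i\<close>; so \<open>?d\<close>
      pushes \<open>?t\<close> back to \<open>t\<close>.\<close>
    let ?d = "restrict (\<lambda>j. if j < i then j else Suc j) {..k - 1}"
    let ?t = "\<lambda>j. if j < i then t j else t (Suc j)"
    have d: "?d \<in> simplex_ops (k - 1) k" using \<open>k \<noteq> 0\<close> by (intro simplex_opsI) auto
    have push: "simplex_push (k - 1) ?d ?t = t"
    proof
      fix j
      have "{l. l \<le> k - 1 \<and> ?d l = j} = (if j \<le> k \<and> j \<noteq> i then {if j < i then j else j - 1} else {})"
        using that \<open>k \<noteq> 0\<close> by (auto split: if_splits)
      then show "simplex_push (k - 1) ?d ?t j = t j"
        using ti s by (auto simp: simplex_push_def standard_simplex_def)
    qed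
    have "?t \<in> standard_simplex (k - 1)"
    proof (rule standard_simplexI)
      have "(\<Sum>j\<le>k - 1. ?t j) = (\<Sum>j\<le>k. simplex_push (k - 1) ?d ?t j)"
        using sum_simplex_push[OF d] by simp
      then show "(\<Sum>j\<le>k - 1. ?t j) = 1" using push s by (simp add: standard_simplex_def)
      show "0 \<le> ?t j" for j using s(2) by (simp add: standard_simplex_def)
      show "?t j = 0" if "j > k - 1" for j
      proof -
        have "\<not> j < i" "Suc j > k" using that \<open>i \<le> k\<close> by auto
        then show ?thesis using s(2) by (simp add: standard_simplex_def)
      qed
    qed
    moreover have "c = cell X (k - 1) (act X (k - 1) k ?d \<sigma>) ?t"
      using cell_act[OF d s(1) calculation] unfolding push s(3) by (rule sym)
    ultimately have "P (k - 1)" using act_closed[OF d s(1)] unfolding P_def by blast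
    then show False using k \<open>k \<noteq> 0\<close> by auto
  qed
  ultimately show ?thesis using that s by blast
qed

text \<open>
  The total weight of the faces in \<open>A\<close> is compatible with degeneracies as long as the members of \<open>A\<close>
  are nondegenerate.
\<close>

definition copies :: "nat \<Rightarrow> 'a set \<Rightarrow> nat \<Rightarrow> 'a \<Rightarrow> (nat \<Rightarrow> nat) set" where
  "copies k A n x = {J. J \<in> faces k n \<and> act X k n J x \<in> A}"

lemma finite_copies: "finite (copies k A n x)"
  using finite_faces[of k n] by (simp add: copies_def)

lemma copies_ops: "J \<in> copies k A n x \<Longrightarrow> J \<in> simplex_ops k n"
  by (simp add: copies_def faces_def)

text \<open>If the composite of \<open>\<theta>\<close> and \<open>J\<close> takes \<open>x\<close>
  to a nondegenerate simplex, it is injective by \<open>nondegenerate_inj\<close>. So the faces of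
  \<open>act X m n \<theta> x\<close> in \<open>A\<close> all lie over faces of
  \<open>x\<close>.\<close>

lemma copies_act:
  assumes nd: "\<And>\<sigma>. \<sigma> \<in> A \<Longrightarrow> nondegenerate X k \<sigma>" and \<theta>: "\<theta> \<in> simplex_ops m n" and x: "x \<in> simps X n"
  shows "copies k A m (act X m n \<theta> x) =
    {J. J \<in> faces k m \<and> compose {..k} \<theta> J \<in> faces k n \<and> compose {..k} \<theta> J \<in> copies k A n x}"
  using act_compose[OF \<theta> _ x] nondegenerate_inj[OF nd simplex_ops_compose[OF \<theta>] x]
  by (auto simp: faces_def copies_def)

lemma sum_copies_act:
  assumes nd: "\<And>\<sigma>. \<sigma> \<in> A \<Longrightarrow> nondegenerate X k \<sigma>" and \<theta>: "\<theta> \<in> simplex_ops m n" and x: "x \<in> simps X n"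
  shows "sum (cprod k t) (copies k A m (act X m n \<theta> x)) = sum (cprod k (simplex_push m \<theta> t)) (copies k A n x)"
proof -
  have "copies k A m (act X m n \<theta> x) =
    {J. J \<in> faces k m \<and> compose {..k} \<theta> J \<in> faces k n \<and> compose {..k} \<theta> J \<in> copies k A n x}"
    by (rule copies_act) (use assms in auto)
  then show ?thesis
    using sum_faces_push[OF \<theta>, where k = k and Q = "\<lambda>I. I \<in> copies k A n x" and t = t]
    by (simp add: copies_def)
qed

end

section \<open>The realization of a simplicial covering\<close>

lemma majorities_meet:
  fixes f :: "'a \<Rightarrow> real"
  assumes "finite T" "S \<subseteq> T" "S' \<subseteq> T" "\<And>x. x \<in> T \<Longrightarrow> 0 \<le> f x"
    and "sum f T < 2 * sum f S" "sum f T < 2 * sum f S'"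
  shows "S \<inter> S' \<noteq> {}"
proof
  assume "S \<inter> S' = {}"
  then have "sum f S + sum f S' = sum f (S \<union> S')"
    using assms finite_subset by (metis sum.union_disjoint)
  also have "\<dots> \<le> sum f T" using assms by (intro sum_mono2) auto
  finally show False using assms by linarith
qed

text \<open>Injectivity and monotonicity give \<open>i \<le> J i\<close>. A permutation does not
  change the sum of the indices, so equality holds for every \<open>i\<close>.\<close>

lemma faces_self:
  assumes "J \<in> faces k k"
  shows "J = restrict id {..k}"
proof -
  have J: "J \<in> simplex_ops k k" "inj_on J {..k}" using assms by (auto simp: faces_def)
  have ge: "i \<le> J i" if "i \<le> k" for i
    using that
  proof (induction i)
    case (Suc i)
    have "J i \<le> J (Suc i)" "J i \<noteq> J (Suc i)"
      using Suc simplex_ops_mono[OF J(1), of i "Suc i"] inj_onD[OF J(2), of i "Suc i"] by auto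
    then show ?case using Suc by simp
  qed simp
  have "J ` {..k} = {..k}"
    using J by (intro endo_inj_surj) (auto intro: simplex_ops_le)
  then have "(\<Sum>i\<le>k. i) = (\<Sum>i\<le>k. J i)"
    using sum.reindex[OF J(2), of id] by simp
  then have "J i = i" if "i \<le> k" for i
    using sum_mono_inv[of "\<lambda>i. i" "{..k}" J i] ge that by auto
  then show ?thesis using simplex_ops_ext[OF J(1)] by (intro extensionalityI[of _ "{..k}"]) auto
qed

text \<open>The bijections between fibres are the simplicial form of unique lifting. That the
  realization is a covering in the topological sense is a consequence,
  \<open>sheeted_realization\<close>.\<close>

locale simplicial_covering = C: simplicial_set C + Y: simplicial_set Y
  for C :: "'c sset" and Y :: "'y sset" +
  fixes \<pi> :: "nat \<Rightarrow> 'c \<Rightarrow> 'y"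
  assumes simplicial_map: "simplicial_map C Y \<pi>"
    and fibre_bij: "\<theta> \<in> simplex_ops m n \<Longrightarrow> y \<in> simps Y n \<Longrightarrow>
      bij_betw (act C m n \<theta>) {x \<in> simps C n. \<pi> n x = y} {x \<in> simps C m. \<pi> m x = act Y m n \<theta> y}"
begin

abbreviation fibre :: "nat \<Rightarrow> 'y \<Rightarrow> 'c set" where
  "fibre n y \<equiv> {x \<in> simps C n. \<pi> n x = y}"

abbreviation proj where "proj \<equiv> realization_map Y \<pi>"

lemma proj_closed: "x \<in> simps C n \<Longrightarrow> \<pi> n x \<in> simps Y n"
  using simplicial_map by (auto simp: simplicial_map_def)

lemma proj_act: "\<theta> \<in> simplex_ops m n \<Longrightarrow> x \<in> simps C n \<Longrightarrow> \<pi> m (act C m n \<theta> x) = act Y m n \<theta> (\<pi> n x)"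
  using simplicial_map by (auto simp: simplicial_map_def)

lemmas proj_cell = realization_map_cell[OF C.simplicial_set_axioms Y.simplicial_set_axioms simplicial_map]

text \<open>Structure maps are onto between fibres, so the identifications that relate two
  representatives of a point of \<open>Y\<close> can be followed in \<open>C\<close>. A point over
  \<open>cell Y n y t\<close> therefore keeps the coordinates \<open>t\<close> and only has to
  choose a simplex over \<open>y\<close>.\<close>

lemma fibre_cell:
  assumes w: "w \<in> topspace (realization C)" and y: "y \<in> simps Y n" "t \<in> standard_simplex n"
    and eq: "proj w = cell Y n y t"
  obtains x where "x \<in> fibre n y" "w = cell C n x t"
proof -
  obtain n' x' t' where x': "x' \<in> simps C n'" "t' \<in> standard_simplex n'" "w = cell C n' x' t'"
    using w by (rule topspace_realizationE)
  define Q where "Q n y t \<longleftrightarrow> (\<exists>x\<in>fibre n y. w = cell C n x t)" for n y t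
  have "Q n' (\<pi> n' x') t' \<longleftrightarrow> Q n y t"
  proof (rule Y.cell_eq_invariant)
    show "cell Y n' (\<pi> n' x') t' = cell Y n y t" using eq x' by (simp add: proj_cell)
    fix m n \<theta> y t assume \<theta>: "\<theta> \<in> simplex_ops m n" and y: "y \<in> simps Y n" and t: "t \<in> standard_simplex m"
    have "fibre m (act Y m n \<theta> y) = act C m n \<theta> ` fibre n y"
      using fibre_bij[OF \<theta> y] by (simp add: bij_betw_def)
    then show "Q m (act Y m n \<theta> y) t \<longleftrightarrow> Q n y (simplex_push m \<theta> t)"
      using C.cell_act[OF \<theta> _ t] unfolding Q_def by auto
  qed (use x' y proj_closed in auto)
  moreover have "Q n' (\<pi> n' x') t'" using x' by (auto simp: Q_def)
  ultimately show ?thesis using that by (auto simp: Q_def)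
qed

lemma continuous_proj: "continuous_map (realization C) (realization Y) proj"
  by (rule continuous_realization_map[OF C.simplicial_set_axioms Y.simplicial_set_axioms simplicial_map])

text \<open>By \<open>fibre_cell\<close>, the part of a simplex \<open>y\<close> that maps into the
  image of \<open>U\<close> is the union, over the simplices above \<open>y\<close>, of the parts
  that map into \<open>U\<close>.\<close>

lemma open_proj: "open_map (realization C) (realization Y) proj"
  unfolding open_map_def
proof (intro allI impI)
  fix U assume U: "openin (realization C) U"
  have Usub: "U \<subseteq> topspace (realization C)" using U openin_subset by blast
  show "openin (realization Y) (proj ` U)"
    unfolding openin_realization
  proof (intro conjI allI ballI)
    show "proj ` U \<subseteq> topspace (realization Y)"
      using continuous_map_image_subset_topspace[OF continuous_proj] Usub by blast
    fix n y assume y: "y \<in> simps Y n"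
    have "{t \<in> standard_simplex n. cell Y n y t \<in> proj ` U} =
        (\<Union>x\<in>fibre n y. {t \<in> standard_simplex n. cell C n x t \<in> U})"
    proof (intro subset_antisym subsetI)
      fix t assume t: "t \<in> {t \<in> standard_simplex n. cell Y n y t \<in> proj ` U}"
      then obtain w where w: "w \<in> U" "proj w = cell Y n y t" by auto
      have "w \<in> topspace (realization C)" using w Usub by auto
      then obtain x where "x \<in> fibre n y" "w = cell C n x t"
        using fibre_cell[of w y n t] t y w by blast
      then show "t \<in> (\<Union>x\<in>fibre n y. {t \<in> standard_simplex n. cell C n x t \<in> U})"
        using w t by auto
    next
      fix t assume "t \<in> (\<Union>x\<in>fibre n y. {t \<in> standard_simplex n. cell C n x t \<in> U})"
      then obtain x where x: "x \<in> simps C n" "\<pi> n x = y" "t \<in> standard_simplex n" "cell C n x t \<in> U" by auto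
      then have "cell Y n y t = proj (cell C n x t)" by (simp add: proj_cell)
      then show "t \<in> {t \<in> standard_simplex n. cell Y n y t \<in> proj ` U}" using x by auto
    qed
    then show "openin (simplex_topology n) {t \<in> standard_simplex n. cell Y n y t \<in> proj ` U}"
      using U unfolding openin_realization by auto
  qed
qed

section \<open>Local trivialisation by weighted majorities\<close>

lemma nondegenerate_fibre:
  assumes "nondegenerate Y k \<sigma>" "a \<in> fibre k \<sigma>"
  shows "nondegenerate C k a"
  unfolding nondegenerate_def
proof (intro allI impI ballI notI)
  fix m \<theta> \<rho> assume "m < k" "\<theta> \<in> simplex_ops k m" "\<rho> \<in> simps C m" "act C k m \<theta> \<rho> = a"
  then show False
    using assms proj_act[of \<theta> k m \<rho>] proj_closed[of \<rho> m] unfolding nondegenerate_def by auto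
qed

text \<open>
  Over a simplex \<open>y\<close>, each face \<open>J\<close> of \<open>y\<close> equal to \<open>\<sigma>\<close> identifies the fibre of \<open>y\<close> with that of
  \<open>\<sigma>\<close>. The covering is trivialised where one of these identifications carries more than half of
  the total weight of the faces \<open>\<sigma>\<close>; the majority then picks the sheet.
\<close>

definition parallel :: "nat \<Rightarrow> 'y \<Rightarrow> nat \<Rightarrow> 'y \<Rightarrow> (nat \<Rightarrow> nat) \<Rightarrow> (nat \<Rightarrow> nat) set" where
  "parallel k \<sigma> n y I = {J \<in> Y.copies k {\<sigma>} n y. \<forall>x\<in>fibre n y. act C k n J x = act C k n I x}"

definition majority :: "nat \<Rightarrow> 'y \<Rightarrow> nat \<Rightarrow> 'y \<Rightarrow> (nat \<Rightarrow> real) \<Rightarrow> bool" where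
  "majority k \<sigma> n y t \<longleftrightarrow> (\<exists>I\<in>Y.copies k {\<sigma>} n y.
     sum (cprod k t) (Y.copies k {\<sigma>} n y) < 2 * sum (cprod k t) (parallel k \<sigma> n y I))"

lemma copies_act:
  assumes "nondegenerate Y k \<sigma>" "\<theta> \<in> simplex_ops m n" "y \<in> simps Y n"
  shows "Y.copies k {\<sigma>} m (act Y m n \<theta> y) =
    {J. J \<in> faces k m \<and> compose {..k} \<theta> J \<in> faces k n \<and> compose {..k} \<theta> J \<in> Y.copies k {\<sigma>} n y}"
  using assms by (intro Y.copies_act) auto

text \<open>Every simplex over \<open>act Y m n \<theta> y\<close> comes from one over
  \<open>y\<close>, so equality of two identifications can be tested over \<open>y\<close> on the
  composites with \<open>\<theta>\<close>.\<close>

lemma parallel_act: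
  assumes nd: "nondegenerate Y k \<sigma>" and \<theta>: "\<theta> \<in> simplex_ops m n" and y: "y \<in> simps Y n"
    and I: "I \<in> Y.copies k {\<sigma>} m (act Y m n \<theta> y)"
  shows "parallel k \<sigma> m (act Y m n \<theta> y) I =
    {J. J \<in> faces k m \<and> compose {..k} \<theta> J \<in> faces k n \<and>
        compose {..k} \<theta> J \<in> parallel k \<sigma> n y (compose {..k} \<theta> I)}"
proof -
  have fib: "fibre m (act Y m n \<theta> y) = act C m n \<theta> ` fibre n y"
    using fibre_bij[OF \<theta> y] by (simp add: bij_betw_def)
  have "(\<forall>x\<in>fibre m (act Y m n \<theta> y). act C k m J x = act C k m I x) \<longleftrightarrow>
      (\<forall>x\<in>fibre n y. act C k n (compose {..k} \<theta> J) x = act C k n (compose {..k} \<theta> I) x)"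
    if "J \<in> simplex_ops k m" for J
    unfolding fib using C.act_compose[OF \<theta> that] C.act_compose[OF \<theta> Y.copies_ops[OF I]] by auto
  then show ?thesis
    unfolding parallel_def copies_act[OF nd \<theta> y] by (auto simp: faces_def)
qed

text \<open>A majority for \<open>I\<close> passes to the composite of \<open>\<theta>\<close> and
  \<open>I\<close>. Conversely, a face \<open>I\<close> of \<open>y\<close> need not factor through
  \<open>\<theta>\<close>; but its parallel class has nonzero weight at the pushed point, so it
  contains a composite of \<open>\<theta>\<close> with some \<open>J\<close>, and this
  \<open>J\<close> serves as the witness.\<close>

lemma majority_act:
  assumes nd: "nondegenerate Y k \<sigma>" and \<theta>: "\<theta> \<in> simplex_ops m n" and y: "y \<in> simps Y n"
    and t: "t \<in> standard_simplex m"
  shows "majority k \<sigma> m (act Y m n \<theta> y) t \<longleftrightarrow> majority k \<sigma> n y (simplex_push m \<theta> t)"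
proof -
  let ?y = "act Y m n \<theta> y" and ?t = "simplex_push m \<theta> t"
  have all: "sum (cprod k t) (Y.copies k {\<sigma>} m ?y) = sum (cprod k ?t) (Y.copies k {\<sigma>} n y)"
    using nd by (intro Y.sum_copies_act[OF _ \<theta> y]) auto
  have par: "sum (cprod k ?t) (parallel k \<sigma> n y I) =
    sum (cprod k t) {J. J \<in> faces k m \<and> compose {..k} \<theta> J \<in> faces k n \<and> compose {..k} \<theta> J \<in> parallel k \<sigma> n y I}" for I
    using sum_faces_push[OF \<theta>, where k = k and Q = "\<lambda>J. J \<in> parallel k \<sigma> n y I" and t = t]
    by (simp add: parallel_def Y.copies_def conj_ac)
  show ?thesis
  proof
    assume "majority k \<sigma> m ?y t"
    then obtain I where I: "I \<in> Y.copies k {\<sigma>} m ?y"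
      "sum (cprod k t) (Y.copies k {\<sigma>} m ?y) < 2 * sum (cprod k t) (parallel k \<sigma> m ?y I)"
      by (auto simp: majority_def)
    have "compose {..k} \<theta> I \<in> Y.copies k {\<sigma>} n y" using I copies_act[OF nd \<theta> y] by auto
    then show "majority k \<sigma> n y ?t"
      using I(2) unfolding parallel_act[OF nd \<theta> y I(1)] all par[symmetric] majority_def by blast
  next
    assume "majority k \<sigma> n y ?t"
    then obtain I where I: "I \<in> Y.copies k {\<sigma>} n y"
      "sum (cprod k ?t) (Y.copies k {\<sigma>} n y) < 2 * sum (cprod k ?t) (parallel k \<sigma> n y I)"
      by (auto simp: majority_def)
    have "0 \<le> sum (cprod k ?t) (Y.copies k {\<sigma>} n y)"
      using simplex_push_standard_simplex[OF \<theta> t] by (intro sum_nonneg cprod_nonneg)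
    then have "sum (cprod k t) {J. J \<in> faces k m \<and> compose {..k} \<theta> J \<in> faces k n \<and> compose {..k} \<theta> J \<in> parallel k \<sigma> n y I} \<noteq> 0"
      using I(2) par[of I] by linarith
    then obtain J where J: "J \<in> faces k m" "compose {..k} \<theta> J \<in> faces k n" "compose {..k} \<theta> J \<in> parallel k \<sigma> n y I"
      by (metis (mono_tags, lifting) Collect_empty_eq sum.empty)
    then have Jc: "J \<in> Y.copies k {\<sigma>} m ?y" unfolding copies_act[OF nd \<theta> y] by (auto simp: parallel_def)
    have "parallel k \<sigma> n y (compose {..k} \<theta> J) = parallel k \<sigma> n y I"
      using J(3) by (auto simp: parallel_def)
    then have "sum (cprod k t) (parallel k \<sigma> m ?y J) = sum (cprod k ?t) (parallel k \<sigma> n y I)"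
      unfolding parallel_act[OF nd \<theta> y Jc] par[symmetric] by simp
    then show "majority k \<sigma> m ?y t"
      using I(2) Jc all unfolding majority_def by metis
  qed
qed

definition majority_set :: "nat \<Rightarrow> 'y \<Rightarrow> ((nat \<times> 'y) \<times> (nat \<Rightarrow> real)) set set" where
  "majority_set k \<sigma> = {cell Y n y t | n y t. y \<in> simps Y n \<and> t \<in> standard_simplex n \<and> majority k \<sigma> n y t}"

lemma cell_in_majority_set:
  assumes nd: "nondegenerate Y k \<sigma>" and y: "y \<in> simps Y n" "t \<in> standard_simplex n"
  shows "cell Y n y t \<in> majority_set k \<sigma> \<longleftrightarrow> majority k \<sigma> n y t"
proof
  assume "cell Y n y t \<in> majority_set k \<sigma>"
  then obtain n' y' t' where *: "cell Y n y t = cell Y n' y' t'" "y' \<in> simps Y n'" "t' \<in> standard_simplex n'"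
    "majority k \<sigma> n' y' t'" by (auto simp: majority_set_def)
  show "majority k \<sigma> n y t"
    using Y.cell_eq_invariant[OF *(1) y *(2,3), of "majority k \<sigma>"] majority_act[OF nd] *(4) by blast
qed (use y in \<open>auto simp: majority_set_def\<close>)

lemma open_less_coordinates:
  fixes k :: nat and F :: "(nat \<Rightarrow> nat) set"
  shows "openin (simplex_topology n) {t \<in> standard_simplex n. sum (cprod k t) F < 2 * sum (cprod k t) G}"
proof -
  have "continuous_map (simplex_topology n) euclideanreal (\<lambda>t. 2 * sum (cprod k t) G - sum (cprod k t) F)"
    by (intro continuous_map_diff continuous_map_real_mult continuous_map_coordinates) auto
  from openin_continuous_map_preimage[OF this, of "{0<..}"] show ?thesis by simp
qed

lemma open_majority_set:
  assumes nd: "nondegenerate Y k \<sigma>"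
  shows "openin (realization Y) (majority_set k \<sigma>)"
  unfolding openin_realization
proof (intro conjI allI ballI)
  show "majority_set k \<sigma> \<subseteq> topspace (realization Y)"
    by (auto simp: majority_set_def topspace_realization)
  fix n y assume y: "y \<in> simps Y n"
  have "{t \<in> standard_simplex n. cell Y n y t \<in> majority_set k \<sigma>} =
    (\<Union>I\<in>Y.copies k {\<sigma>} n y. {t \<in> standard_simplex n.
       sum (cprod k t) (Y.copies k {\<sigma>} n y) < 2 * sum (cprod k t) (parallel k \<sigma> n y I)})"
    using cell_in_majority_set[OF nd y] by (auto simp: majority_def)
  then show "openin (simplex_topology n) {t \<in> standard_simplex n. cell Y n y t \<in> majority_set k \<sigma>}"
    using open_less_coordinates by auto
qed

text \<open>The condition looks at a single simplex \<open>x\<close>, whereas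
  \<open>majority\<close> compares identifications on a whole fibre. So a sheet may reach beyond the
  preimage of \<open>majority_set\<close>, which \<open>sheeted_map\<close> permits: sheets have to
  cover the preimage of \<open>W\<close>, not to lie in it.\<close>

definition sheet :: "nat \<Rightarrow> 'y \<Rightarrow> 'c \<Rightarrow> ((nat \<times> 'c) \<times> (nat \<Rightarrow> real)) set set" where
  "sheet k \<sigma> a = {cell C n x t | n x t. x \<in> simps C n \<and> t \<in> standard_simplex n \<and>
     sum (cprod k t) (Y.copies k {\<sigma>} n (\<pi> n x)) < 2 * sum (cprod k t) (C.copies k {a} n x)}"

lemma copies_in_subset:
  assumes "a \<in> fibre k \<sigma>" "x \<in> simps C n"
  shows "C.copies k {a} n x \<subseteq> Y.copies k {\<sigma>} n (\<pi> n x)"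
  using assms proj_act[OF _ assms(2)] by (auto simp: C.copies_def Y.copies_def faces_def)

lemma cell_in_sheet:
  assumes nd: "nondegenerate Y k \<sigma>" and a: "a \<in> fibre k \<sigma>"
    and x: "x \<in> simps C n" "t \<in> standard_simplex n"
  shows "cell C n x t \<in> sheet k \<sigma> a \<longleftrightarrow>
    sum (cprod k t) (Y.copies k {\<sigma>} n (\<pi> n x)) < 2 * sum (cprod k t) (C.copies k {a} n x)"
proof
  define Q where "Q n x t \<longleftrightarrow>
    sum (cprod k t) (Y.copies k {\<sigma>} n (\<pi> n x)) < 2 * sum (cprod k t) (C.copies k {a} n x)" for n x t
  assume "cell C n x t \<in> sheet k \<sigma> a"
  then obtain n' x' t' where *: "cell C n x t = cell C n' x' t'" "x' \<in> simps C n'" "t' \<in> standard_simplex n'" "Q n' x' t'"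
    unfolding sheet_def Q_def by blast
  have "Q n x t \<longleftrightarrow> Q n' x' t'"
  proof (rule C.cell_eq_invariant[OF *(1) x *(2,3)])
    fix m n \<theta> x t assume \<theta>: "\<theta> \<in> simplex_ops m n" and x: "x \<in> simps C n"
    show "Q m (act C m n \<theta> x) t \<longleftrightarrow> Q n x (simplex_push m \<theta> t)"
      unfolding Q_def proj_act[OF \<theta> x]
      using nd nondegenerate_fibre[OF nd a] Y.sum_copies_act[OF _ \<theta> proj_closed[OF x], of "{\<sigma>}" k t]
        C.sum_copies_act[OF _ \<theta> x, of "{a}" k t] by simp
  qed
  with *(4) show "sum (cprod k t) (Y.copies k {\<sigma>} n (\<pi> n x)) < 2 * sum (cprod k t) (C.copies k {a} n x)"
    by (simp add: Q_def)
qed (use x in \<open>auto simp: sheet_def\<close>)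

lemma sheet_topspace: "sheet k \<sigma> a \<subseteq> topspace (realization C)"
  by (auto simp: sheet_def topspace_realization)

lemma open_sheet:
  assumes nd: "nondegenerate Y k \<sigma>" and a: "a \<in> fibre k \<sigma>"
  shows "openin (realization C) (sheet k \<sigma> a)"
  unfolding openin_realization
proof (intro conjI allI ballI sheet_topspace)
  fix n x assume x: "x \<in> simps C n"
  have "{t \<in> standard_simplex n. cell C n x t \<in> sheet k \<sigma> a} = {t \<in> standard_simplex n.
      sum (cprod k t) (Y.copies k {\<sigma>} n (\<pi> n x)) < 2 * sum (cprod k t) (C.copies k {a} n x)}"
    using cell_in_sheet[OF nd a x] by blast
  then show "openin (simplex_topology n) {t \<in> standard_simplex n. cell C n x t \<in> sheet k \<sigma> a}"
    using open_less_coordinates by simp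
qed

text \<open>Two points with the same image are given by simplices \<open>x\<close> and
  \<open>x'\<close> over one simplex, with the same coordinates. Their majorities share a face
  \<open>J\<close>, which takes both to \<open>a\<close>, and the identification of fibres along
  \<open>J\<close> is injective.\<close>

lemma inj_on_sheet:
  assumes nd: "nondegenerate Y k \<sigma>" and a: "a \<in> fibre k \<sigma>"
  shows "inj_on proj (sheet k \<sigma> a)"
proof (rule inj_onI)
  fix w w' assume w: "w \<in> sheet k \<sigma> a" and w': "w' \<in> sheet k \<sigma> a" and eq: "proj w = proj w'"
  have "w \<in> topspace (realization C)" using w sheet_topspace by blast
  then obtain n x t where x: "x \<in> simps C n" "t \<in> standard_simplex n" "w = cell C n x t"
    by (rule topspace_realizationE)
  have "w' \<in> topspace (realization C)" using w' sheet_topspace by blast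
  then obtain x' where x': "x' \<in> fibre n (\<pi> n x)" "w' = cell C n x' t"
    using fibre_cell[of w' "\<pi> n x" n t] eq x proj_closed proj_cell by metis
  have "C.copies k {a} n x \<inter> C.copies k {a} n x' \<noteq> {}"
  proof (rule majorities_meet[OF Y.finite_copies[of k "{\<sigma>}" n "\<pi> n x"], of _ _ "cprod k t"])
    show "C.copies k {a} n x \<subseteq> Y.copies k {\<sigma>} n (\<pi> n x)" using copies_in_subset[OF a x(1)] .
    show "C.copies k {a} n x' \<subseteq> Y.copies k {\<sigma>} n (\<pi> n x)" using copies_in_subset[OF a, of x' n] x' by auto
    show "sum (cprod k t) (Y.copies k {\<sigma>} n (\<pi> n x)) < 2 * sum (cprod k t) (C.copies k {a} n x)"
      using cell_in_sheet[OF nd a x(1,2)] w x by simp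
    show "sum (cprod k t) (Y.copies k {\<sigma>} n (\<pi> n x)) < 2 * sum (cprod k t) (C.copies k {a} n x')"
      using cell_in_sheet[OF nd a, of x' n t] w' x x' by simp
  qed (use cprod_nonneg[OF x(2)] in auto)
  then obtain J where J: "J \<in> faces k n" "act C k n J x = a" "act C k n J x' = a"
    by (auto simp: C.copies_def)
  then have "x = x'"
    using fibre_bij[OF _ proj_closed[OF x(1)], of J k] x(1) x'(1)
    by (auto simp: bij_betw_def inj_on_def faces_def)
  then show "w = w'" using x x' by simp
qed

text \<open>At a common point the two majorities share a face, which takes the simplex both to
  \<open>a\<close> and to \<open>b\<close>.\<close>

lemma disjoint_sheets:
  assumes nd: "nondegenerate Y k \<sigma>" and a: "a \<in> fibre k \<sigma>" and b: "b \<in> fibre k \<sigma>"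
    and w: "w \<in> sheet k \<sigma> a" "w \<in> sheet k \<sigma> b"
  shows "a = b"
proof -
  have "w \<in> topspace (realization C)" using w sheet_topspace by blast
  then obtain n x t where x: "x \<in> simps C n" "t \<in> standard_simplex n" "w = cell C n x t"
    by (rule topspace_realizationE)
  have "C.copies k {a} n x \<inter> C.copies k {b} n x \<noteq> {}"
    by (rule majorities_meet[OF Y.finite_copies[of k "{\<sigma>}" n "\<pi> n x"], of _ _ "cprod k t"])
      (use copies_in_subset[OF a x(1)] copies_in_subset[OF b x(1)] cprod_nonneg[OF x(2)]
        cell_in_sheet[OF nd a x(1,2)] cell_in_sheet[OF nd b x(1,2)] w x(3) in auto)
  then show ?thesis by (auto simp: C.copies_def)
qed

text \<open>All faces parallel to \<open>I\<close> take \<open>x\<close> to the same simplex, so the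
  copies of that simplex in \<open>x\<close> inherit the majority.\<close>

lemma majority_sheet:
  assumes nd: "nondegenerate Y k \<sigma>" and x: "x \<in> simps C n" "t \<in> standard_simplex n"
    and I: "I \<in> Y.copies k {\<sigma>} n (\<pi> n x)"
      "sum (cprod k t) (Y.copies k {\<sigma>} n (\<pi> n x)) < 2 * sum (cprod k t) (parallel k \<sigma> n (\<pi> n x) I)"
  shows "act C k n I x \<in> fibre k \<sigma>" "cell C n x t \<in> sheet k \<sigma> (act C k n I x)"
proof -
  show a: "act C k n I x \<in> fibre k \<sigma>"
    using I(1) C.act_closed[OF _ x(1)] proj_act[OF _ x(1)] by (auto simp: Y.copies_def faces_def)
  have "parallel k \<sigma> n (\<pi> n x) I \<subseteq> C.copies k {act C k n I x} n x"
    using x(1) by (auto simp: parallel_def C.copies_def Y.copies_def)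
  then have "sum (cprod k t) (parallel k \<sigma> n (\<pi> n x) I) \<le> sum (cprod k t) (C.copies k {act C k n I x} n x)"
    using cprod_nonneg[OF x(2)] finite_faces[of k n]
    by (intro sum_mono2) (auto simp: C.copies_def)
  then show "cell C n x t \<in> sheet k \<sigma> (act C k n I x)"
    using cell_in_sheet[OF nd a x] I(2) by simp
qed

text \<open>Each point lies in the majority set of its nondegenerate representative
  \<open>\<sigma>\<close>: the only copy of \<open>\<sigma>\<close> in itself is the identity, and
  its weight is positive because all coordinates are. The sheets are indexed by the fibre over
  \<open>\<sigma>\<close>.\<close>

theorem sheeted_realization: "sheeted_map (realization C) (realization Y) proj"
proof
  fix z assume "z \<in> topspace (realization Y)"
  then obtain k \<sigma> t where s: "\<sigma> \<in> simps Y k" "nondegenerate Y k \<sigma>" "t \<in> standard_simplex k"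
    "\<And>i. i \<le> k \<Longrightarrow> 0 < t i" "z = cell Y k \<sigma> t"
    by (rule Y.nondegenerate_representative) blast
  let ?W = "majority_set k \<sigma>" and ?O = "sheet k \<sigma> ` fibre k \<sigma>"
  have id: "restrict id {..k} \<in> simplex_ops k k" by (rule simplex_opsI) auto
  have copies: "Y.copies k {\<sigma>} k \<sigma> = {restrict id {..k}}"
    using faces_self[of _ k] Y.act_id[OF s(1)] id by (auto simp: Y.copies_def faces_def inj_on_def)
  have "0 < cprod k t (restrict id {..k})" using s(4) by (intro prod_pos) auto
  moreover have "parallel k \<sigma> k \<sigma> (restrict id {..k}) = {restrict id {..k}}"
    by (auto simp: parallel_def copies)
  ultimately have "majority k \<sigma> k \<sigma> t" by (simp add: majority_def copies)
  then have "z \<in> ?W" using cell_in_majority_set s by metis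
  moreover have "disjoint ?O"
    using disjoint_sheets[OF s(2)] by (auto simp: disjoint_def)
  moreover have "openin (realization C) Q \<and> inj_on proj Q \<and> ?W \<subseteq> proj ` Q" if Q: "Q \<in> ?O" for Q
  proof -
    obtain a where a: "a \<in> fibre k \<sigma>" "Q = sheet k \<sigma> a" using Q by blast
    have "?W \<subseteq> proj ` Q"
    proof
      fix z assume "z \<in> ?W"
      then obtain n y t where y: "y \<in> simps Y n" "t \<in> standard_simplex n" "majority k \<sigma> n y t" "z = cell Y n y t"
        by (auto simp: majority_set_def)
      then obtain I where I: "I \<in> Y.copies k {\<sigma>} n y"
        "sum (cprod k t) (Y.copies k {\<sigma>} n y) < 2 * sum (cprod k t) (parallel k \<sigma> n y I)"
        by (auto simp: majority_def)
      have "fibre k \<sigma> = act C k n I ` fibre n y"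
      proof -
        have "act Y k n I y = \<sigma>" using I(1) by (simp add: Y.copies_def)
        then show ?thesis using bij_betw_imp_surj_on[OF fibre_bij[OF Y.copies_ops[OF I(1)] y(1)]] by simp
      qed
      \<comment> \<open>Along \<open>I\<close> the fibre over \<open>y\<close> is identified with
        the fibre over \<open>\<sigma>\<close>, which supplies the simplex over \<open>y\<close>
        whose point lies in the sheet of \<open>a\<close>.\<close>
      with a(1) have "a \<in> act C k n I ` fibre n y" by (simp only:)
      then obtain x where x: "a = act C k n I x" "x \<in> fibre n y" by (rule imageE)
      then have x': "x \<in> simps C n" "\<pi> n x = y" by auto
      have "cell C n x t \<in> Q"
        using majority_sheet(2)[OF s(2) x'(1) y(2), of I] I unfolding x'(2) a(2) x(1) by blast
      moreover have "z = proj (cell C n x t)" using x y by (simp add: proj_cell)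
      ultimately show "z \<in> proj ` Q" by blast
    qed
    then show ?thesis using a open_sheet[OF s(2)] inj_on_sheet[OF s(2)] by blast
  qed
  moreover have "{w \<in> topspace (realization C). proj w \<in> ?W} \<subseteq> \<Union>?O"
  proof
    fix w assume w: "w \<in> {w \<in> topspace (realization C). proj w \<in> ?W}"
    then obtain n x t where x: "x \<in> simps C n" "t \<in> standard_simplex n" "w = cell C n x t"
      by (blast elim: topspace_realizationE)
    have "majority k \<sigma> n (\<pi> n x) t"
      using w x cell_in_majority_set[OF s(2) proj_closed[OF x(1)] x(2)] by (simp add: proj_cell)
    then show "w \<in> \<Union>?O"
      using majority_sheet[OF s(2) x(1,2)] x(3) unfolding majority_def by blast
  qed
  ultimately show "\<exists>W \<O>. openin (realization Y) W \<and> z \<in> W \<and> disjoint \<O> \<and>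
      (\<forall>Q\<in>\<O>. openin (realization C) Q \<and> inj_on proj Q \<and> W \<subseteq> proj ` Q) \<and>
      {w \<in> topspace (realization C). proj w \<in> W} \<subseteq> \<Union>\<O>"
    using open_majority_set[OF s(2)] by blast
qed (rule continuous_proj open_proj)+

end

section \<open>Loops in simplicial coverings\<close>

definition vertex_op :: "nat \<Rightarrow> nat \<Rightarrow> nat" where
  "vertex_op i = restrict (\<lambda>_. i) {..0}"

definition edge_op :: "nat \<Rightarrow> nat \<Rightarrow> nat \<Rightarrow> nat" where
  "edge_op i j = restrict (\<lambda>h. if h = 0 then i else j) {..1}"

definition triangle_op :: "nat \<Rightarrow> nat \<Rightarrow> nat \<Rightarrow> nat \<Rightarrow> nat" where
  "triangle_op i j l = restrict (\<lambda>h. if h = 0 then i else if h = 1 then j else l) {..2}"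

lemma vertex_op: "i \<le> n \<Longrightarrow> vertex_op i \<in> simplex_ops 0 n"
  unfolding vertex_op_def by (rule simplex_opsI) auto

lemma edge_op: "i \<le> j \<Longrightarrow> j \<le> n \<Longrightarrow> edge_op i j \<in> simplex_ops 1 n"
  unfolding edge_op_def by (rule simplex_opsI) auto

lemma triangle_op: "i \<le> j \<Longrightarrow> j \<le> l \<Longrightarrow> l \<le> n \<Longrightarrow> triangle_op i j l \<in> simplex_ops 2 n"
  unfolding triangle_op_def by (rule simplex_opsI) auto

abbreviation vert :: "'a sset \<Rightarrow> nat \<Rightarrow> nat \<Rightarrow> 'a \<Rightarrow> 'a" where
  "vert X n i \<equiv> act X 0 n (vertex_op i)"

abbreviation edge :: "'a sset \<Rightarrow> nat \<Rightarrow> nat \<Rightarrow> nat \<Rightarrow> 'a \<Rightarrow> 'a" where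
  "edge X n i j \<equiv> act X 1 n (edge_op i j)"

definition basepoint :: "nat \<Rightarrow> real" where
  "basepoint = (\<lambda>i. if i = 0 then 1 else 0)"

definition segment :: "real \<Rightarrow> nat \<Rightarrow> real" where
  "segment s = (\<lambda>i. if i = 0 then 1 - s else if i = 1 then s else 0)"

lemma basepoint: "basepoint \<in> standard_simplex 0"
  by (rule standard_simplexI) (auto simp: basepoint_def)

lemma segment: "s \<in> {0..1} \<Longrightarrow> segment s \<in> standard_simplex 1"
  by (rule standard_simplexI) (auto simp: segment_def)

lemma continuous_map_segment: "continuous_map (top_of_set {0..1}) (simplex_topology 1) segment"
proof -
  have "continuous_on {0..1} (\<lambda>s. segment s i)" for i
    unfolding segment_def by (cases "i = 0"; cases "i = 1") (auto intro!: continuous_intros)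
  then show ?thesis
    using segment by (auto simp: continuous_map_in_subtopology continuous_map_componentwise_UNIV)
qed

lemma push_basepoint:
  "simplex_push 0 (vertex_op 0) basepoint = segment 0"
  "simplex_push 0 (vertex_op 1) basepoint = segment 1"
proof -
  have "{i. i \<le> 0 \<and> vertex_op a i = j} = (if j = a then {0} else {})" for a j
    by (auto simp: vertex_op_def)
  then show "simplex_push 0 (vertex_op 0) basepoint = segment 0"
    "simplex_push 0 (vertex_op 1) basepoint = segment 1"
    by (auto simp: simplex_push_def basepoint_def segment_def fun_eq_iff)
qed

context simplicial_set
begin

lemma vert_closed: "x \<in> simps X n \<Longrightarrow> i \<le> n \<Longrightarrow> vert X n i x \<in> simps X 0"
  by (rule act_closed[OF vertex_op])

lemma edge_closed: "x \<in> simps X n \<Longrightarrow> i \<le> j \<Longrightarrow> j \<le> n \<Longrightarrow> edge X n i j x \<in> simps X 1"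
  by (rule act_closed[OF edge_op])

lemma vert_act:
  assumes "\<theta> \<in> simplex_ops m n" "x \<in> simps X n" "i \<le> m"
  shows "vert X m i (act X m n \<theta> x) = vert X n (\<theta> i) x"
proof -
  have "compose {..0} \<theta> (vertex_op i) = vertex_op (\<theta> i)"
    by (auto simp: compose_def vertex_op_def)
  then show ?thesis using act_compose[OF assms(1) vertex_op[OF assms(3)] assms(2)] by simp
qed

lemma edge_act:
  assumes "\<theta> \<in> simplex_ops m n" "x \<in> simps X n" "i \<le> j" "j \<le> m"
  shows "edge X m i j (act X m n \<theta> x) = edge X n (\<theta> i) (\<theta> j) x"
proof -
  have "compose {..1} \<theta> (edge_op i j) = edge_op (\<theta> i) (\<theta> j)"
    by (auto simp: compose_def edge_op_def)
  then show ?thesis using act_compose[OF assms(1) edge_op[OF assms(3,4)] assms(2)] by simp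
qed

lemma vert_edge:
  assumes "x \<in> simps X n" "i \<le> j" "j \<le> n"
  shows "vert X 1 0 (edge X n i j x) = vert X n i x" "vert X 1 1 (edge X n i j x) = vert X n j x"
  using vert_act[OF edge_op[OF assms(2,3)] assms(1)] by (auto simp: edge_op_def)

lemma vert_self: "x \<in> simps X 0 \<Longrightarrow> vert X 0 0 x = x"
proof -
  have "vertex_op 0 = restrict id {..0}" by (auto simp: vertex_op_def)
  then show "x \<in> simps X 0 \<Longrightarrow> vert X 0 0 x = x" using act_id[of x 0] by simp
qed

lemma edge_self: "x \<in> simps X 1 \<Longrightarrow> edge X 1 0 1 x = x"
proof -
  have "edge_op 0 1 = restrict id {..1}" by (auto simp: edge_op_def)
  then show "x \<in> simps X 1 \<Longrightarrow> edge X 1 0 1 x = x" using act_id[of x 1] by simp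
qed

lemma edge_triangle:
  assumes "x \<in> simps X n" "i \<le> j" "j \<le> l" "l \<le> n"
  shows "edge X 2 0 1 (act X 2 n (triangle_op i j l) x) = edge X n i j x"
    "edge X 2 1 2 (act X 2 n (triangle_op i j l) x) = edge X n j l x"
    "edge X 2 0 2 (act X 2 n (triangle_op i j l) x) = edge X n i l x"
  using edge_act[OF triangle_op[OF assms(2-4)] assms(1)] by (auto simp: triangle_op_def)

lemma edge_vert:
  assumes "x \<in> simps X n" "i \<le> n"
  shows "edge X 0 0 0 (vert X n i x) = edge X n i i x"
  using edge_act[OF vertex_op[OF assms(2)] assms(1), of 0 0] by (simp add: vertex_op_def)

lemma cell_segment_ends:
  assumes "x \<in> simps X 1"
  shows "cell X 1 x (segment 0) = cell X 0 (vert X 1 0 x) basepoint"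
    "cell X 1 x (segment 1) = cell X 0 (vert X 1 1 x) basepoint"
  unfolding push_basepoint[symmetric]
  by (rule cell_act[symmetric, OF vertex_op assms basepoint], simp)+

text \<open>The weight of the copies of the vertex \<open>x\<close> is well defined on the
  realization, since vertices are nondegenerate. It is 1 at \<open>x\<close> and 0 at every other
  vertex.\<close>

lemma cell_basepoint_inj:
  assumes x: "x \<in> simps X 0" "x' \<in> simps X 0" and eq: "cell X 0 x basepoint = cell X 0 x' basepoint"
  shows "x = x'"
proof -
  have nd: "nondegenerate X 0 v" for v by (simp add: nondegenerate_def)
  have faces: "faces 0 0 = {restrict id {..0}}"
  proof (rule subset_antisym)
    show "faces 0 0 \<subseteq> {restrict id {..0}}" using faces_self[of _ 0] by blast
    have "restrict id {..0} \<in> simplex_ops 0 0" by (rule simplex_opsI) auto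
    then show "{restrict id {..0}} \<subseteq> faces 0 0" by (simp add: faces_def)
  qed
  have w: "sum (cprod 0 basepoint) (copies 0 {x} 0 y) = (if y = x then 1 else 0)" if "y \<in> simps X 0" for y
  proof -
    have "copies 0 {x} 0 y = (if y = x then {restrict id {..0}} else {})"
      unfolding copies_def faces using act_id[OF that] by auto
    then show ?thesis by (simp add: basepoint_def)
  qed
  define Q where "Q n y t \<longleftrightarrow> sum (cprod 0 t) (copies 0 {x} n y) = 1" for n y t
  have "Q 0 x basepoint \<longleftrightarrow> Q 0 x' basepoint"
  proof (rule cell_eq_invariant[OF eq x(1) basepoint x(2) basepoint])
    show "Q m (act X m n \<theta> y) t \<longleftrightarrow> Q n y (simplex_push m \<theta> t)"
      if "\<theta> \<in> simplex_ops m n" "y \<in> simps X n" for m n \<theta> y t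
      unfolding Q_def by (subst sum_copies_act[OF nd that]) (rule refl)
  qed
  then show ?thesis unfolding Q_def w[OF x(1)] w[OF x(2)] by (simp split: if_splits)
qed

end

context simplicial_covering
begin

text \<open>The homotopy, applied to the loop \<open>c\<close> traced by \<open>e\<close>, spans a
  square whose bottom side has the closed lift \<open>G \<circ> c\<close>. Hence the top side
  \<open>c\<close> has a closed lift. By uniqueness this lift ends where the path of a single edge
  \<open>x\<close> over \<open>e\<close> ends, so the end vertices of \<open>x\<close> are equal in
  the realization and, by \<open>cell_basepoint_inj\<close>, in \<open>C\<close>.\<close>

lemma loop_edge_lifts:
  assumes e: "e \<in> simps Y 1" "vert Y 1 0 e = vert Y 1 1 e"
    and G: "continuous_map (realization Y) (realization C) G"
    and homotopic: "homotopic_with (\<lambda>_. True) (realization Y) (realization Y) (proj \<circ> G) id"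
  obtains x where "x \<in> fibre 1 e" "vert C 1 0 x = vert C 1 1 x"
proof -
  interpret sheeted_map "realization C" "realization Y" proj by (rule sheeted_realization)
  let ?I = "{0..1} :: real set"
  obtain h where h: "continuous_map (prod_topology (top_of_set ?I) (realization Y)) (realization Y) h"
    "\<And>z. h (0, z) = proj (G z)" "\<And>z. h (1, z) = z"
    using homotopic by (auto simp: homotopic_with_def)
  define c where "c = cell Y 1 e \<circ> segment"
  have c: "continuous_map (top_of_set ?I) (realization Y) c"
    unfolding c_def by (rule continuous_map_compose[OF continuous_map_segment continuous_map_cell[OF e(1)]])
  have c01: "c 0 = c 1" using Y.cell_segment_ends[OF e(1)] e(2) by (simp add: c_def)
  define R where "R = h \<circ> (\<lambda>x. (snd x, c (fst x)))"
  have "continuous_map (top_of_set (?I \<times> ?I)) (top_of_set ?I) fst"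
    by (auto intro: continuous_intros)
  from continuous_map_compose[OF this c]
  have "continuous_map (top_of_set (?I \<times> ?I)) (realization Y) (\<lambda>x. c (fst x))" by (simp add: o_def)
  moreover have "continuous_map (top_of_set (?I \<times> ?I)) (top_of_set ?I) snd"
    by (auto intro: continuous_intros)
  ultimately have "continuous_map (top_of_set (?I \<times> ?I)) (prod_topology (top_of_set ?I) (realization Y))
      (\<lambda>x. (snd x, c (fst x)))"
    by (intro continuous_map_pairedI) auto
  from continuous_map_compose[OF this h(1)]
  have R: "continuous_map (top_of_set (?I \<times> ?I)) (realization Y) R" by (simp add: R_def)
  have Rs: "R (0, r) = R (1, r)" for r using c01 by (simp add: R_def)
  have l0: "continuous_map (top_of_set ?I) (realization C) (G \<circ> c)"
    by (rule continuous_map_compose[OF c G])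
  have l0_lift: "proj ((G \<circ> c) s) = R (s, 0)" for s using h(2) by (simp add: R_def)
  have l0_loop: "(G \<circ> c) 0 = (G \<circ> c) 1" using c01 by simp
  obtain l where l: "continuous_map (top_of_set ?I) (realization C) l"
    "\<And>s. s \<in> ?I \<Longrightarrow> proj (l s) = R (s, 1)" "l 0 = l 1"
    by (rule loop_lift[OF R Rs l0 l0_lift l0_loop]) blast
  have lc: "proj (l s) = cell Y 1 e (segment s)" if "s \<in> ?I" for s
    using l(2)[OF that] h(3) by (simp add: R_def c_def)
  have "l 0 \<in> topspace (realization C)" using continuous_map_funspace[OF l(1)] by auto
  then obtain x where x: "x \<in> fibre 1 e" "l 0 = cell C 1 x (segment 0)"
    using fibre_cell[of "l 0" e 1 "segment 0"] lc[of 0] segment[of 0] e(1) by auto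
  then have x': "x \<in> simps C 1" "\<pi> 1 x = e" by auto
  have "l 1 = (cell C 1 x \<circ> segment) 1"
  proof (rule lift_unique[of "top_of_set ?I" l "cell C 1 x \<circ> segment" 0 1])
    show "connected_space (top_of_set ?I)" by (simp add: connected_space_subtopology)
    show "continuous_map (top_of_set ?I) (realization C) (cell C 1 x \<circ> segment)"
      by (rule continuous_map_compose[OF continuous_map_segment continuous_map_cell[OF x'(1)]])
    show "proj (l s) = proj ((cell C 1 x \<circ> segment) s)" if "s \<in> topspace (top_of_set ?I)" for s
    proof -
      have s: "s \<in> ?I" using that by simp
      show ?thesis using lc[OF s] proj_cell[OF x'(1) segment[OF s]] x'(2) by simp
    qed
    show "l 0 = (cell C 1 x \<circ> segment) 0" using x(2) by simp
  qed (use l(1) in auto)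
  then have "cell C 0 (vert C 1 0 x) basepoint = cell C 0 (vert C 1 1 x) basepoint"
    using l(3) x(2) C.cell_segment_ends[OF x'(1)] by simp
  then have "vert C 1 0 x = vert C 1 1 x"
    by (intro C.cell_basepoint_inj C.vert_closed x'(1)) auto
  with x(1) that show ?thesis by blast
qed

end

section \<open>Kan fibrations\<close>

definition coface :: "nat \<Rightarrow> nat \<Rightarrow> nat \<Rightarrow> nat" where
  "coface n i = restrict (\<lambda>j. if j < i then j else Suc j) {..n - 1}"

text \<open>A left inverse of the coface omitting \<open>i\<close>. Its value at
  \<open>k \<noteq> i\<close> is the position of the vertex \<open>k\<close> in the face opposite to
  \<open>i\<close>.\<close>

definition retract_from :: "nat \<Rightarrow> nat \<Rightarrow> nat" where
  "retract_from i j = (if j < i then j else j - 1)"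

text \<open>If \<open>\<alpha>\<close> omits \<open>i\<close>, this is its factor through the coface
  omitting \<open>i\<close>, as \<open>coface_lower\<close> shows.\<close>

definition lower :: "nat \<Rightarrow> nat \<Rightarrow> (nat \<Rightarrow> nat) \<Rightarrow> nat \<Rightarrow> nat" where
  "lower m i \<alpha> = restrict (\<lambda>h. retract_from i (\<alpha> h)) {..m}"

lemma coface: "1 \<le> n \<Longrightarrow> i \<le> n \<Longrightarrow> coface n i \<in> simplex_ops (n - 1) n"
  unfolding coface_def by (rule simplex_opsI) auto

lemma lower:
  assumes "\<alpha> \<in> simplex_ops m n" "i \<le> n" "i \<notin> \<alpha> ` {..m}"
  shows "lower m i \<alpha> \<in> simplex_ops m (n - 1)"
  unfolding lower_def
proof (rule simplex_opsI)
  show "retract_from i (\<alpha> h) \<le> n - 1" if "h \<le> m" for h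
    using that simplex_ops_le[OF assms(1) that] assms(2,3) by (auto simp: retract_from_def image_iff)
  show "retract_from i (\<alpha> h) \<le> retract_from i (\<alpha> h')" if "h \<le> h'" "h' \<le> m" for h h'
    using simplex_ops_mono[OF assms(1) that] by (auto simp: retract_from_def)
qed

lemma coface_lower:
  assumes "\<alpha> \<in> simplex_ops m n" "1 \<le> n" "i \<le> n" "i \<notin> \<alpha> ` {..m}"
  shows "compose {..m} (coface n i) (lower m i \<alpha>) = \<alpha>"
proof (rule simplex_ops_eqI[OF simplex_ops_compose[OF coface[OF assms(2,3)] lower[OF assms(1,3,4)]] assms(1)])
  fix h assume h: "h \<le> m"
  then have "\<alpha> h \<noteq> i" using assms(4) by auto
  moreover have "lower m i \<alpha> h \<le> n - 1" using simplex_ops_le[OF lower[OF assms(1,3,4)] h] .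
  ultimately show "compose {..m} (coface n i) (lower m i \<alpha>) h = \<alpha> h"
    using h by (auto simp: compose_def coface_def lower_def retract_from_def)
qed

lemma lower_coface:
  assumes "1 \<le> n" "i \<le> n"
  shows "lower (n - 1) i (coface n i) = restrict id {..n - 1}"
  by (auto simp: lower_def coface_def retract_from_def)

lemma notin_coface: "i \<notin> coface n i ` {..n - 1}"
  by (auto simp: coface_def)

lemma lower_compose:
  assumes "\<theta> \<in> simplex_ops l m"
  shows "lower l i (compose {..l} \<alpha> \<theta>) = compose {..l} (lower m i \<alpha>) \<theta>"
  using simplex_ops_le[OF assms] by (auto simp: lower_def compose_def)

lemma coface_small:
  "i \<le> 1 \<Longrightarrow> k \<le> 1 \<Longrightarrow> i \<noteq> k \<Longrightarrow> coface 1 i = vertex_op k"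
  "coface 2 0 = edge_op 1 2" "coface 2 1 = edge_op 0 2" "coface 2 2 = edge_op 0 1"
  by (auto simp: coface_def vertex_op_def edge_op_def)

locale kan_fibration = X: simplicial_set X + Y: simplicial_set Y
  for X :: "'x sset" and Y :: "'y sset" +
  fixes \<phi> :: "nat \<Rightarrow> 'x \<Rightarrow> 'y"
  assumes Kan: "Kan_fibration X Y \<phi>"
begin

lemma simplicial_map: "simplicial_map X Y \<phi>"
  using Kan by (simp add: Kan_fibration_def)

lemma map_closed: "x \<in> simps X n \<Longrightarrow> \<phi> n x \<in> simps Y n"
  using simplicial_map by (auto simp: simplicial_map_def)

lemma map_act: "\<theta> \<in> simplex_ops m n \<Longrightarrow> x \<in> simps X n \<Longrightarrow> \<phi> m (act X m n \<theta> x) = act Y m n \<theta> (\<phi> n x)"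
  using simplicial_map by (auto simp: simplicial_map_def)

text \<open>A map out of the horn is assembled from faces, and a map out of the full simplex is its
  value on the identity (Yoneda). \<open>compat\<close> says that \<open>u\<close> does not depend
  on which omitted vertex \<open>missing\<close> selects, so it is demanded for every simplex that
  omits both \<open>i\<close> and \<open>j\<close>.\<close>

lemma horn_filler:
  assumes n: "1 \<le> n" "k \<le> n"
    and e: "\<And>i. i \<le> n \<Longrightarrow> i \<noteq> k \<Longrightarrow> e i \<in> simps X (n - 1)"
    and y: "y \<in> simps Y n"
    and \<phi>e: "\<And>i. i \<le> n \<Longrightarrow> i \<noteq> k \<Longrightarrow> \<phi> (n - 1) (e i) = act Y (n - 1) n (coface n i) y"
    and compat: "\<And>m \<alpha> i j. \<alpha> \<in> simplex_ops m n \<Longrightarrow> i \<le> n \<Longrightarrow> j \<le> n \<Longrightarrow> i \<noteq> k \<Longrightarrow> j \<noteq> k \<Longrightarrow>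
      i \<notin> \<alpha> ` {..m} \<Longrightarrow> j \<notin> \<alpha> ` {..m} \<Longrightarrow>
      act X m (n - 1) (lower m i \<alpha>) (e i) = act X m (n - 1) (lower m j \<alpha>) (e j)"
  obtains x where "x \<in> simps X n" "\<phi> n x = y"
    "\<And>i. i \<le> n \<Longrightarrow> i \<noteq> k \<Longrightarrow> act X (n - 1) n (coface n i) x = e i"
proof -
  define missing where "missing m \<alpha> = (SOME i. i \<le> n \<and> i \<noteq> k \<and> i \<notin> \<alpha> ` {..m})" for m and \<alpha> :: "nat \<Rightarrow> nat"
  define u where "u m \<alpha> = act X m (n - 1) (lower m (missing m \<alpha>) \<alpha>) (e (missing m \<alpha>))" for m \<alpha>
  define v where "v m \<alpha> = act Y m n \<alpha> y" for m \<alpha>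
  have u: "u m \<alpha> = act X m (n - 1) (lower m i \<alpha>) (e i)"
    if "\<alpha> \<in> simplex_ops m n" "i \<le> n" "i \<noteq> k" "i \<notin> \<alpha> ` {..m}" for m \<alpha> i
  proof -
    have "missing m \<alpha> \<le> n \<and> missing m \<alpha> \<noteq> k \<and> missing m \<alpha> \<notin> \<alpha> ` {..m}"
      unfolding missing_def by (rule someI[of _ i]) (use that in auto)
    then show ?thesis unfolding u_def using compat[OF that(1)] that by blast
  qed
  have horn: "\<exists>i. \<alpha> \<in> simplex_ops m n \<and> i \<le> n \<and> i \<noteq> k \<and> i \<notin> \<alpha> ` {..m}"
    if "\<alpha> \<in> simps (horn_sset n k) m" for m \<alpha>
    using that by (auto simp: horn_sset_def)
  have "simplicial_map (horn_sset n k) X u"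
    unfolding simplicial_map_def
  proof (intro conjI allI ballI funcsetI)
    fix m \<alpha> assume "\<alpha> \<in> simps (horn_sset n k) m"
    from horn[OF this] obtain i where i: "\<alpha> \<in> simplex_ops m n" "i \<le> n" "i \<noteq> k" "i \<notin> \<alpha> ` {..m}" by blast
    show "u m \<alpha> \<in> simps X m"
      unfolding u[OF i] by (rule X.act_closed[OF lower[OF i(1,2,4)] e[OF i(2,3)]])
  next
    fix l m \<theta> \<alpha> assume \<theta>: "\<theta> \<in> simplex_ops l m" and "\<alpha> \<in> simps (horn_sset n k) m"
    from horn[OF this(2)] obtain i where i: "\<alpha> \<in> simplex_ops m n" "i \<le> n" "i \<noteq> k" "i \<notin> \<alpha> ` {..m}" by blast
    have "i \<notin> compose {..l} \<alpha> \<theta> ` {..l}"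
      using i(4) simplex_ops_le[OF \<theta>] by (auto simp: compose_def)
    from u[OF simplex_ops_compose[OF i(1) \<theta>] i(2,3) this]
    have "u l (compose {..l} \<alpha> \<theta>) = act X l m \<theta> (u m \<alpha>)"
      unfolding u[OF i] lower_compose[OF \<theta>]
      using X.act_compose[OF lower[OF i(1,2,4)] \<theta> e[OF i(2,3)]] by simp
    then show "u l (act (horn_sset n k) l m \<theta> \<alpha>) = act X l m \<theta> (u m \<alpha>)"
      by (simp add: horn_sset_def simplex_sset_def)
  qed
  moreover have "simplicial_map (simplex_sset n) Y v"
    unfolding simplicial_map_def v_def
    using Y.act_closed[OF _ y] Y.act_compose[OF _ _ y] by (auto simp: simplex_sset_def)
  moreover have "\<phi> m (u m \<alpha>) = v m \<alpha>" if "\<alpha> \<in> simps (horn_sset n k) m" for m \<alpha>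
  proof -
    from horn[OF that] obtain i where i: "\<alpha> \<in> simplex_ops m n" "i \<le> n" "i \<noteq> k" "i \<notin> \<alpha> ` {..m}" by blast
    have "\<phi> m (u m \<alpha>) = act Y m (n - 1) (lower m i \<alpha>) (act Y (n - 1) n (coface n i) y)"
      unfolding u[OF i] using map_act[OF lower[OF i(1,2,4)] e[OF i(2,3)]] \<phi>e[OF i(2,3)] by simp
    also have "\<dots> = v m \<alpha>"
      using Y.act_compose[OF coface[OF n(1) i(2)] lower[OF i(1,2,4)] y] coface_lower[OF i(1) n(1) i(2,4)]
      by (simp add: v_def)
    finally show ?thesis .
  qed
  ultimately obtain w where w: "simplicial_map (simplex_sset n) X w"
    "\<And>m \<alpha>. \<alpha> \<in> simps (horn_sset n k) m \<Longrightarrow> w m \<alpha> = u m \<alpha>"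
    "\<And>m \<alpha>. \<alpha> \<in> simps (simplex_sset n) m \<Longrightarrow> \<phi> m (w m \<alpha>) = v m \<alpha>"
    using Kan n unfolding Kan_fibration_def by metis
  let ?id = "restrict id {..n}"
  have id: "?id \<in> simplex_ops n n" by (rule simplex_opsI) auto
  have wact: "act X m n \<theta> (w n ?id) = w m \<theta>" if "\<theta> \<in> simplex_ops m n" for m \<theta>
  proof -
    have "compose {..m} ?id \<theta> = \<theta>"
      by (rule simplex_ops_eqI[OF simplex_ops_compose[OF id that] that])
        (auto simp: compose_def simplex_ops_le[OF that])
    moreover have "w m (compose {..m} ?id \<theta>) = act X m n \<theta> (w n ?id)"
      using w(1) that id unfolding simplicial_map_def simplex_sset_def by simp
    ultimately show ?thesis by simp
  qed
  show ?thesis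
  proof (rule that[of "w n ?id"])
    show "w n ?id \<in> simps X n"
      using w(1) id by (auto simp: simplicial_map_def simplex_sset_def)
    show "\<phi> n (w n ?id) = y"
      using w(3)[of ?id n] id Y.act_id[OF y] by (simp add: simplex_sset_def v_def)
    fix i assume i: "i \<le> n" "i \<noteq> k"
    have "coface n i \<in> simps (horn_sset n k) (n - 1)"
      using coface[OF n(1) i(1)] notin_coface[of i n] i by (auto simp: horn_sset_def)
    then have "w (n - 1) (coface n i) = u (n - 1) (coface n i)" by (rule w(2))
    also have "\<dots> = e i"
      unfolding u[OF coface[OF n(1) i(1)] i notin_coface] lower_coface[OF n(1) i(1)]
      by (rule X.act_id[OF e[OF i]])
    finally show "act X (n - 1) n (coface n i) (w n ?id) = e i"
      using wact[OF coface[OF n(1) i(1)]] by simp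
  qed
qed

text \<open>In dimension 1 the horn with index \<open>k\<close> is the vertex \<open>k\<close>,
  which is the face opposite to \<open>1 - k\<close>.\<close>

lemma edge_filler:
  assumes "k \<le> 1" "x \<in> simps X 0" "e \<in> simps Y 1" "\<phi> 0 x = vert Y 1 k e"
  obtains \<epsilon> where "\<epsilon> \<in> simps X 1" "\<phi> 1 \<epsilon> = e" "vert X 1 k \<epsilon> = x"
proof -
  obtain \<epsilon> where \<epsilon>: "\<epsilon> \<in> simps X 1" "\<phi> 1 \<epsilon> = e"
    "\<And>i. i \<le> 1 \<Longrightarrow> i \<noteq> k \<Longrightarrow> act X 0 1 (coface 1 i) \<epsilon> = x"
  proof (rule horn_filler[of 1 k "\<lambda>_. x" e])
    fix m \<alpha> i j
    assume "i \<le> 1" "j \<le> 1" "i \<noteq> k" "j \<noteq> k"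
    then have "i = j" using assms(1) by linarith
    then show "act X m (1 - 1) (lower m i \<alpha>) x = act X m (1 - 1) (lower m j \<alpha>) x" by simp
  next
    fix i :: nat assume "i \<le> 1" "i \<noteq> k"
    then show "\<phi> (1 - 1) x = act Y (1 - 1) 1 (coface 1 i) e"
      using assms coface_small(1)[of i k] by simp
  qed (use assms in auto)
  have k: "1 - k \<le> 1" "1 - k \<noteq> k" using assms(1) by (cases k; simp)+
  have "act X 0 1 (coface 1 (1 - k)) \<epsilon> = x" by (rule \<epsilon>(3)[OF k])
  moreover have "coface 1 (1 - k) = vertex_op k" by (rule coface_small(1)[OF k(1) assms(1) k(2)])
  ultimately show ?thesis using that \<epsilon> by metis
qed

text \<open>The two given faces meet only in the vertex \<open>k\<close>: a simplex that omits both
  other vertices is constant at \<open>k\<close>. Compatibility thus reduces to a common corner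
  value \<open>x0\<close>.\<close>

lemma triangle_filler:
  assumes k: "k \<le> 2" and e: "\<And>i. i \<le> 2 \<Longrightarrow> i \<noteq> k \<Longrightarrow> e i \<in> simps X 1"
    and y: "y \<in> simps Y 2"
    and \<phi>e: "\<And>i. i \<le> 2 \<Longrightarrow> i \<noteq> k \<Longrightarrow> \<phi> 1 (e i) = act Y 1 2 (coface 2 i) y"
    and corner: "\<And>i. i \<le> 2 \<Longrightarrow> i \<noteq> k \<Longrightarrow> vert X 1 (retract_from i k) (e i) = x0"
  obtains x where "x \<in> simps X 2" "\<phi> 2 x = y"
    "\<And>i. i \<le> 2 \<Longrightarrow> i \<noteq> k \<Longrightarrow> act X 1 2 (coface 2 i) x = e i"
proof (rule horn_filler[of 2 k e y])
  fix m \<alpha> i j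
  assume \<alpha>: "\<alpha> \<in> simplex_ops m 2" and ij: "i \<le> 2" "j \<le> 2" "i \<noteq> k" "j \<noteq> k"
    "i \<notin> \<alpha> ` {..m}" "j \<notin> \<alpha> ` {..m}"
  show "act X m (2 - 1) (lower m i \<alpha>) (e i) = act X m (2 - 1) (lower m j \<alpha>) (e j)"
  proof (cases "i = j")
    case False
    have \<alpha>k: "\<alpha> h = k" if "h \<le> m" for h
    proof -
      have "\<alpha> h \<le> 2" "\<alpha> h \<noteq> i" "\<alpha> h \<noteq> j" using simplex_ops_le[OF \<alpha> that] ij(5,6) that by auto
      then show ?thesis using False ij(1-4) k by linarith
    qed
    have z: "restrict (\<lambda>_. 0) {..m} \<in> simplex_ops m 0" by (rule simplex_opsI) auto
    have "act X m 1 (lower m i \<alpha>) (e i) = act X m 0 (restrict (\<lambda>_. 0) {..m}) x0"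
      if i: "i \<le> 2" "i \<noteq> k" for i
    proof -
      have r: "retract_from i k \<le> 1" using i k by (auto simp: retract_from_def)
      have "lower m i \<alpha> = compose {..m} (vertex_op (retract_from i k)) (restrict (\<lambda>_. 0) {..m})"
        using \<alpha>k by (auto simp: lower_def compose_def vertex_op_def)
      then show ?thesis
        using X.act_compose[OF vertex_op[OF r] z e[OF i]] corner[OF i] by simp
    qed
    then show ?thesis using ij by simp
  qed simp
next
  fix i assume i: "i \<le> 2" "i \<noteq> k"
  show "e i \<in> simps X (2 - 1)" using e[OF i] by simp
  show "\<phi> (2 - 1) (e i) = act Y (2 - 1) 2 (coface 2 i) y" using \<phi>e[OF i] by simp
next
  fix x assume x: "x \<in> simps X 2" "\<phi> 2 x = y"
    "\<And>i. i \<le> 2 \<Longrightarrow> i \<noteq> k \<Longrightarrow> act X (2 - 1) 2 (coface 2 i) x = e i"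
  have "act X 1 2 (coface 2 i) x = e i" if "i \<le> 2" "i \<noteq> k" for i
    using x(3)[OF that] by simp
  with x show thesis by (intro that) auto
qed (use k y in auto)

section \<open>End points of lifted edges and fibrewise components\<close>

definition lifts :: "'y \<Rightarrow> ('x \<times> 'x) set" where
  "lifts e = {(a, b). \<exists>\<epsilon>\<in>simps X 1. \<phi> 1 \<epsilon> = e \<and> vert X 1 0 \<epsilon> = a \<and> vert X 1 1 \<epsilon> = b}"

abbreviation vfib :: "'y \<Rightarrow> 'x set" where
  "vfib y \<equiv> {x \<in> simps X 0. \<phi> 0 x = y}"

lemma lifts_vfib:
  assumes "(a, b) \<in> lifts e"
  shows "a \<in> vfib (vert Y 1 0 e)" "b \<in> vfib (vert Y 1 1 e)"
  using assms X.vert_closed map_act[OF vertex_op] by (auto simp: lifts_def)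

lemma lifts_edgeI:
  assumes "x \<in> simps X n" "i \<le> j" "j \<le> n"
  shows "(vert X n i x, vert X n j x) \<in> lifts (edge Y n i j (\<phi> n x))"
  using X.edge_closed[OF assms] X.vert_edge[OF assms] map_act[OF edge_op[OF assms(2,3)] assms(1)]
  unfolding lifts_def by blast

lemma lifts_total:
  assumes "\<tau> \<in> simps Y n" "i \<le> j" "j \<le> n"
  shows "a \<in> vfib (vert Y n i \<tau>) \<Longrightarrow> \<exists>b. (a, b) \<in> lifts (edge Y n i j \<tau>)"
    and "b \<in> vfib (vert Y n j \<tau>) \<Longrightarrow> \<exists>a. (a, b) \<in> lifts (edge Y n i j \<tau>)"
  using edge_filler[OF _ _ Y.edge_closed[OF assms], of 0] edge_filler[OF _ _ Y.edge_closed[OF assms], of 1]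
    Y.vert_edge[OF assms]
  unfolding lifts_def by (auto, metis zero_le, metis order_refl)

text \<open>\<open>c\<close> labels the vertices of the triangle. Two sides whose labels are joined
  by lifts form a horn, and the filler provides a lift of the third side. Leaving \<open>k\<close>
  free covers composition and both cancellations at once.\<close>

lemma lifts_horn:
  assumes y: "y \<in> simps Y 2" and k: "k \<le> 2"
    and horn: "\<And>i. i \<le> 2 \<Longrightarrow> i \<noteq> k \<Longrightarrow> (c (coface 2 i 0), c (coface 2 i 1)) \<in> lifts (act Y 1 2 (coface 2 i) y)"
  shows "(c (coface 2 k 0), c (coface 2 k 1)) \<in> lifts (act Y 1 2 (coface 2 k) y)"
proof -
  have "\<forall>i. \<exists>\<epsilon>. i \<le> 2 \<longrightarrow> i \<noteq> k \<longrightarrow> \<epsilon> \<in> simps X 1 \<and> \<phi> 1 \<epsilon> = act Y 1 2 (coface 2 i) y \<and>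
      (\<forall>h\<le>1. vert X 1 h \<epsilon> = c (coface 2 i h))"
    using horn by (auto simp: lifts_def le_Suc_eq)
  from choice[OF this] obtain e where e: "\<And>i. i \<le> 2 \<Longrightarrow> i \<noteq> k \<Longrightarrow> e i \<in> simps X 1"
    "\<And>i. i \<le> 2 \<Longrightarrow> i \<noteq> k \<Longrightarrow> \<phi> 1 (e i) = act Y 1 2 (coface 2 i) y"
    "\<And>i h. i \<le> 2 \<Longrightarrow> i \<noteq> k \<Longrightarrow> h \<le> 1 \<Longrightarrow> vert X 1 h (e i) = c (coface 2 i h)" by blast
  have r: "retract_from i j \<le> 1" "coface 2 i (retract_from i j) = j" if "i \<le> 2" "j \<le> 2" "i \<noteq> j" for i j
    using that by (auto simp: retract_from_def coface_def)
  have corner: "vert X 1 (retract_from i j) (e i) = c j" if "i \<le> 2" "i \<noteq> k" "j \<le> 2" "i \<noteq> j" for i j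
    using e(3)[OF that(1,2) r(1)[OF that(1,3,4)]] r(2)[OF that(1,3,4)] by simp
  obtain x where x: "x \<in> simps X 2" "\<phi> 2 x = y"
    "\<And>i. i \<le> 2 \<Longrightarrow> i \<noteq> k \<Longrightarrow> act X 1 2 (coface 2 i) x = e i"
    using triangle_filler[OF k e(1) y e(2) corner[OF _ _ k]] by blast
  have cof: "coface 2 i \<in> simplex_ops 1 2" if "i \<le> 2" for i using coface[of 2 i] that by simp
  have verts: "vert X 2 j x = c j" if j: "j \<le> 2" for j
  proof -
    \<comment> \<open>The vertex \<open>j\<close> of the filler is read off from a prescribed face,
      one opposite to a vertex other than \<open>j\<close> and \<open>k\<close>.\<close>
    obtain i where i: "i \<le> 2" "i \<noteq> k" "i \<noteq> j"
    proof -
      have "\<exists>i :: nat. i \<le> 2 \<and> i \<noteq> k \<and> i \<noteq> j" by presburger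
      then show ?thesis using that by blast
    qed
    have "vert X 2 (coface 2 i (retract_from i j)) x = vert X 1 (retract_from i j) (e i)"
      using X.vert_act[OF cof[OF i(1)] x(1) r(1)[OF i(1) j i(3)]] x(3)[OF i(1,2)] by simp
    then show ?thesis using corner[OF i(1,2) j i(3)] r(2)[OF i(1) j i(3)] by simp
  qed
  have "vert X 1 h (act X 1 2 (coface 2 k) x) = c (coface 2 k h)" if "h \<le> 1" for h
    using X.vert_act[OF cof[OF k] x(1) that] verts simplex_ops_le[OF cof[OF k] that] by simp
  then show ?thesis
    using X.act_closed[OF cof[OF k] x(1)] map_act[OF cof[OF k] x(1)] x(2) unfolding lifts_def by auto
qed

text \<open>The fillers of the three horns of a triangle give composition and the two cancellations.
  The indices may coincide, so the same rules apply to degenerate triangles and thereby to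
  \<open>sim\<close>.\<close>

lemma lifts_triangle:
  assumes "\<tau> \<in> simps Y n" "i \<le> j" "j \<le> l" "l \<le> n"
  shows "(a, b) \<in> lifts (edge Y n i j \<tau>) \<Longrightarrow> (b, c) \<in> lifts (edge Y n j l \<tau>) \<Longrightarrow> (a, c) \<in> lifts (edge Y n i l \<tau>)"
    and "(a, b) \<in> lifts (edge Y n i j \<tau>) \<Longrightarrow> (a, c) \<in> lifts (edge Y n i l \<tau>) \<Longrightarrow> (b, c) \<in> lifts (edge Y n j l \<tau>)"
    and "(a, c) \<in> lifts (edge Y n i l \<tau>) \<Longrightarrow> (b, c) \<in> lifts (edge Y n j l \<tau>) \<Longrightarrow> (a, b) \<in> lifts (edge Y n i j \<tau>)"
proof -
  let ?y = "act Y 2 n (triangle_op i j l) \<tau>" and ?c = "\<lambda>i :: nat. if i = 0 then a else if i = 1 then b else c"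
  have y: "?y \<in> simps Y 2" by (rule Y.act_closed[OF triangle_op[OF assms(2-4)] assms(1)])
  define P where "P i \<longleftrightarrow> (?c (coface 2 i 0), ?c (coface 2 i 1)) \<in> lifts (act Y 1 2 (coface 2 i) ?y)" for i
  have P: "P 2 \<longleftrightarrow> (a, b) \<in> lifts (edge Y n i j \<tau>)" "P 0 \<longleftrightarrow> (b, c) \<in> lifts (edge Y n j l \<tau>)"
    "P 1 \<longleftrightarrow> (a, c) \<in> lifts (edge Y n i l \<tau>)"
    unfolding P_def coface_small Y.edge_triangle[OF assms] by (simp_all add: edge_op_def)
  have le2: "i = 0 \<or> i = 1 \<or> i = 2" if "i \<le> 2" for i :: nat using that by auto
  have fill: "P k" if "k \<le> 2" "\<And>i. i \<le> 2 \<Longrightarrow> i \<noteq> k \<Longrightarrow> P i" for k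
    using lifts_horn[OF y that(1), of ?c] that(2) unfolding P_def by blast
  show "(a, b) \<in> lifts (edge Y n i j \<tau>) \<Longrightarrow> (b, c) \<in> lifts (edge Y n j l \<tau>) \<Longrightarrow> (a, c) \<in> lifts (edge Y n i l \<tau>)"
    "(a, b) \<in> lifts (edge Y n i j \<tau>) \<Longrightarrow> (a, c) \<in> lifts (edge Y n i l \<tau>) \<Longrightarrow> (b, c) \<in> lifts (edge Y n j l \<tau>)"
    "(a, c) \<in> lifts (edge Y n i l \<tau>) \<Longrightarrow> (b, c) \<in> lifts (edge Y n j l \<tau>) \<Longrightarrow> (a, b) \<in> lifts (edge Y n i j \<tau>)"
    unfolding P[symmetric] using fill[of 1] fill[of 0] fill[of 2] le2 by (metis order_refl zero_le one_le_numeral)+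
qed

lemma lifts_vfib_edge:
  assumes "\<tau> \<in> simps Y n" "i \<le> j" "j \<le> n" "(a, b) \<in> lifts (edge Y n i j \<tau>)"
  shows "a \<in> vfib (vert Y n i \<tau>)" "b \<in> vfib (vert Y n j \<tau>)"
  using lifts_vfib[OF assms(4)] Y.vert_edge[OF assms(1-3)] by auto

text \<open>Lifts of the degenerate edge at \<open>y\<close> are the edges inside the fibre, so the
  relation joins vertices in one path component of the fibre.\<close>

definition sim :: "'y \<Rightarrow> ('x \<times> 'x) set" where
  "sim y = lifts (edge Y 0 0 0 y)"

lemma sim_vert:
  assumes "\<tau> \<in> simps Y n" "i \<le> n"
  shows "sim (vert Y n i \<tau>) = lifts (edge Y n i i \<tau>)"
  by (simp only: sim_def Y.edge_vert[OF assms])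

text \<open>Edges cannot be reversed directly. Symmetry comes from cancelling an edge against the
  degenerate one, and transitivity is composition in a degenerate triangle.\<close>

lemma equiv_sim:
  assumes y: "y \<in> simps Y 0"
  shows "equiv (vfib y) (sim y)"
proof (rule equivI)
  note tri = lifts_triangle[OF y order_refl order_refl order_refl, of _ _ _, folded sim_def]
  show sub: "sim y \<subseteq> vfib y \<times> vfib y"
    using lifts_vfib_edge[OF y order_refl order_refl] Y.vert_self[OF y] by (auto simp: sim_def)
  have refl: "(x, x) \<in> sim y" if "x \<in> vfib y" for x
    using lifts_edgeI[of x 0 0 0] X.vert_self[of x] that by (auto simp: sim_def)
  then show "refl_on (vfib y) (sim y)" by (rule refl_onI)
  show "sym (sim y)"
  proof (rule symI)
    fix a b assume "(a, b) \<in> sim y"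
    then show "(b, a) \<in> sim y" using tri(2) refl sub by blast
  qed
  show "trans (sim y)" by (rule transI) (rule tri(1))
qed

section \<open>Transport of components along edges\<close>

abbreviation transport :: "nat \<Rightarrow> nat \<Rightarrow> nat \<Rightarrow> 'y \<Rightarrow> 'x set \<Rightarrow> 'x set" where
  "transport n i j \<tau> s \<equiv> lifts (edge Y n i j \<tau>) `` s"

abbreviation cmpts :: "'y \<Rightarrow> 'x set set" where
  "cmpts y \<equiv> vfib y // sim y"

text \<open>Composing and cancelling with the degenerate edges at both ends shows that the image of
  a whole class is the class of the end of any one lift.\<close>

lemma transport_class:
  assumes \<tau>: "\<tau> \<in> simps Y n" "i \<le> j" "j \<le> n" and ab: "(a, b) \<in> lifts (edge Y n i j \<tau>)"
  shows "transport n i j \<tau> (sim (vert Y n i \<tau>) `` {a}) = sim (vert Y n j \<tau>) `` {b}"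
proof -
  have i: "i \<le> n" using \<tau> by simp
  show ?thesis
    unfolding sim_vert[OF \<tau>(1) i] sim_vert[OF \<tau>(1,3)]
  proof (intro subset_antisym subsetI)
    fix b' assume "b' \<in> transport n i j \<tau> (lifts (edge Y n i i \<tau>) `` {a})"
    then obtain a' where "(a, a') \<in> lifts (edge Y n i i \<tau>)" "(a', b') \<in> lifts (edge Y n i j \<tau>)" by blast
    then have "(a, b') \<in> lifts (edge Y n i j \<tau>)"
      using lifts_triangle(1)[OF \<tau>(1) order_refl \<tau>(2,3)] by blast
    then show "b' \<in> lifts (edge Y n j j \<tau>) `` {b}"
      using lifts_triangle(2)[OF \<tau>(1,2) order_refl \<tau>(3)] ab by blast
  next
    fix b' assume "b' \<in> lifts (edge Y n j j \<tau>) `` {b}"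
    then have "(a, b') \<in> lifts (edge Y n i j \<tau>)"
      using lifts_triangle(1)[OF \<tau>(1,2) order_refl \<tau>(3)] ab by blast
    moreover have "(a, a) \<in> lifts (edge Y n i i \<tau>)"
      using equiv_sim[OF Y.vert_closed[OF \<tau>(1) i]] lifts_vfib_edge(1)[OF \<tau> ab] sim_vert[OF \<tau>(1) i]
      by (metis equiv_class_self Image_singleton_iff)
    ultimately show "b' \<in> transport n i j \<tau> (lifts (edge Y n i i \<tau>) `` {a})" by blast
  qed
qed

lemma cmptsE:
  assumes "s \<in> cmpts y"
  obtains a where "a \<in> vfib y" "s = sim y `` {a}"
  using assms by (rule quotientE)

lemma transport_closed:
  assumes \<tau>: "\<tau> \<in> simps Y n" "i \<le> j" "j \<le> n" and s: "s \<in> cmpts (vert Y n i \<tau>)"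
  shows "transport n i j \<tau> s \<in> cmpts (vert Y n j \<tau>)"
proof -
  obtain a where a: "a \<in> vfib (vert Y n i \<tau>)" "s = sim (vert Y n i \<tau>) `` {a}" using s by (rule cmptsE)
  obtain b where b: "(a, b) \<in> lifts (edge Y n i j \<tau>)" using lifts_total(1)[OF \<tau> a(1)] by blast
  show ?thesis
    unfolding a(2) transport_class[OF \<tau> b] by (rule quotientI[OF lifts_vfib_edge(2)[OF \<tau> b]])
qed

lemma transport_self:
  assumes \<tau>: "\<tau> \<in> simps Y n" "i \<le> n" and s: "s \<in> cmpts (vert Y n i \<tau>)"
  shows "transport n i i \<tau> s = s"
proof -
  obtain a where a: "a \<in> vfib (vert Y n i \<tau>)" "s = sim (vert Y n i \<tau>) `` {a}" using s by (rule cmptsE)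
  have "(a, a) \<in> lifts (edge Y n i i \<tau>)"
    using equiv_class_self[OF equiv_sim[OF Y.vert_closed[OF \<tau>]] a(1)] sim_vert[OF \<tau>] by simp
  then show ?thesis unfolding a(2) by (rule transport_class[OF \<tau>(1) order_refl \<tau>(2)])
qed

lemma transport_transport:
  assumes \<tau>: "\<tau> \<in> simps Y n" "i \<le> j" "j \<le> l" "l \<le> n" and s: "s \<in> cmpts (vert Y n i \<tau>)"
  shows "transport n j l \<tau> (transport n i j \<tau> s) = transport n i l \<tau> s"
proof -
  have j: "j \<le> n" and il: "i \<le> l" using \<tau> by auto
  obtain a where a: "a \<in> vfib (vert Y n i \<tau>)" "s = sim (vert Y n i \<tau>) `` {a}" using s by (rule cmptsE)
  obtain b where b: "(a, b) \<in> lifts (edge Y n i j \<tau>)" using lifts_total(1)[OF \<tau>(1,2) j a(1)] by blast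
  obtain c where c: "(b, c) \<in> lifts (edge Y n j l \<tau>)"
    using lifts_total(1)[OF \<tau>(1,3,4) lifts_vfib_edge(2)[OF \<tau>(1,2) j b]] by blast
  have "(a, c) \<in> lifts (edge Y n i l \<tau>)" by (rule lifts_triangle(1)[OF \<tau> b c])
  then show ?thesis
    unfolding a(2) transport_class[OF \<tau>(1,2) j b] transport_class[OF \<tau>(1,3,4) c]
    using transport_class[OF \<tau>(1) il \<tau>(4)] by simp
qed

text \<open>If the transported classes agree, composing one lift with an edge in the final fibre
  lets both lifts end at \<open>b'\<close>; cancelling them relates their starting points. Every
  class is reached because a lift may also be prescribed at its end.\<close>

lemma transport_bij:
  assumes \<tau>: "\<tau> \<in> simps Y n" "i \<le> j" "j \<le> n"
  shows "bij_betw (transport n i j \<tau>) (cmpts (vert Y n i \<tau>)) (cmpts (vert Y n j \<tau>))"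
proof -
  have i: "i \<le> n" using \<tau> by simp
  note eqi = equiv_sim[OF Y.vert_closed[OF \<tau>(1) i]] and eqj = equiv_sim[OF Y.vert_closed[OF \<tau>(1,3)]]
  have "s = s'" if s: "s \<in> cmpts (vert Y n i \<tau>)" and s': "s' \<in> cmpts (vert Y n i \<tau>)"
    and eq: "transport n i j \<tau> s = transport n i j \<tau> s'" for s s'
  proof -
    obtain a where a: "a \<in> vfib (vert Y n i \<tau>)" "s = sim (vert Y n i \<tau>) `` {a}" using s by (rule cmptsE)
    obtain a' where a': "a' \<in> vfib (vert Y n i \<tau>)" "s' = sim (vert Y n i \<tau>) `` {a'}" using s' by (rule cmptsE)
    obtain b where b: "(a, b) \<in> lifts (edge Y n i j \<tau>)" using lifts_total(1)[OF \<tau> a(1)] by blast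
    obtain b' where b': "(a', b') \<in> lifts (edge Y n i j \<tau>)" using lifts_total(1)[OF \<tau> a'(1)] by blast
    have "sim (vert Y n j \<tau>) `` {b} = sim (vert Y n j \<tau>) `` {b'}"
      using eq unfolding a(2) a'(2) transport_class[OF \<tau> b] transport_class[OF \<tau> b'] .
    then have "(b, b') \<in> sim (vert Y n j \<tau>)"
      by (rule eq_equiv_class[OF _ eqj lifts_vfib_edge(2)[OF \<tau> b']])
    then have "(a, b') \<in> lifts (edge Y n i j \<tau>)"
      unfolding sim_vert[OF \<tau>(1,3)] by (rule lifts_triangle(1)[OF \<tau>(1,2) order_refl \<tau>(3) b])
    then have "(a, a') \<in> sim (vert Y n i \<tau>)"
      unfolding sim_vert[OF \<tau>(1) i] by (rule lifts_triangle(3)[OF \<tau>(1) order_refl \<tau>(2,3) _ b'])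
    then show "s = s'" unfolding a(2) a'(2) by (rule equiv_class_eq[OF eqi])
  qed
  then have inj: "inj_on (transport n i j \<tau>) (cmpts (vert Y n i \<tau>))" by (rule inj_onI)
  have closed: "transport n i j \<tau> ` cmpts (vert Y n i \<tau>) \<subseteq> cmpts (vert Y n j \<tau>)"
    using transport_closed[OF \<tau>] by blast
  have onto: "s \<in> transport n i j \<tau> ` cmpts (vert Y n i \<tau>)" if s: "s \<in> cmpts (vert Y n j \<tau>)" for s
  proof -
    obtain b where b: "b \<in> vfib (vert Y n j \<tau>)" "s = sim (vert Y n j \<tau>) `` {b}" using s by (rule cmptsE)
    obtain a where a: "(a, b) \<in> lifts (edge Y n i j \<tau>)" using lifts_total(2)[OF \<tau> b(1)] by blast
    show ?thesis
      unfolding b(2) transport_class[OF \<tau> a, symmetric]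
      by (rule imageI[OF quotientI[OF lifts_vfib_edge(1)[OF \<tau> a]]])
  qed
  show ?thesis unfolding bij_betw_def by (intro conjI inj subset_antisym closed subsetI onto)
qed

text \<open>The fibrewise path components of \<open>\<phi>\<close>, as a covering of \<open>Y\<close>; a component over a simplex is
  recorded by its restriction to the vertex \<open>0\<close>.\<close>

definition components :: "('y \<times> 'x set) sset" where
  "components = \<lparr>simps = \<lambda>n. {(\<tau>, s). \<tau> \<in> simps Y n \<and> s \<in> cmpts (vert Y n 0 \<tau>)},
    act = \<lambda>m n \<theta> (\<tau>, s). (act Y m n \<theta> \<tau>, transport n 0 (\<theta> 0) \<tau> s)\<rparr>"

text \<open>The factor of \<open>\<phi>\<close> through the covering: \<open>fst\<close> after
  \<open>component n\<close> is \<open>\<phi> n\<close>. A right inverse of \<open>\<phi>\<close> up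
  to homotopy on realizations thus yields one of the projection.\<close>

definition component :: "nat \<Rightarrow> 'x \<Rightarrow> 'y \<times> 'x set" where
  "component n \<xi> = (\<phi> n \<xi>, sim (vert Y n 0 (\<phi> n \<xi>)) `` {vert X n 0 \<xi>})"

lemma simps_components: "(\<tau>, s) \<in> simps components n \<longleftrightarrow> \<tau> \<in> simps Y n \<and> s \<in> cmpts (vert Y n 0 \<tau>)"
  by (simp add: components_def)

lemma act_components: "act components m n \<theta> (\<tau>, s) = (act Y m n \<theta> \<tau>, transport n 0 (\<theta> 0) \<tau> s)"
  by (simp add: components_def)

lemma transport_act:
  assumes "\<theta> \<in> simplex_ops m n" "\<tau> \<in> simps Y n" "i \<le> j" "j \<le> m"
  shows "transport m i j (act Y m n \<theta> \<tau>) = transport n (\<theta> i) (\<theta> j) \<tau>"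
  by (simp only: Y.edge_act[OF assms])

text \<open>The fibre over \<open>\<tau>\<close> is the set of components at its vertex 0, on which
  \<open>\<theta>\<close> acts by transport from \<open>0\<close> to \<open>\<theta> 0\<close>.
  Functoriality is \<open>transport_transport\<close>, and the bijection of fibres is
  \<open>transport_bij\<close>.\<close>

lemma simplicial_covering_components: "simplicial_covering components Y (\<lambda>_. fst)"
proof
  fix m n \<theta> x assume \<theta>: "\<theta> \<in> simplex_ops m n" and x: "x \<in> simps components n"
  obtain \<tau> s where xs: "x = (\<tau>, s)" by force
  with x have \<tau>: "\<tau> \<in> simps Y n" "s \<in> cmpts (vert Y n 0 \<tau>)" by (auto simp: simps_components)
  show "act components m n \<theta> x \<in> simps components m"
    using transport_closed[OF \<tau>(1) _ simplex_ops_le[OF \<theta>] \<tau>(2), of 0] Y.act_closed[OF \<theta> \<tau>(1)]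
      Y.vert_act[OF \<theta> \<tau>(1), of 0] by (simp add: xs act_components simps_components)
next
  fix n x assume x: "x \<in> simps components n"
  obtain \<tau> s where xs: "x = (\<tau>, s)" by force
  with x have \<tau>: "\<tau> \<in> simps Y n" "s \<in> cmpts (vert Y n 0 \<tau>)" by (auto simp: simps_components)
  show "act components n n (restrict id {..n}) x = x"
    using transport_self[OF \<tau>(1) _ \<tau>(2)] Y.act_id[OF \<tau>(1)] by (simp add: xs act_components)
next
  fix l m n \<theta> \<eta> x
  assume \<theta>: "\<theta> \<in> simplex_ops m n" and \<eta>: "\<eta> \<in> simplex_ops l m" and x: "x \<in> simps components n"
  obtain \<tau> s where xs: "x = (\<tau>, s)" by force
  with x have \<tau>: "\<tau> \<in> simps Y n" "s \<in> cmpts (vert Y n 0 \<tau>)" by (auto simp: simps_components)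
  have le: "\<eta> 0 \<le> m" "\<theta> 0 \<le> \<theta> (\<eta> 0)" "\<theta> (\<eta> 0) \<le> n"
    using simplex_ops_le[OF \<eta>, of 0] simplex_ops_mono[OF \<theta>, of 0 "\<eta> 0"] simplex_ops_le[OF \<theta>, of "\<eta> 0"] by auto
  show "act components l m \<eta> (act components m n \<theta> x) = act components l n (compose {..l} \<theta> \<eta>) x"
    using transport_transport[OF \<tau>(1) _ le(2,3) \<tau>(2)] Y.act_compose[OF \<theta> \<eta> \<tau>(1)]
      transport_act[OF \<theta> \<tau>(1) _ le(1), of 0]
    by (simp add: xs act_components compose_def)
next
  show "simplicial_map components Y (\<lambda>_. fst)"
    by (auto simp: simplicial_map_def simps_components act_components)
next
  fix m n \<theta> y assume \<theta>: "\<theta> \<in> simplex_ops m n" and y: "y \<in> simps Y n"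
  have fib: "{x \<in> simps components n. fst x = y} = Pair y ` cmpts (vert Y n 0 y)" if "y \<in> simps Y n" for n y
    using that by (auto simp: simps_components)
  have b: "bij_betw (transport n 0 (\<theta> 0) y) (cmpts (vert Y n 0 y)) (cmpts (vert Y n (\<theta> 0) y))"
    using transport_bij[OF y _ simplex_ops_le[OF \<theta>], of 0] by simp
  have "act components m n \<theta> ` Pair y ` cmpts (vert Y n 0 y) =
      Pair (act Y m n \<theta> y) ` transport n 0 (\<theta> 0) y ` cmpts (vert Y n 0 y)"
    by (simp only: image_image act_components)
  also have "\<dots> = Pair (act Y m n \<theta> y) ` cmpts (vert Y m 0 (act Y m n \<theta> y))"
    using bij_betw_imp_surj_on[OF b] Y.vert_act[OF \<theta> y, of 0] by simp
  finally have img: "act components m n \<theta> ` Pair y ` cmpts (vert Y n 0 y) =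
    Pair (act Y m n \<theta> y) ` cmpts (vert Y m 0 (act Y m n \<theta> y))" .
  have "inj_on (act components m n \<theta>) (Pair y ` cmpts (vert Y n 0 y))"
    using bij_betw_imp_inj_on[OF b] by (auto simp: inj_on_def act_components)
  then show "bij_betw (act components m n \<theta>) {x \<in> simps components n. fst x = y}
      {x \<in> simps components m. fst x = act Y m n \<theta> y}"
    unfolding fib[OF y] fib[OF Y.act_closed[OF \<theta> y]] bij_betw_def using img by blast
qed

lemma simplicial_map_component: "simplicial_map X components component"
  unfolding simplicial_map_def
proof (intro conjI allI ballI funcsetI)
  fix n \<xi> assume \<xi>: "\<xi> \<in> simps X n"
  have v: "vert X n 0 \<xi> \<in> vfib (vert Y n 0 (\<phi> n \<xi>))"
    using X.vert_closed[OF \<xi>] map_act[OF vertex_op \<xi>] by simp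
  show "component n \<xi> \<in> simps components n"
    unfolding component_def simps_components by (intro conjI map_closed[OF \<xi>] quotientI v)
next
  fix m n \<theta> \<xi> assume \<theta>: "\<theta> \<in> simplex_ops m n" and \<xi>: "\<xi> \<in> simps X n"
  have "transport n 0 (\<theta> 0) (\<phi> n \<xi>) (sim (vert Y n 0 (\<phi> n \<xi>)) `` {vert X n 0 \<xi>}) =
      sim (vert Y n (\<theta> 0) (\<phi> n \<xi>)) `` {vert X n (\<theta> 0) \<xi>}"
    using simplex_ops_le[OF \<theta>, of 0] by (intro transport_class map_closed lifts_edgeI \<xi>) auto
  then show "component m (act X m n \<theta> \<xi>) = act components m n \<theta> (component n \<xi>)"
    using X.vert_act[OF \<theta> \<xi>, of 0] Y.vert_act[OF \<theta> map_closed[OF \<xi>], of 0] map_act[OF \<theta> \<xi>]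
    by (simp add: component_def act_components)
qed

text \<open>A closed edge of the covering is a component \<open>s\<close> fixed by transport along
  \<open>e\<close>. A lift of \<open>e\<close> that starts at \<open>a\<close> in \<open>s\<close>
  ends at some \<open>b\<close> in the same component; composing it with an edge from
  \<open>b\<close> to \<open>a\<close> in the fibre closes it up.\<close>

theorem loop_lifts:
  assumes e: "e \<in> simps Y 1" "vert Y 1 0 e = vert Y 1 1 e"
    and g: "continuous_map (realization Y) (realization X) g"
    and homotopic: "homotopic_with (\<lambda>_. True) (realization Y) (realization Y) (realization_map Y \<phi> \<circ> g) id"
  obtains \<epsilon> where "\<epsilon> \<in> simps X 1" "\<phi> 1 \<epsilon> = e" "vert X 1 0 \<epsilon> = vert X 1 1 \<epsilon>"
proof -
  interpret C: simplicial_covering components Y "\<lambda>_. fst" by (rule simplicial_covering_components)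
  note Xs = X.simplicial_set_axioms and Cs = C.C.simplicial_set_axioms
  let ?k = "realization_map components component"
  have k: "continuous_map (realization X) (realization components) ?k"
    by (rule continuous_realization_map[OF Xs Cs simplicial_map_component])
  have "C.proj (?k w) = realization_map Y \<phi> w" if w: "w \<in> topspace (realization X)" for w
  proof -
    obtain n x t where x: "x \<in> simps X n" "t \<in> standard_simplex n" "w = cell X n x t"
      using w by (rule topspace_realizationE)
    have "component n x \<in> simps components n"
      using simplicial_map_component x(1) by (auto simp: simplicial_map_def)
    then show ?thesis
      using x realization_map_cell[OF Xs Cs simplicial_map_component x(1,2)]
        realization_map_cell[OF Xs Y.simplicial_set_axioms simplicial_map x(1,2)]
        C.proj_cell[of "component n x" n t] by (simp add: component_def)
  qed
  then have "homotopic_with (\<lambda>_. True) (realization Y) (realization Y) (C.proj \<circ> (?k \<circ> g)) id"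
    using continuous_map_funspace[OF g]
    by (intro homotopic_with_eq[OF homotopic]) auto
  then obtain x where x: "x \<in> simps components 1" "fst x = e" "vert components 1 0 x = vert components 1 1 x"
    using C.loop_edge_lifts[OF e continuous_map_compose[OF g k]] by blast
  obtain s where s: "x = (e, s)" using x(2) by (cases x) auto
  then have sc: "s \<in> cmpts (vert Y 1 0 e)" using x(1) by (simp add: simps_components)
  have "transport 1 0 0 e s = transport 1 0 1 e s"
    using x(3) by (simp add: s act_components vertex_op_def)
  then have fixed: "transport 1 0 1 e s = s" using transport_self[OF e(1) _ sc] by simp
  obtain a where a: "a \<in> vfib (vert Y 1 0 e)" "s = sim (vert Y 1 0 e) `` {a}" using sc by (rule cmptsE)
  obtain b where b: "(a, b) \<in> lifts (edge Y 1 0 1 e)" using lifts_total(1)[OF e(1) _ _ a(1), of 1] by auto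
  have "sim (vert Y 1 1 e) `` {b} = sim (vert Y 1 1 e) `` {a}"
    using fixed transport_class[OF e(1) _ _ b] e(2) unfolding a(2) by simp
  then have "(b, a) \<in> lifts (edge Y 1 1 1 e)"
    using eq_equiv_class[OF _ equiv_sim[OF Y.vert_closed[OF e(1)]], of 1 b a] a(1) e(2) sim_vert[OF e(1), of 1] by simp
  then have "(a, a) \<in> lifts (edge Y 1 0 1 e)"
    using lifts_triangle(1)[OF e(1) _ _ _ b] by simp
  then obtain \<epsilon> where \<epsilon>: "\<epsilon> \<in> simps X 1" "\<phi> 1 \<epsilon> = e" "vert X 1 0 \<epsilon> = a" "vert X 1 1 \<epsilon> = a"
    unfolding Y.edge_self[OF e(1)] lifts_def by blast
  show ?thesis by (rule that[OF \<epsilon>(1,2)]) (simp only: \<epsilon>)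
qed

end

section \<open>Smooth functions\<close>

text \<open>Product-open sets contain boxes. Only the coordinates below \<open>m\<close> can vary,
  so finitely many radii matter and a common one exists.\<close>

lemma openin_Euclidean_space_box:
  assumes V: "openin (Euclidean_space m) V" and p: "p \<in> V"
  obtains d where "d > 0" "\<And>y. (\<And>i. i < m \<Longrightarrow> \<bar>y i - p i\<bar> < d) \<Longrightarrow> (\<And>i. i \<ge> m \<Longrightarrow> y i = 0) \<Longrightarrow> y \<in> V"
proof -
  obtain S where S: "openin (powertop_real UNIV) S" "V = S \<inter> {x. \<forall>i\<ge>m. x i = 0}"
    using V unfolding Euclidean_space_def openin_subtopology by blast
  then have "p \<in> S" using p by auto
  then obtain B where B: "\<And>i. open (B i)" "p \<in> PiE UNIV B" "PiE UNIV B \<subseteq> S"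
    using S(1) unfolding openin_product_topology_alt by (metis UNIV_I open_openin)
  have "\<exists>d>0. \<forall>x. \<bar>x - p i\<bar> < d \<longrightarrow> x \<in> B i" for i
    using B(1)[of i] B(2) unfolding open_real by (auto simp: PiE_def Pi_def)
  then obtain d where d: "\<And>i. d i > 0" "\<And>i x. \<bar>x - p i\<bar> < d i \<Longrightarrow> x \<in> B i" by metis
  \<comment> \<open>The \<open>1\<close> keeps the minimum meaningful when
    \<open>m = 0\<close>.\<close>
  define e where "e = Min (insert 1 (d ` {..<m}))"
  have e: "e > 0" "\<And>i. i < m \<Longrightarrow> e \<le> d i" using d(1) by (auto simp: e_def)
  show ?thesis
  proof (rule that[OF e(1)])
    fix y assume y: "\<And>i. i < m \<Longrightarrow> \<bar>y i - p i\<bar> < e" "\<And>i. i \<ge> m \<Longrightarrow> y i = 0"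
    have "y i \<in> B i" for i
    proof (cases "i < m")
      case True then show ?thesis using y(1)[OF True] e(2)[OF True] by (intro d(2)) simp
    next
      case False
      then have "p i = 0" "y i = 0" using p S(2) y(2) by auto
      then show ?thesis using B(2) by (auto simp: PiE_def Pi_def) metis
    qed
    then have "y \<in> S" using B(3) by (auto simp: PiE_def Pi_def)
    then show "y \<in> V" using S(2) y(2) by auto
  qed
qed

lemma openin_Euclidean_space_zero:
  "openin (Euclidean_space m) V \<Longrightarrow> x \<in> V \<Longrightarrow> i \<ge> m \<Longrightarrow> x i = 0"
  using openin_subset[of "Euclidean_space m" V] by (auto simp: topspace_Euclidean_space)

lemma eventually_line:
  assumes U: "openin (Euclidean_space n) U" "x \<in> U" "i < n"
  shows "eventually (\<lambda>t. x(i := t) \<in> U) (nhds (x i))"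
proof -
  obtain d where d: "d > 0"
    "\<And>y. (\<And>i. i < n \<Longrightarrow> \<bar>y i - x i\<bar> < d) \<Longrightarrow> (\<And>i. i \<ge> n \<Longrightarrow> y i = 0) \<Longrightarrow> y \<in> U"
    using openin_Euclidean_space_box[OF U(1,2)] by blast
  have "x(i := t) \<in> U" if "dist t (x i) < d" for t
    using that openin_Euclidean_space_zero[OF U(1,2)] U(3) d(1) by (intro d(2)) (auto simp: dist_real_def)
  then show ?thesis using d(1) unfolding eventually_nhds_metric by blast
qed

lemma Ck_on_continuous: "Ck_on k n U f \<Longrightarrow> continuous_map (subtopology (Euclidean_space n) U) euclideanreal f"
  by (cases k) auto

lemma Ck_on_SucE:
  assumes "Ck_on (Suc k) n U f"
  obtains D where "\<And>i x. i < n \<Longrightarrow> x \<in> U \<Longrightarrow> ((\<lambda>t. f (x(i := t))) has_real_derivative D i x) (at (x i))"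
    "\<And>i. i < n \<Longrightarrow> Ck_on k n U (D i)"
proof -
  have "\<forall>i. \<exists>g. i < n \<longrightarrow> (\<forall>x\<in>U. ((\<lambda>t. f (x(i := t))) has_real_derivative g x) (at (x i))) \<and> Ck_on k n U g"
    using assms[unfolded Ck_on.simps(2)] by blast
  from choice[OF this] show ?thesis using that by blast
qed

lemma Ck_on_SucI:
  assumes "continuous_map (subtopology (Euclidean_space n) U) euclideanreal f"
    and "\<And>i x. i < n \<Longrightarrow> x \<in> U \<Longrightarrow> ((\<lambda>t. f (x(i := t))) has_real_derivative D i x) (at (x i))"
    and "\<And>i. i < n \<Longrightarrow> Ck_on k n U (D i)"
  shows "Ck_on (Suc k) n U f"
  unfolding Ck_on.simps(2)
proof (intro conjI allI impI assms(1))
  show "\<exists>g. (\<forall>x\<in>U. ((\<lambda>t. f (x(i := t))) has_real_derivative g x) (at (x i))) \<and> Ck_on k n U g" if "i < n" for i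
    by (rule exI[of _ "D i"]) (intro conjI ballI assms(2,3) that)
qed

lemma Ck_on_SucD: "Ck_on (Suc k) n U f \<Longrightarrow> Ck_on k n U f"
proof (induction k arbitrary: f)
  case (Suc k)
  obtain D where D: "\<And>i x. i < n \<Longrightarrow> x \<in> U \<Longrightarrow> ((\<lambda>t. f (x(i := t))) has_real_derivative D i x) (at (x i))"
    "\<And>i. i < n \<Longrightarrow> Ck_on (Suc k) n U (D i)"
    using Suc.prems by (rule Ck_on_SucE) blast
  show ?case by (rule Ck_on_SucI[OF Ck_on_continuous[OF Suc.prems] D(1) Suc.IH[OF D(2)]])
qed simp

lemma Ck_on_subset: "Ck_on k n U f \<Longrightarrow> V \<subseteq> U \<Longrightarrow> Ck_on k n V f"
proof (induction k arbitrary: f)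
  case 0
  then show ?case by (auto intro: continuous_map_from_subtopology_mono)
next
  case (Suc k)
  obtain D where D: "\<And>i x. i < n \<Longrightarrow> x \<in> U \<Longrightarrow> ((\<lambda>t. f (x(i := t))) has_real_derivative D i x) (at (x i))"
    "\<And>i. i < n \<Longrightarrow> Ck_on k n U (D i)"
    using Suc.prems(1) by (rule Ck_on_SucE) blast
  show ?case
    by (rule Ck_on_SucI[OF continuous_map_from_subtopology_mono[OF Ck_on_continuous[OF Suc.prems(1)] Suc.prems(2)]
        D(1) Suc.IH[OF D(2) Suc.prems(2)]]) (use Suc.prems(2) in auto)
qed

text \<open>A partial derivative at \<open>x\<close> sees the function on a short line through
  \<open>x\<close>, which stays in \<open>U\<close> because \<open>U\<close> is open. So values
  outside \<open>U\<close> do not matter.\<close>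

lemma Ck_on_cong:
  assumes U: "openin (Euclidean_space n) U" and eq: "\<And>x. x \<in> U \<Longrightarrow> f x = f' x" and f: "Ck_on k n U f"
  shows "Ck_on k n U f'"
proof -
  have c: "continuous_map (subtopology (Euclidean_space n) U) euclideanreal f'"
    using Ck_on_continuous[OF f] by (rule continuous_map_eq) (use eq in auto)
  show ?thesis
  proof (cases k)
    case 0 then show ?thesis using c by simp
  next
    case (Suc k')
    obtain D where D: "\<And>i x. i < n \<Longrightarrow> x \<in> U \<Longrightarrow> ((\<lambda>t. f (x(i := t))) has_real_derivative D i x) (at (x i))"
      "\<And>i. i < n \<Longrightarrow> Ck_on k' n U (D i)"
      using f[unfolded Suc] by (rule Ck_on_SucE) blast
    have "((\<lambda>t. f' (x(i := t))) has_real_derivative D i x) (at (x i))" if i: "i < n" and x: "x \<in> U" for i x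
    proof -
      have "eventually (\<lambda>t. f (x(i := t)) = f' (x(i := t))) (nhds (x i))"
        using eventually_line[OF U x i] by (rule eventually_mono) (rule eq)
      then show ?thesis by (rule DERIV_cong_ev[OF refl _ refl, THEN iffD1, OF _ D(1)[OF i x]])
    qed
    then show ?thesis unfolding Suc by (rule Ck_on_SucI[OF c _ D(2)])
  qed
qed

lemma continuous_map_Union_open:
  assumes "\<And>V. V \<in> \<V> \<Longrightarrow> openin X V" "\<And>V. V \<in> \<V> \<Longrightarrow> continuous_map (subtopology X V) Y f"
  shows "continuous_map (subtopology X (\<Union>\<V>)) Y f"
  unfolding continuous_map_def
proof (intro conjI allI impI)
  show "f \<in> topspace (subtopology X (\<Union>\<V>)) \<rightarrow> topspace Y"
    using continuous_map_funspace[OF assms(2)] by fastforce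
  fix W assume W: "openin Y W"
  have "{x \<in> topspace (subtopology X (\<Union>\<V>)). f x \<in> W} =
      (\<Union>V\<in>\<V>. {x \<in> topspace (subtopology X V). f x \<in> W})" by auto
  moreover have "openin X {x \<in> topspace (subtopology X V). f x \<in> W}" if "V \<in> \<V>" for V
    using openin_trans_full[OF openin_continuous_map_preimage[OF assms(2)[OF that] W] assms(1)[OF that]] .
  ultimately have "openin X {x \<in> topspace (subtopology X (\<Union>\<V>)). f x \<in> W}" by auto
  moreover have "{x \<in> topspace (subtopology X (\<Union>\<V>)). f x \<in> W} =
      {x \<in> topspace (subtopology X (\<Union>\<V>)). f x \<in> W} \<inter> \<Union>\<V>" by auto
  ultimately show "openin (subtopology X (\<Union>\<V>)) {x \<in> topspace (subtopology X (\<Union>\<V>)). f x \<in> W}"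
    unfolding openin_subtopology by blast
qed

lemma Ck_on_Union:
  assumes "\<And>V. V \<in> \<V> \<Longrightarrow> openin (Euclidean_space n) V" "\<And>V. V \<in> \<V> \<Longrightarrow> Ck_on k n V f"
  shows "Ck_on k n (\<Union>\<V>) f"
  using assms(2)
proof (induction k arbitrary: f)
  case 0
  have "continuous_map (subtopology (Euclidean_space n) (\<Union>\<V>)) euclideanreal f"
    using assms(1) Ck_on_continuous[OF 0] by (rule continuous_map_Union_open)
  then show ?case by simp
next
  case (Suc k)
  \<comment> \<open>\<open>deriv\<close> provides one partial derivative on the whole union; the
    witnesses obtained on each \<open>V\<close> agree with it there.\<close>
  define g where "g i x = deriv (\<lambda>t. f (x(i := t))) (x i)" for i x
  have g: "(\<forall>x\<in>V. ((\<lambda>t. f (x(i := t))) has_real_derivative g i x) (at (x i))) \<and> Ck_on k n V (g i)"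
    if V: "V \<in> \<V>" and i: "i < n" for V i
  proof -
    obtain D where D: "\<And>i x. i < n \<Longrightarrow> x \<in> V \<Longrightarrow> ((\<lambda>t. f (x(i := t))) has_real_derivative D i x) (at (x i))"
      "\<And>i. i < n \<Longrightarrow> Ck_on k n V (D i)"
      using Suc.prems[OF V] by (rule Ck_on_SucE) blast
    have eq: "D i x = g i x" if "x \<in> V" for x using DERIV_imp_deriv[OF D(1)[OF i that]] by (simp add: g_def)
    show ?thesis using D(1)[OF i] eq Ck_on_cong[OF assms(1)[OF V] eq D(2)[OF i]] by metis
  qed
  have c: "continuous_map (subtopology (Euclidean_space n) (\<Union>\<V>)) euclideanreal f"
    using assms(1) Ck_on_continuous[OF Suc.prems] by (rule continuous_map_Union_open)
  show ?case by (rule Ck_on_SucI[OF c, where D = g]) (use g Suc.IH in blast)+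
qed

section \<open>Closure of C^k functions under algebra and composition\<close>

lemma Ck_on_const: "Ck_on k n U (\<lambda>_. c)"
proof (induction k arbitrary: c)
  case (Suc k)
  show ?case by (rule Ck_on_SucI[where D = "\<lambda>_ _. 0"]) (auto intro: Suc.IH)
qed simp

lemma Ck_on_add:
  assumes "Ck_on k n U f" "Ck_on k n U g"
  shows "Ck_on k n U (\<lambda>x. f x + g x)"
  using assms
proof (induction k arbitrary: f g)
  case 0
  then show ?case by (simp add: continuous_map_add)
next
  case (Suc k)
  obtain D where D: "\<And>i x. i < n \<Longrightarrow> x \<in> U \<Longrightarrow> ((\<lambda>t. f (x(i := t))) has_real_derivative D i x) (at (x i))"
    "\<And>i. i < n \<Longrightarrow> Ck_on k n U (D i)"
    using Suc.prems(1) by (rule Ck_on_SucE) blast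
  obtain D' where D': "\<And>i x. i < n \<Longrightarrow> x \<in> U \<Longrightarrow> ((\<lambda>t. g (x(i := t))) has_real_derivative D' i x) (at (x i))"
    "\<And>i. i < n \<Longrightarrow> Ck_on k n U (D' i)"
    using Suc.prems(2) by (rule Ck_on_SucE) blast
  show ?case
    by (rule Ck_on_SucI[where D = "\<lambda>i x. D i x + D' i x"])
      (intro continuous_map_add Ck_on_continuous[OF Suc.prems(1)] Ck_on_continuous[OF Suc.prems(2)]
        DERIV_add D D' Suc.IH; assumption)+
qed

lemma Ck_on_mult:
  assumes "Ck_on k n U f" "Ck_on k n U g"
  shows "Ck_on k n U (\<lambda>x. f x * g x)"
  using assms
proof (induction k arbitrary: f g)
  case 0
  then show ?case by (simp add: continuous_map_real_mult)
next
  case (Suc k)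
  obtain D where D: "\<And>i x. i < n \<Longrightarrow> x \<in> U \<Longrightarrow> ((\<lambda>t. f (x(i := t))) has_real_derivative D i x) (at (x i))"
    "\<And>i. i < n \<Longrightarrow> Ck_on k n U (D i)"
    using Suc.prems(1) by (rule Ck_on_SucE) blast
  obtain D' where D': "\<And>i x. i < n \<Longrightarrow> x \<in> U \<Longrightarrow> ((\<lambda>t. g (x(i := t))) has_real_derivative D' i x) (at (x i))"
    "\<And>i. i < n \<Longrightarrow> Ck_on k n U (D' i)"
    using Suc.prems(2) by (rule Ck_on_SucE) blast
  show ?case
  proof (rule Ck_on_SucI[where D = "\<lambda>i x. D i x * g x + D' i x * f x"])
    show "continuous_map (subtopology (Euclidean_space n) U) euclideanreal (\<lambda>x. f x * g x)"
      by (intro continuous_map_real_mult Ck_on_continuous[OF Suc.prems(1)] Ck_on_continuous[OF Suc.prems(2)])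
    show "((\<lambda>t. f (x(i := t)) * g (x(i := t))) has_real_derivative D i x * g x + D' i x * f x) (at (x i))"
      if "i < n" "x \<in> U" for i x
      using DERIV_mult[OF D(1)[OF that] D'(1)[OF that]] by simp
    show "Ck_on k n U (\<lambda>x. D i x * g x + D' i x * f x)" if "i < n" for i
      by (intro Ck_on_add Suc.IH D(2) D'(2) that Ck_on_SucD[OF Suc.prems(1)] Ck_on_SucD[OF Suc.prems(2)])
  qed
qed

lemma Ck_on_sum:
  assumes "\<And>j. j \<in> F \<Longrightarrow> Ck_on k n U (f j)"
  shows "Ck_on k n U (\<lambda>x. \<Sum>j\<in>F. f j x)"
  using assms by (induction F rule: infinite_finite_induct) (auto intro: Ck_on_const Ck_on_add)

text \<open>\<open>H\<close> lists the successive derivatives of \<open>H 0\<close>. Differentiating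
  the composite replaces \<open>H j\<close> by \<open>H (Suc j)\<close>, so the induction treats all
  \<open>j\<close> together.\<close>

lemma Ck_on_compose_real:
  assumes S: "open S" and H: "\<And>j t. t \<in> S \<Longrightarrow> (H j has_real_derivative H (Suc j) t) (at t)"
    and f: "Ck_on k n U f" "\<And>x. x \<in> U \<Longrightarrow> f x \<in> S"
  shows "Ck_on k n U (\<lambda>x. H (j :: nat) (f x))"
proof -
  have cont: "continuous_map (subtopology (Euclidean_space n) U) euclideanreal (\<lambda>x. H j (f x))"
    if "Ck_on k n U f" for j k
  proof -
    have "continuous_on S (H j)" using H by (intro DERIV_continuous_on) (auto intro: has_field_derivative_at_within)
    moreover have "continuous_map (subtopology (Euclidean_space n) U) (top_of_set S) f"
      using Ck_on_continuous[OF that] f(2) by (auto simp: continuous_map_in_subtopology)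
    ultimately show ?thesis using continuous_map_compose[of _ "top_of_set S" f euclideanreal "H j"] by (simp add: o_def)
  qed
  show ?thesis using f(1)
  proof (induction k arbitrary: j)
    case 0
    show ?case using cont[OF 0] by simp
  next
    case (Suc k)
    obtain D where D: "\<And>i x. i < n \<Longrightarrow> x \<in> U \<Longrightarrow> ((\<lambda>t. f (x(i := t))) has_real_derivative D i x) (at (x i))"
      "\<And>i. i < n \<Longrightarrow> Ck_on k n U (D i)"
      using Suc.prems by (rule Ck_on_SucE) blast
    have "((\<lambda>t. H j (f (x(i := t)))) has_real_derivative H (Suc j) (f x) * D i x) (at (x i))"
      if "i < n" "x \<in> U" for i x
      using DERIV_chain2[of "H j" _ "\<lambda>t. f (x(i := t))" "x i", OF _ D(1)[OF that]] H[OF f(2)[OF that(2)]] by simp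
    then show ?case
      by (rule Ck_on_SucI[OF cont[OF Suc.prems] _ Ck_on_mult[OF Suc.IH[OF Ck_on_SucD[OF Suc.prems]] D(2)]])
  qed
qed

text \<open>The chain rule follows from continuity of the partial derivatives: the coordinates are
  moved one at a time, the increments telescope, and the mean value theorem turns each into a value
  of \<open>D j\<close> near \<open>p\<close>.\<close>

lemma has_derivative_compose_partial:
  assumes V: "openin (Euclidean_space m) V"
    and f: "\<And>j y. j < m \<Longrightarrow> y \<in> V \<Longrightarrow> ((\<lambda>t. f (y(j := t))) has_real_derivative D j y) (at (y j))"
    and D: "\<And>j. j < m \<Longrightarrow> continuous_map (subtopology (Euclidean_space m) V) euclideanreal (D j)"
    and c: "\<And>j. j < m \<Longrightarrow> ((\<lambda>t. c t j) has_real_derivative c' j) (at t0)"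
    and cV: "c t0 \<in> V" "eventually (\<lambda>t. c t \<in> V) (at t0)"
  shows "((\<lambda>t. f (c t)) has_real_derivative (\<Sum>j<m. D j (c t0) * c' j)) (at t0)"
proof -
  define p where "p = c t0"
  have p: "p \<in> V" using cV by (simp add: p_def)
  have p0: "p i = 0" if "i \<ge> m" for i using openin_Euclidean_space_zero[OF V p that] .
  \<comment> \<open>The first \<open>j\<close> coordinates have already moved to \<open>c t\<close>,
    the others are still at \<open>p\<close>.\<close>
  define q where "q j t = (\<lambda>i. if i < j then c t i else p i)" for j t
  \<comment> \<open>The mean slope in direction \<open>j\<close>. The default \<open>D j p\<close>
    for a vanishing increment keeps both the telescoping identity and the limit valid.\<close>
  define \<psi> where "\<psi> j t = (if c t j = p j then D j p else (f (q (Suc j) t) - f (q j t)) / (c t j - p j))" for j t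
  obtain d where d: "d > 0"
    "\<And>y. (\<And>i. i < m \<Longrightarrow> \<bar>y i - p i\<bar> < d) \<Longrightarrow> (\<And>i. i \<ge> m \<Longrightarrow> y i = 0) \<Longrightarrow> y \<in> V"
    using openin_Euclidean_space_box[OF V p] by blast
  have near: "eventually (\<lambda>t. \<forall>i<m. \<bar>c t i - p i\<bar> < e) (at t0)" if "e > 0" for e
  proof -
    have "eventually (\<lambda>t. \<bar>c t i - p i\<bar> < e) (at t0)" if "i < m" for i
    proof -
      have "((\<lambda>t. c t i) \<longlongrightarrow> p i) (at t0)"
        using DERIV_isCont[OF c[OF that]] by (simp add: isCont_def p_def)
      from tendstoD[OF this \<open>e > 0\<close>] show ?thesis by (simp add: dist_real_def)
    qed
    then have "eventually (\<lambda>t. \<forall>i\<in>{..<m}. \<bar>c t i - p i\<bar> < e) (at t0)"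
      by (intro eventually_ball_finite) auto
    then show ?thesis by (simp only: Ball_def lessThan_iff)
  qed
  have lim: "(\<psi> j \<longlongrightarrow> D j p) (at t0)" if j: "j < m" for j
  proof (rule tendstoI)
    fix e :: real assume e: "e > 0"
    have "openin (subtopology (Euclidean_space m) V) {y \<in> topspace (subtopology (Euclidean_space m) V). D j y \<in> ball (D j p) e}"
      by (rule openin_continuous_map_preimage[OF D[OF j]]) simp
    then have "openin (Euclidean_space m) {y \<in> topspace (subtopology (Euclidean_space m) V). D j y \<in> ball (D j p) e}"
      using V openin_trans_full by blast
    moreover have "p \<in> {y \<in> topspace (subtopology (Euclidean_space m) V). D j y \<in> ball (D j p) e}"
      using p e openin_subset[OF V] by auto
    ultimately obtain d' where d': "d' > 0"
      "\<And>y. (\<And>i. i < m \<Longrightarrow> \<bar>y i - p i\<bar> < d') \<Longrightarrow> (\<And>i. i \<ge> m \<Longrightarrow> y i = 0) \<Longrightarrow>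
        y \<in> {y \<in> topspace (subtopology (Euclidean_space m) V). D j y \<in> ball (D j p) e}"
      by (rule openin_Euclidean_space_box) (rule that, assumption, blast)
    have box: "y \<in> V \<and> dist (D j y) (D j p) < e"
      if "\<And>i. i < m \<Longrightarrow> \<bar>y i - p i\<bar> < d'" "\<And>i. i \<ge> m \<Longrightarrow> y i = 0" for y
      using d'(2)[OF that] by (auto simp: dist_commute)
    show "eventually (\<lambda>t. dist (\<psi> j t) (D j p) < e) (at t0)"
      using near[OF d'(1)]
    proof (rule eventually_mono)
      fix t assume t: "\<forall>i<m. \<bar>c t i - p i\<bar> < d'"
      show "dist (\<psi> j t) (D j p) < e"
      proof (cases "c t j = p j")
        case True then show ?thesis using e by (simp add: \<psi>_def)
      next
        case False
        define F where "F x = f ((q j t)(j := x))" for x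
        have inbox: "(q j t)(j := x) \<in> V \<and> dist (D j ((q j t)(j := x))) (D j p) < e"
          if "\<bar>x - p j\<bar> < d'" for x
          by (rule box) (use t that j p0 d'(1) in \<open>auto simp: q_def\<close>)
        have DF: "(F has_real_derivative D j ((q j t)(j := x))) (at x)" if "\<bar>x - p j\<bar> < d'" for x
          using f[OF j, of "(q j t)(j := x)"] inbox[OF that] by (simp add: F_def[abs_def])
        have tj: "\<bar>c t j - p j\<bar> < d'" using t j by simp
        have q1: "q (Suc j) t = (q j t)(j := c t j)" by (auto simp: q_def)
        have q0: "q j t = (q j t)(j := p j)" by (auto simp: q_def)
        have Fdiff: "f (q (Suc j) t) - f (q j t) = F (c t j) - F (p j)"
          unfolding F_def q1 using q0 by simp
        let ?l = "min (p j) (c t j)" and ?r = "max (p j) (c t j)"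
        have "\<exists>x. ?l < x \<and> x < ?r \<and> F ?r - F ?l = (?r - ?l) * D j ((q j t)(j := x))"
          by (rule MVT2) (use False tj in \<open>auto intro!: DF\<close>)
        then obtain x where x': "?l < x" "x < ?r" "F ?r - F ?l = (?r - ?l) * D j ((q j t)(j := x))" by blast
        have x: "\<bar>x - p j\<bar> < d'" "F (c t j) - F (p j) = (c t j - p j) * D j ((q j t)(j := x))"
          using x' tj by (auto simp: min_def max_def algebra_simps split: if_splits)
        have "\<psi> j t = D j ((q j t)(j := x))" using False Fdiff x(2) by (simp add: \<psi>_def)
        then show ?thesis using inbox[OF x(1)] by simp
      qed
    qed
  qed
  have tele: "f (c t) - f p = (\<Sum>j<m. \<psi> j t * (c t j - p j))" if "c t \<in> V" for t
  proof -
    have "q m t = c t" using openin_Euclidean_space_zero[OF V that] p0 by (auto simp: q_def fun_eq_iff not_less)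
    moreover have "q 0 t = p" by (simp add: q_def)
    ultimately have "f (c t) - f p = (\<Sum>j<m. f (q (Suc j) t) - f (q j t))"
      using sum_lessThan_telescope[of "\<lambda>j. f (q j t)" m] by simp
    also have "\<dots> = (\<Sum>j<m. \<psi> j t * (c t j - p j))"
    proof (rule sum.cong[OF refl])
      fix j
      show "f (q (Suc j) t) - f (q j t) = \<psi> j t * (c t j - p j)"
      proof (cases "c t j = p j")
        case True
        then have "q (Suc j) t = q j t" by (auto simp: q_def less_Suc_eq)
        then show ?thesis using True by simp
      qed (simp add: \<psi>_def)
    qed
    finally show ?thesis .
  qed
  have "((\<lambda>t. \<Sum>j<m. \<psi> j t * ((c t j - c t0 j) / (t - t0))) \<longlongrightarrow> (\<Sum>j<m. D j p * c' j)) (at t0)"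
    using c unfolding has_field_derivative_iff by (intro tendsto_sum tendsto_mult lim) auto
  moreover have "eventually (\<lambda>t. (\<Sum>j<m. \<psi> j t * ((c t j - c t0 j) / (t - t0))) = (f (c t) - f (c t0)) / (t - t0)) (at t0)"
    using cV(2) by (rule eventually_mono) (use tele in \<open>simp add: p_def[symmetric] sum_divide_distrib\<close>)
  ultimately have "((\<lambda>t. (f (c t) - f (c t0)) / (t - t0)) \<longlongrightarrow> (\<Sum>j<m. D j p * c' j)) (at t0)"
    by (rule Lim_transform_eventually)
  then show ?thesis by (simp add: has_field_derivative_iff p_def)
qed

lemma continuous_map_into_Euclidean:
  assumes "\<And>j. j < m \<Longrightarrow> continuous_map X euclideanreal (\<lambda>x. g x j)" "\<And>x j. x \<in> topspace X \<Longrightarrow> j \<ge> m \<Longrightarrow> g x j = 0"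
  shows "continuous_map X (Euclidean_space m) g"
proof -
  have "continuous_map X euclideanreal (\<lambda>x. g x j)" for j
  proof (cases "j < m")
    case False
    have "continuous_map X euclideanreal (\<lambda>_. 0)" by simp
    then show ?thesis by (rule continuous_map_eq) (use assms(2) False in auto)
  qed (rule assms(1))
  then show ?thesis using assms(2)
    unfolding Euclidean_space_def continuous_map_in_subtopology
    by (auto simp: continuous_map_componentwise_UNIV)
qed

lemma Ck_on_compose:
  assumes U: "openin (Euclidean_space n) U" and V: "openin (Euclidean_space m) V"
    and g: "\<And>x. x \<in> U \<Longrightarrow> g x \<in> V" "\<And>j. j < m \<Longrightarrow> Ck_on k n U (\<lambda>x. g x j)"
    and f: "Ck_on k m V f"
  shows "Ck_on k n U (\<lambda>x. f (g x))"
  using g(2) f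
proof (induction k arbitrary: f)
  have cont: "continuous_map (subtopology (Euclidean_space n) U) euclideanreal (\<lambda>x. f (g x))"
    if "\<And>j. j < m \<Longrightarrow> Ck_on k n U (\<lambda>x. g x j)" "Ck_on k m V f" for f k
  proof -
    have "continuous_map (subtopology (Euclidean_space n) U) (Euclidean_space m) g"
      using Ck_on_continuous[OF that(1)] openin_Euclidean_space_zero[OF V g(1)]
      by (intro continuous_map_into_Euclidean) auto
    then have "continuous_map (subtopology (Euclidean_space n) U) (subtopology (Euclidean_space m) V) g"
      using g(1) by (auto simp: continuous_map_in_subtopology)
    from continuous_map_compose[OF this Ck_on_continuous[OF that(2)]] show ?thesis by (simp add: o_def)
  qed
  {
    case 0
    then show ?case using cont[of 0] by simp
  next
    case (Suc k)
    obtain D where D: "\<And>j y. j < m \<Longrightarrow> y \<in> V \<Longrightarrow> ((\<lambda>t. f (y(j := t))) has_real_derivative D j y) (at (y j))"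
      "\<And>j. j < m \<Longrightarrow> Ck_on k m V (D j)"
      using Suc.prems(2) by (rule Ck_on_SucE) blast
    have "\<forall>j. \<exists>D. j < m \<longrightarrow> (\<forall>i<n. (\<forall>x\<in>U. ((\<lambda>t. g (x(i := t)) j) has_real_derivative D i x) (at (x i))) \<and>
        Ck_on k n U (D i))"
      using Ck_on_SucE[OF Suc.prems(1)] by metis
    then obtain D' where D': "\<And>j i x. j < m \<Longrightarrow> i < n \<Longrightarrow> x \<in> U \<Longrightarrow>
        ((\<lambda>t. g (x(i := t)) j) has_real_derivative D' j i x) (at (x i))"
      "\<And>j i. j < m \<Longrightarrow> i < n \<Longrightarrow> Ck_on k n U (D' j i)" by metis
    show ?case
    proof (rule Ck_on_SucI[OF cont[OF Suc.prems], where D = "\<lambda>i x. \<Sum>j<m. D j (g x) * D' j i x"])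
      fix i x assume i: "i < n" and x: "x \<in> U"
      have "eventually (\<lambda>t. g (x(i := t)) \<in> V) (at (x i))"
        using eventually_line[OF U x i] unfolding eventually_at_filter
        by (rule eventually_mono) (use g(1) in blast)
      then have "((\<lambda>t. f (g (x(i := t)))) has_real_derivative (\<Sum>j<m. D j (g (x(i := x i))) * D' j i x)) (at (x i))"
        by (intro has_derivative_compose_partial[OF V D(1) Ck_on_continuous[OF D(2)] D'(1)[OF _ i x]])
          (use g(1)[OF x] in auto)
      then show "((\<lambda>t. f (g (x(i := t)))) has_real_derivative (\<Sum>j<m. D j (g x) * D' j i x)) (at (x i))"
        by simp
    next
      show "Ck_on k n U (\<lambda>x. \<Sum>j<m. D j (g x) * D' j i x)" if i: "i < n" for i
      proof (rule Ck_on_sum)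
        fix j assume "j \<in> {..<m}"
        then have j: "j < m" by simp
        show "Ck_on k n U (\<lambda>x. D j (g x) * D' j i x)"
          by (rule Ck_on_mult[OF Suc.IH[OF Ck_on_SucD[OF Suc.prems(1)] D(2)[OF j]] D'(2)[OF j i]])
      qed
    qed
  }
qed

section \<open>The circle\<close>

lemma smooth_on_cong:
  "openin (Euclidean_space n) U \<Longrightarrow> (\<And>x. x \<in> U \<Longrightarrow> f x = f' x) \<Longrightarrow> smooth_on n U f \<Longrightarrow> smooth_on n U f'"
  unfolding smooth_on_def using Ck_on_cong by blast

lemma smooth_on_subset: "smooth_on n U f \<Longrightarrow> V \<subseteq> U \<Longrightarrow> smooth_on n V f"
  unfolding smooth_on_def using Ck_on_subset by blast

lemma smooth_on_Union:
  "(\<And>V. V \<in> \<V> \<Longrightarrow> openin (Euclidean_space n) V) \<Longrightarrow> (\<And>V. V \<in> \<V> \<Longrightarrow> smooth_on n V f) \<Longrightarrow>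
    smooth_on n (\<Union>\<V>) f"
  unfolding smooth_on_def using Ck_on_Union by blast

lemma smooth_on_continuous: "smooth_on n U f \<Longrightarrow> continuous_map (subtopology (Euclidean_space n) U) euclideanreal f"
  unfolding smooth_on_def using Ck_on_continuous by blast

lemma smooth_on_const: "smooth_on n U (\<lambda>_. c)"
  by (simp add: smooth_on_def Ck_on_const)

lemma smooth_on_add: "smooth_on n U f \<Longrightarrow> smooth_on n U g \<Longrightarrow> smooth_on n U (\<lambda>x. f x + g x)"
  by (simp add: smooth_on_def Ck_on_add)

lemma smooth_on_mult: "smooth_on n U f \<Longrightarrow> smooth_on n U g \<Longrightarrow> smooth_on n U (\<lambda>x. f x * g x)"
  by (simp add: smooth_on_def Ck_on_mult)

lemma smooth_on_diff: "smooth_on n U f \<Longrightarrow> smooth_on n U g \<Longrightarrow> smooth_on n U (\<lambda>x. f x - g x)"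
  using smooth_on_add[OF _ smooth_on_mult[OF smooth_on_const[of n U "-1"]], of f g] by simp

lemma smooth_on_sum: "(\<And>j. j \<in> F \<Longrightarrow> smooth_on n U (f j)) \<Longrightarrow> smooth_on n U (\<lambda>x. \<Sum>j\<in>F. f j x)"
  by (simp add: smooth_on_def Ck_on_sum)

lemma smooth_on_compose_real:
  assumes "open S" "\<And>j t. t \<in> S \<Longrightarrow> (H j has_real_derivative H (Suc j) t) (at t)"
    and "smooth_on n U f" "\<And>x. x \<in> U \<Longrightarrow> f x \<in> S"
  shows "smooth_on n U (\<lambda>x. H (j :: nat) (f x))"
  unfolding smooth_on_def
proof
  fix k
  show "Ck_on k n U (\<lambda>x. H j (f x))"
    by (rule Ck_on_compose_real[where S = S and H = H]) (use assms in \<open>auto simp: smooth_on_def\<close>)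
qed

lemma smooth_on_compose:
  assumes "openin (Euclidean_space n) U" "openin (Euclidean_space m) V"
    and "\<And>x. x \<in> U \<Longrightarrow> g x \<in> V" "\<And>j. j < m \<Longrightarrow> smooth_on n U (\<lambda>x. g x j)" "smooth_on m V f"
  shows "smooth_on n U (\<lambda>x. f (g x))"
  unfolding smooth_on_def
proof
  fix k
  show "Ck_on k n U (\<lambda>x. f (g x))"
    by (rule Ck_on_compose[OF assms(1-3)]) (use assms(4,5) in \<open>auto simp: smooth_on_def\<close>)
qed

lemma smooth_on_inverse:
  assumes "smooth_on n U f" "\<And>x. x \<in> U \<Longrightarrow> f x \<noteq> 0"
  shows "smooth_on n U (\<lambda>x. inverse (f x))"
proof -
  \<comment> \<open>The \<open>j\<close>-th derivative of \<open>inverse\<close>.\<close>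
  define H where "H j t = (-1) ^ j * fact j * inverse t ^ Suc j" for j and t :: real
  have "(H j has_real_derivative H (Suc j) t) (at t)" if "t \<in> - {0}" for j t
  proof -
    have "((\<lambda>t. inverse t ^ Suc j) has_real_derivative - (1 + real j) * inverse t ^ Suc (Suc j)) (at t)"
      using DERIV_power[OF DERIV_inverse[of t UNIV], where n = "Suc j"] that by (simp add: algebra_simps)
    from DERIV_cmult[OF this, of "(-1) ^ j * fact j"] show ?thesis
      unfolding H_def by (simp add: algebra_simps)
  qed
  then have "smooth_on n U (\<lambda>x. H 0 (f x))"
    using assms by (intro smooth_on_compose_real[where S = "- {0}" and H = H]) auto
  then show ?thesis by (simp add: H_def)
qed

lemma smooth_on_divide:
  assumes "smooth_on n U f" "smooth_on n U g" "\<And>x. x \<in> U \<Longrightarrow> g x \<noteq> 0"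
  shows "smooth_on n U (\<lambda>x. f x / g x)"
  using smooth_on_mult[OF assms(1) smooth_on_inverse[OF assms(2,3)]] by (simp add: divide_inverse)

lemma smooth_on_cos: "smooth_on n U f \<Longrightarrow> smooth_on n U (\<lambda>x. cos (f x))"
proof -
  assume f: "smooth_on n U f"
  \<comment> \<open>Each differentiation of the cosine shifts its argument by a quarter turn, so all
    derivatives have one closed form.\<close>
  define H where "H j t = cos (t + real j * (pi / 2))" for j t
  have "(H j has_real_derivative H (Suc j) t) (at t)" for j t
  proof -
    have "H (Suc j) t = - sin (t + real j * (pi / 2))"
    proof -
      have "t + real (Suc j) * (pi / 2) = (t + real j * (pi / 2)) + pi / 2"
        by (simp only: of_nat_Suc distrib_right mult_1_left ac_simps)
      moreover have "cos (y + pi / 2) = - sin y" for y by (simp add: cos_add)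
      ultimately show ?thesis by (simp only: H_def)
    qed
    then show ?thesis unfolding H_def by (auto intro!: derivative_eq_intros)
  qed
  then have "smooth_on n U (\<lambda>x. H 0 (f x))" using f by (intro smooth_on_compose_real[where S = UNIV and H = H]) auto
  then show ?thesis by (simp add: H_def)
qed

lemma smooth_on_sin:
  assumes "smooth_on n U f"
  shows "smooth_on n U (\<lambda>x. sin (f x))"
proof -
  have "smooth_on n U (\<lambda>x. cos (pi / 2 - f x))"
    by (intro smooth_on_cos smooth_on_diff smooth_on_const assms)
  then show ?thesis by (simp add: cos_diff)
qed

text \<open>One differentiation suffices: the derivative \<open>1 / (1 + t\<^sup>2)\<close> is
  smooth as the inverse of a polynomial, so no formula for the higher derivatives is
  required.\<close>

lemma smooth_on_arctan:
  assumes f: "smooth_on n U f"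
  shows "smooth_on n U (\<lambda>x. arctan (f x))"
  unfolding smooth_on_def
proof
  fix k
  have cont: "continuous_map (subtopology (Euclidean_space n) U) euclideanreal (\<lambda>x. arctan (f x))"
    using continuous_map_compose[OF smooth_on_continuous[OF f], of euclideanreal arctan]
    by (simp add: o_def continuous_on_arctan[OF continuous_on_id])
  show "Ck_on k n U (\<lambda>x. arctan (f x))"
  proof (cases k)
    case 0 then show ?thesis using cont by simp
  next
    case (Suc k')
    have "Ck_on (Suc k') n U f" using f by (simp add: smooth_on_def)
    then obtain D where D: "\<And>i x. i < n \<Longrightarrow> x \<in> U \<Longrightarrow> ((\<lambda>t. f (x(i := t))) has_real_derivative D i x) (at (x i))"
      "\<And>i. i < n \<Longrightarrow> Ck_on k' n U (D i)"
      by (rule Ck_on_SucE) blast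
    have "((\<lambda>t. arctan (f (x(i := t)))) has_real_derivative inverse (1 + f x * f x) * D i x) (at (x i))"
      if "i < n" "x \<in> U" for i x
      using DERIV_chain2[OF DERIV_arctan D(1)[OF that]] by (simp add: power2_eq_square)
    moreover have "1 + f x * f x \<noteq> 0" for x by (smt (verit) zero_le_square)
    then have "smooth_on n U (\<lambda>x. inverse (1 + f x * f x))"
      by (intro smooth_on_inverse smooth_on_add smooth_on_const smooth_on_mult f)
    then have c: "Ck_on k' n U (\<lambda>x. inverse (1 + f x * f x))" by (simp add: smooth_on_def)
    ultimately show ?thesis unfolding Suc by (intro Ck_on_SucI[OF cont _ Ck_on_mult[OF c D(2)]])
  qed
qed

section \<open>A smooth step function\<close>

lemma poly_exp_tendsto_0: "((\<lambda>y. poly Q y * exp (- y)) \<longlongrightarrow> 0) (at_top :: real filter)"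
proof -
  have "((\<lambda>y. \<Sum>i\<le>degree Q. coeff Q i * (y ^ i / exp y)) \<longlongrightarrow> (\<Sum>i\<le>degree Q. coeff Q i * 0)) at_top"
    by (intro tendsto_sum tendsto_mult tendsto_const tendsto_power_div_exp_0)
  then show ?thesis
    by (simp add: poly_altdef sum_distrib_right exp_minus divide_inverse mult.assoc)
qed

text \<open>For \<open>t > 0\<close> the \<open>j\<close>-th derivative of
  \<open>exp (- inverse t)\<close> is this polynomial at \<open>inverse t\<close> times
  \<open>exp (- inverse t)\<close>. Differentiating \<open>P (1/t) * exp (-1/t)\<close> gives the
  recursion \<open>x\<^sup>2 * (P - P')\<close>.\<close>

fun flat_poly :: "nat \<Rightarrow> real poly" where
  "flat_poly 0 = 1"
| "flat_poly (Suc j) = monom 1 2 * (flat_poly j - pderiv (flat_poly j))"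

definition flat :: "nat \<Rightarrow> real \<Rightarrow> real" where
  "flat j t = (if t > 0 then poly (flat_poly j) (inverse t) * exp (- inverse t) else 0)"

text \<open>Only \<open>t = 0\<close> is delicate. There the right difference quotient is again a
  polynomial in \<open>inverse h\<close> times \<open>exp (- inverse h)\<close>, with
  \<open>pCons 0\<close> absorbing the division by \<open>h\<close>; the exponential wins.\<close>

lemma flat_deriv: "(flat j has_real_derivative flat (Suc j) t) (at t)"
proof (cases t "0 :: real" rule: linorder_cases)
  case less
  have "((\<lambda>_. 0) has_real_derivative 0) (at t)" by simp
  then have "(flat j has_real_derivative 0) (at t)"
    by (rule has_field_derivative_transform_within_open[of _ _ _ "{..<0}"]) (use less in \<open>auto simp: flat_def\<close>)
  then show ?thesis using less by (simp add: flat_def)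
next
  case greater
  let ?P = "flat_poly j"
  have "((\<lambda>t. poly ?P (inverse t) * exp (- inverse t)) has_real_derivative flat (Suc j) t) (at t)"
    using greater
    by (auto intro!: derivative_eq_intros DERIV_chain2[OF poly_DERIV]
        simp: flat_def poly_monom power2_eq_square algebra_simps)
  then show ?thesis
    by (rule has_field_derivative_transform_within_open[of _ _ _ "{0<..}"]) (use greater in \<open>auto simp: flat_def\<close>)
next
  case equal
  have "((\<lambda>h. flat j h / h) \<longlongrightarrow> 0) (at 0)"
  proof (rule filterlim_split_at)
    have "eventually (\<lambda>h. 0 = flat j h / h) (at_left 0)"
      unfolding eventually_at_filter by (auto simp: flat_def)
    then show "((\<lambda>h. flat j h / h) \<longlongrightarrow> 0) (at_left 0)" by (rule Lim_transform_eventually[OF tendsto_const])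
    have "((\<lambda>h. poly (pCons 0 (flat_poly j)) (inverse h) * exp (- inverse h)) \<longlongrightarrow> 0) (at_right (0 :: real))"
      by (rule filterlim_compose[OF poly_exp_tendsto_0 filterlim_inverse_at_top_right])
    moreover have "eventually (\<lambda>h. poly (pCons 0 (flat_poly j)) (inverse h) * exp (- inverse h) = flat j h / h) (at_right 0)"
      unfolding eventually_at_filter by (auto simp: flat_def divide_inverse)
    ultimately show "((\<lambda>h. flat j h / h) \<longlongrightarrow> 0) (at_right 0)" by (rule Lim_transform_eventually)
  qed
  then show ?thesis using equal by (simp add: has_field_derivative_iff flat_def)
qed

text \<open>The transition stays inside \<open>[1/3, 2/3]\<close>, away from the parameters that
  wrap around the circle: those in \<open>(-1/4, 1/4)\<close> lie before it and those in
  \<open>(3/4, 5/4)\<close> after it.\<close>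

definition step :: "real \<Rightarrow> real" where
  "step t = flat 0 (t - 1/3) / (flat 0 (t - 1/3) + flat 0 (2/3 - t))"

lemma step_low: "t \<le> 1/3 \<Longrightarrow> step t = 0"
  by (simp add: step_def flat_def)

lemma step_high: "t \<ge> 2/3 \<Longrightarrow> step t = 1"
  by (simp add: step_def flat_def)

lemma smooth_on_step:
  assumes f: "smooth_on n U f"
  shows "smooth_on n U (\<lambda>x. step (f x))"
proof -
  have flat: "smooth_on n U (\<lambda>x. flat 0 (g x))" if "smooth_on n U g" for g
    using that by (intro smooth_on_compose_real[where S = UNIV and H = flat] flat_deriv) auto
  have pos: "flat 0 (t - 1/3) + flat 0 (2/3 - t) \<noteq> 0" for t
  proof -
    have "flat 0 s \<ge> 0" "s > 0 \<Longrightarrow> flat 0 s > 0" for s by (auto simp: flat_def)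
    moreover have "t - 1/3 > 0 \<or> 2/3 - t > 0" by linarith
    ultimately show ?thesis by (smt (verit))
  qed
  show ?thesis unfolding step_def
    by (intro smooth_on_divide smooth_on_add flat smooth_on_diff smooth_on_const f pos)
qed

lemma openin_Euclidean_preimage:
  assumes "openin (Euclidean_space n) U" "smooth_on n U f" "open S"
  shows "openin (Euclidean_space n) {u \<in> U. f u \<in> S}"
proof -
  have "openin (subtopology (Euclidean_space n) U) {u \<in> topspace (subtopology (Euclidean_space n) U). f u \<in> S}"
    using openin_continuous_map_preimage[OF smooth_on_continuous[OF assms(2)]] assms(3) by simp
  moreover have "{u \<in> topspace (subtopology (Euclidean_space n) U). f u \<in> S} = {u \<in> U. f u \<in> S}"
    using openin_subset[OF assms(1)] by auto
  ultimately show ?thesis using openin_trans_full[OF _ assms(1)] by metis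
qed

section \<open>Plots of the circle and local angles\<close>

lemma topspace_circle: "x \<in> topspace (nsphere (Suc 0)) \<longleftrightarrow> x 0 ^ 2 + x (Suc 0) ^ 2 = 1 \<and> (\<forall>i\<ge>2. x i = 0)"
  by (auto simp: nsphere_def topspace_Euclidean_space numeral_2_eq_2)

lemma points_circle: "points circle = topspace (nsphere 1)"
  by (simp add: circle_def manifold_diffeology_def)

text \<open>Inverse stereographic projection recovers the coordinates from
  \<open>s = a / (1 - b)\<close>, namely \<open>a = 2 * s / (s\<^sup>2 + 1)\<close> and
  \<open>b = (s\<^sup>2 - 1) / (s\<^sup>2 + 1)\<close>.\<close>

lemma smooth_on_stereographic:
  assumes D: "openin (Euclidean_space n) D" and sm: "smooth_on n D (\<lambda>u. a u / (1 - b u))"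
    and ab: "\<And>u. u \<in> D \<Longrightarrow> a u ^ 2 + b u ^ 2 = 1" "\<And>u. u \<in> D \<Longrightarrow> b u \<noteq> 1"
  shows "smooth_on n D a \<and> smooth_on n D b"
proof -
  let ?s = "\<lambda>u. a u / (1 - b u)"
  have eq: "2 * ?s u / (?s u * ?s u + 1) = a u" "(?s u * ?s u - 1) / (?s u * ?s u + 1) = b u" if "u \<in> D" for u
  proof -
    have "a u * a u = (1 - b u) * (1 + b u)" using ab(1)[OF that] by (simp add: power2_eq_square algebra_simps)
    then have s: "?s u * ?s u = (1 + b u) / (1 - b u)" using ab(2)[OF that] by (simp add: divide_simps)
    then have s1: "?s u * ?s u + 1 = 2 / (1 - b u)" and s2: "?s u * ?s u - 1 = 2 * b u / (1 - b u)"
      using ab(2)[OF that] by (simp_all add: divide_simps)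
    show "2 * ?s u / (?s u * ?s u + 1) = a u" "(?s u * ?s u - 1) / (?s u * ?s u + 1) = b u"
      unfolding s1 s2 using ab(2)[OF that] by (simp_all add: divide_simps)
  qed
  have nz: "x * x + 1 \<noteq> 0" for x :: real by (smt (verit) zero_le_square)
  have A: "smooth_on n D (\<lambda>u. 2 * ?s u / (?s u * ?s u + 1))"
    by (rule smooth_on_divide) (intro smooth_on_add smooth_on_mult smooth_on_const sm nz)+
  have B: "smooth_on n D (\<lambda>u. (?s u * ?s u - 1) / (?s u * ?s u + 1))"
    by (rule smooth_on_divide) (intro smooth_on_diff smooth_on_add smooth_on_mult smooth_on_const sm nz)+
  show ?thesis
    by (intro conjI smooth_on_cong[OF D _ A] smooth_on_cong[OF D _ B]) (rule eq, assumption)+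
qed

text \<open>The manifold diffeology of the circle coincides with the one induced from the plane, so
  the later arguments work with two coordinate functions instead of charts.\<close>

lemma circle_plots:
  "p \<in> plots circle n U \<longleftrightarrow> openin (Euclidean_space n) U \<and> (\<forall>u\<in>U. p u \<in> topspace (nsphere 1)) \<and>
     smooth_on n U (\<lambda>u. p u 0) \<and> smooth_on n U (\<lambda>u. p u 1)"
  (is "?L \<longleftrightarrow> ?R")
proof -
  let ?D1 = "{u \<in> U. p u 1 \<noteq> 1}" and ?D2 = "{u \<in> U. p u 1 \<noteq> -1}"
  have plots: "?L \<longleftrightarrow> openin (Euclidean_space n) U \<and>
      continuous_map (subtopology (Euclidean_space n) U) (nsphere 1) p \<and>
      openin (Euclidean_space n) {u \<in> U. p u \<in> topspace (nsphere 1) \<and> p u 1 \<noteq> 1} \<and>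
      smooth_on n {u \<in> U. p u \<in> topspace (nsphere 1) \<and> p u 1 \<noteq> 1} (\<lambda>u. p u 0 / (1 - p u 1)) \<and>
      openin (Euclidean_space n) {u \<in> U. p u \<in> topspace (nsphere 1) \<and> p u 1 \<noteq> -1} \<and>
      smooth_on n {u \<in> U. p u \<in> topspace (nsphere 1) \<and> p u 1 \<noteq> -1} (\<lambda>u. p u 0 / (1 + p u 1))"
    using openin_topspace[of "Euclidean_space 1"]
    by (auto simp: circle_def manifold_diffeology_def circle_atlas_def smooth_open_map_def topspace_Euclidean_space)
  show ?thesis
  proof
    assume L: ?L
    then have U: "openin (Euclidean_space n) U" and c: "continuous_map (subtopology (Euclidean_space n) U) (nsphere 1) p"
      using plots by auto
    have pS: "p u \<in> topspace (nsphere 1)" if "u \<in> U" for u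
      using continuous_map_funspace[OF c] openin_subset[OF U] that by auto
    then have D: "{u \<in> U. p u \<in> topspace (nsphere 1) \<and> p u 1 \<noteq> c} = {u \<in> U. p u 1 \<noteq> c}" for c by auto
    have D1: "openin (Euclidean_space n) ?D1" "smooth_on n ?D1 (\<lambda>u. p u 0 / (1 - p u 1))"
      and D2: "openin (Euclidean_space n) ?D2" "smooth_on n ?D2 (\<lambda>u. p u 0 / (1 + p u 1))"
      using L plots D by simp_all
    have Un: "\<Union>{?D1, ?D2} = U" by auto
    have D1s: "smooth_on n ?D1 (\<lambda>u. p u 0) \<and> smooth_on n ?D1 (\<lambda>u. p u 1)"
      using pS topspace_circle by (intro smooth_on_stereographic[OF D1]) auto
    \<comment> \<open>The second chart is the first one for the reflected map, with
      \<open>- p u 1\<close> in place of \<open>p u 1\<close>.\<close>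
    have "smooth_on n ?D2 (\<lambda>u. p u 0) \<and> smooth_on n ?D2 (\<lambda>u. - p u 1)"
      using pS topspace_circle D2(2) by (intro smooth_on_stereographic[OF D2(1)]) (auto simp: minus_equation_iff)
    then have D2s: "smooth_on n ?D2 (\<lambda>u. p u 0) \<and> smooth_on n ?D2 (\<lambda>u. p u 1)"
      using smooth_on_diff[OF smooth_on_const[of n ?D2 0], of "\<lambda>u. - p u 1"] by simp
    have "smooth_on n (\<Union>{?D1, ?D2}) (\<lambda>u. p u i)" if "i = 0 \<or> i = 1" for i
      using D1s D2s D1(1) D2(1) that by (intro smooth_on_Union) auto
    then show ?R unfolding Un using U pS by auto
  next
    assume R: ?R
    then have U: "openin (Euclidean_space n) U" and pS: "\<And>u. u \<in> U \<Longrightarrow> p u \<in> topspace (nsphere 1)"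
      and p0: "smooth_on n U (\<lambda>u. p u 0)" and p1: "smooth_on n U (\<lambda>u. p u 1)" by auto
    have D: "{u \<in> U. p u \<in> topspace (nsphere 1) \<and> p u 1 \<noteq> c} = {u \<in> U. p u 1 \<in> - {c}}" for c using pS by auto
    have o: "openin (Euclidean_space n) {u \<in> U. p u 1 \<in> - {c}}" for c
      by (rule openin_Euclidean_preimage[OF U p1]) auto
    have "continuous_map (subtopology (Euclidean_space n) U) (Euclidean_space 2) p"
    proof (rule continuous_map_into_Euclidean)
      show "continuous_map (subtopology (Euclidean_space n) U) euclideanreal (\<lambda>u. p u j)" if "j < 2" for j
        using smooth_on_continuous[OF p0] smooth_on_continuous[OF p1] that by (auto simp: less_2_cases_iff)
      show "p u j = 0" if "u \<in> topspace (subtopology (Euclidean_space n) U)" "2 \<le> j" for u j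
        using that pS topspace_circle by auto
    qed
    then have "continuous_map (subtopology (Euclidean_space n) U) (nsphere 1) p"
      using pS by (auto simp: nsphere_def continuous_map_in_subtopology numeral_2_eq_2)
    moreover have "smooth_on n {u \<in> U. p u 1 \<in> - {1}} (\<lambda>u. p u 0 / (1 - p u 1))"
      by (intro smooth_on_divide smooth_on_diff smooth_on_const smooth_on_subset[OF p0] smooth_on_subset[OF p1]) auto
    moreover have "smooth_on n {u \<in> U. p u 1 \<in> - {-1}} (\<lambda>u. p u 0 / (1 + p u 1))"
      by (intro smooth_on_divide smooth_on_add smooth_on_const smooth_on_subset[OF p0] smooth_on_subset[OF p1]) auto
    ultimately show ?L unfolding plots D using U o by blast
  qed
qed

lemma diffeological_space_circle: "diffeological_space circle"
  unfolding diffeological_space_def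
proof (intro conjI allI ballI impI)
  fix n U p assume p: "p \<in> plots circle n U"
  then show "openin (Euclidean_space n) U" by (simp add: circle_plots)
  show "p \<in> U \<rightarrow> points circle" using p by (auto simp: circle_plots points_circle)
next
  fix n U p q assume p: "p \<in> plots circle n U" and eq: "\<forall>u\<in>U. p u = q u"
  have U: "openin (Euclidean_space n) U" using p by (simp add: circle_plots)
  have "smooth_on n U (\<lambda>u. q u 0)" "smooth_on n U (\<lambda>u. q u 1)"
    using p eq smooth_on_cong[OF U, of "\<lambda>u. p u 0" "\<lambda>u. q u 0"] smooth_on_cong[OF U, of "\<lambda>u. p u 1" "\<lambda>u. q u 1"]
    by (auto simp: circle_plots)
  then show "q \<in> plots circle n U" using p eq by (simp add: circle_plots)
next
  fix n U and x :: "nat \<Rightarrow> real" assume "openin (Euclidean_space n) U" "x \<in> points circle"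
  then show "(\<lambda>_. x) \<in> plots circle n U" by (simp add: circle_plots points_circle smooth_on_const)
next
  fix n U p m V g assume p: "p \<in> plots circle n U" and g: "smooth_open_map m V n U g"
  then have V: "openin (Euclidean_space m) V" "openin (Euclidean_space n) U" "\<And>x. x \<in> V \<Longrightarrow> g x \<in> U"
    "\<And>j. j < n \<Longrightarrow> smooth_on m V (\<lambda>x. g x j)" by (auto simp: smooth_open_map_def)
  show "p \<circ> g \<in> plots circle m V"
    using p V smooth_on_compose[OF V, of "\<lambda>u. p u 0"] smooth_on_compose[OF V, of "\<lambda>u. p u 1"]
    by (auto simp: circle_plots)
next
  fix n U p and \<V> :: "(nat \<Rightarrow> real) set set"
  assume \<V>: "\<forall>V\<in>\<V>. openin (Euclidean_space n) V \<and> p \<in> plots circle n V" and U: "\<Union>\<V> = U"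
  show "p \<in> plots circle n U"
    unfolding circle_plots U[symmetric] using \<V> smooth_on_Union[of \<V> n]
    by (auto simp: circle_plots)
qed

definition circle_point :: "real \<Rightarrow> nat \<Rightarrow> real" where
  "circle_point t = (\<lambda>i. if i = 0 then cos (2 * pi * t) else if i = 1 then sin (2 * pi * t) else 0)"

lemma circle_point: "circle_point t \<in> points circle"
  by (simp add: points_circle topspace_circle circle_point_def)

lemma circle_point_eqD:
  assumes "circle_point s = circle_point t"
  obtains k :: int where "s = t + of_int k"
proof -
  have "cos (2 * pi * s) = cos (2 * pi * t)" "sin (2 * pi * s) = sin (2 * pi * t)"
    using fun_cong[OF assms, of 0] fun_cong[OF assms, of 1] by (simp_all add: circle_point_def)
  then obtain k :: int where "2 * pi * s = 2 * pi * t + 2 * pi * of_int k"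
    using sin_cos_eq_iff[of "2 * pi * s" "2 * pi * t"] by auto
  then have "2 * pi * s = 2 * pi * (t + of_int k)" by (simp add: algebra_simps)
  then have "s = t + of_int k" by simp
  then show ?thesis by (rule that)
qed

lemma circle_point_add_1: "circle_point (t + 1) = circle_point t"
proof -
  have "2 * pi * (t + 1) = 2 * pi * t + 2 * pi" by (simp add: algebra_simps)
  then show ?thesis unfolding circle_point_def by (simp only: sin_periodic cos_periodic)
qed

lemma circle_point_plot:
  assumes "openin (Euclidean_space n) U" "smooth_on n U f"
  shows "(\<lambda>u. circle_point (f u)) \<in> plots circle n U"
  using assms circle_point
  by (auto simp: circle_plots points_circle circle_point_def intro!: smooth_on_cos smooth_on_sin smooth_on_mult smooth_on_const)

lemma cos_sin_arctan:
  assumes "c > 0" "c ^ 2 + s ^ 2 = (1 :: real)"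
  shows "cos (arctan (s / c)) = c" "sin (arctan (s / c)) = s"
proof -
  have "1 + (s / c) ^ 2 = (1 / c) ^ 2" using assms by (simp add: field_simps power_divide)
  then have "sqrt (1 + (s / c) ^ 2) = 1 / c" using assms(1) by simp
  then show "cos (arctan (s / c)) = c" "sin (arctan (s / c)) = s"
    using assms(1) by (simp_all add: cos_arctan sin_arctan)
qed

text \<open>A rotation by \<open>- \<theta>\<close> moves \<open>p u\<close> to
  \<open>(1, 0)\<close>; near that point the angle is the arctangent of \<open>s / c\<close>, where
  \<open>c\<close> and \<open>s\<close> are the rotated coordinates. In units of a full turn,
  \<open>\<theta>\<close> lies in \<open>[0, 1)\<close> and the arctangent in
  \<open>(-1/4, 1/4)\<close>, whence the window from \<open>-1/4\<close> to
  \<open>5/4\<close>.\<close>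

lemma circle_plot_local_angle:
  assumes p: "p \<in> plots circle n U" and u: "u \<in> U"
  obtains V \<alpha> where "openin (Euclidean_space n) V" "u \<in> V" "V \<subseteq> U" "smooth_on n V \<alpha>"
    "\<And>x. x \<in> V \<Longrightarrow> p x = circle_point (\<alpha> x)" "\<And>x. x \<in> V \<Longrightarrow> -1/4 < \<alpha> x \<and> \<alpha> x < 5/4"
proof -
  have U: "openin (Euclidean_space n) U" and pS: "\<And>x. x \<in> U \<Longrightarrow> p x \<in> topspace (nsphere 1)"
    and sm: "smooth_on n U (\<lambda>x. p x 0)" "smooth_on n U (\<lambda>x. p x 1)" using p by (auto simp: circle_plots)
  have p1: "p x 0 ^ 2 + p x 1 ^ 2 = 1" if "x \<in> U" for x using pS[OF that] by (simp add: topspace_circle)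
  obtain \<theta> where \<theta>: "0 \<le> \<theta>" "\<theta> < 2 * pi" "p u 0 = cos \<theta>" "p u 1 = sin \<theta>"
    using sincos_total_2pi[OF p1[OF u]] by metis
  define c where "c x = p x 0 * cos \<theta> + p x 1 * sin \<theta>" for x
  define s where "s x = p x 1 * cos \<theta> - p x 0 * sin \<theta>" for x
  have sc: "sin \<theta> * sin \<theta> = 1 - cos \<theta> * cos \<theta>"
    using sin_cos_squared_add[of \<theta>] by (simp add: power2_eq_square)
  have rot: "cos \<theta> * c x - sin \<theta> * s x = p x 0" "sin \<theta> * c x + cos \<theta> * s x = p x 1" for x
    unfolding c_def s_def using sc by algebra+
  have cs: "c x ^ 2 + s x ^ 2 = 1" if "x \<in> U" for x
    unfolding c_def s_def using p1[OF that] sc by algebra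
  have cu: "c u = 1" unfolding c_def \<theta>(3,4) using sc by simp
  have smc: "smooth_on n U c" and sms: "smooth_on n U s"
    unfolding c_def s_def by (intro smooth_on_add smooth_on_diff smooth_on_mult smooth_on_const sm)+
  let ?V = "{x \<in> U. c x \<in> {0<..}}" and ?\<alpha> = "\<lambda>x. (\<theta> + arctan (s x / c x)) * (1 / (2 * pi))"
  have sub: "?V \<subseteq> U" by auto
  show ?thesis
  proof (rule that[of ?V ?\<alpha>])
    show "openin (Euclidean_space n) ?V" by (rule openin_Euclidean_preimage[OF U smc]) simp
    show "u \<in> ?V" using u cu by simp
    show "smooth_on n ?V ?\<alpha>"
      by (intro smooth_on_add smooth_on_mult smooth_on_const smooth_on_arctan smooth_on_divide
          smooth_on_subset[OF smc sub] smooth_on_subset[OF sms sub]) auto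
    fix x assume "x \<in> ?V"
    then have x: "x \<in> U" "c x > 0" by auto
    have "2 * pi * ?\<alpha> x = \<theta> + arctan (s x / c x)" by simp
    then have "cos (2 * pi * ?\<alpha> x) = p x 0" "sin (2 * pi * ?\<alpha> x) = p x 1"
      using cos_sin_arctan[OF x(2) cs[OF x(1)]] rot[of x] by (simp_all only: cos_add sin_add)
    then show "p x = circle_point (?\<alpha> x)"
      using pS[OF x(1)] by (auto simp: fun_eq_iff circle_point_def topspace_circle)
    show "-1/4 < ?\<alpha> x \<and> ?\<alpha> x < 5/4"
      using arctan_bounded[of "s x / c x"] \<theta>(1,2) by (simp add: field_simps)
  qed (rule sub)
qed

section \<open>Lifting against trivial fibrations\<close>

lemma plots_cong:
  "diffeological_space X \<Longrightarrow> p \<in> plots X n U \<Longrightarrow> (\<And>u. u \<in> U \<Longrightarrow> p u = q u) \<Longrightarrow> q \<in> plots X n U"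
  by (drule diffeological_space_def[THEN iffD1, THEN conjunct2, THEN conjunct1]) blast

lemma plots_const:
  "diffeological_space X \<Longrightarrow> openin (Euclidean_space n) U \<Longrightarrow> x \<in> points X \<Longrightarrow> (\<lambda>_. x) \<in> plots X n U"
  by (drule diffeological_space_def[THEN iffD1, THEN conjunct2, THEN conjunct2, THEN conjunct1]) blast

lemma plots_local:
  assumes X: "diffeological_space X"
    and loc: "\<And>u. u \<in> U \<Longrightarrow> \<exists>V. openin (Euclidean_space n) V \<and> u \<in> V \<and> V \<subseteq> U \<and> p \<in> plots X n V"
  shows "p \<in> plots X n U"
proof -
  define \<V> where "\<V> = {V. openin (Euclidean_space n) V \<and> V \<subseteq> U \<and> p \<in> plots X n V}"
  have "\<Union>\<V> = U"
  proof (intro subset_antisym subsetI)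
    fix u assume "u \<in> U"
    from loc[OF this] show "u \<in> \<Union>\<V>" unfolding \<V>_def by blast
  qed (auto simp: \<V>_def)
  moreover have "\<forall>V\<in>\<V>. openin (Euclidean_space n) V \<and> p \<in> plots X n V" by (simp add: \<V>_def)
  moreover note X[unfolded diffeological_space_def, THEN conjunct2, THEN conjunct2, THEN conjunct2, THEN conjunct2,
    THEN spec[of _ n], THEN spec[of _ U], THEN spec[of _ p], THEN spec[of _ \<V>]]
  ultimately show ?thesis by simp
qed

section \<open>Smooth simplices in affine coordinates\<close>

lemma points_affine_simplex: "x \<in> points (affine_simplex n) \<longleftrightarrow> (\<forall>i>n. x i = 0) \<and> (\<Sum>i\<le>n. x i) = 1"
  by (auto simp: affine_simplex_def sub_diffeology_def euclidean_diffeology_def topspace_Euclidean_space Suc_le_eq)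

lemma plots_affine_simplex:
  "q \<in> plots (affine_simplex n) m U \<longleftrightarrow> openin (Euclidean_space m) U \<and>
     (\<forall>u\<in>U. q u \<in> points (affine_simplex n)) \<and> (\<forall>j\<le>n. smooth_on m U (\<lambda>u. q u j))"
  using openin_topspace[of "Euclidean_space (Suc n)"]
  by (auto simp: affine_simplex_def sub_diffeology_def euclidean_diffeology_def smooth_open_map_def less_Suc_eq_le
      Pi_iff)

text \<open>Simplices of \<open>SD X\<close> are extensional, so formulas enter through
  \<open>restrict\<close>. Composites with plots do not notice this, as plots take values in the
  affine simplex.\<close>

lemma restrict_in_SD:
  assumes X: "diffeological_space X"
    and pt: "\<And>x. x \<in> points (affine_simplex n) \<Longrightarrow> \<sigma> x \<in> points X"
    and pl: "\<And>m U q. q \<in> plots (affine_simplex n) m U \<Longrightarrow> (\<lambda>u. \<sigma> (q u)) \<in> plots X m U"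
  shows "restrict \<sigma> (points (affine_simplex n)) \<in> simps (SD X) n"
proof -
  have "restrict \<sigma> (points (affine_simplex n)) \<circ> q \<in> plots X m U" if "q \<in> plots (affine_simplex n) m U" for m U q
    by (rule plots_cong[OF X pl[OF that]]) (use that in \<open>auto simp: plots_affine_simplex\<close>)
  then show ?thesis using pt by (auto simp: SD_def smooth_map_def)
qed

lemma SD_plots:
  assumes "\<sigma> \<in> simps (SD X) n" "q \<in> plots (affine_simplex n) m U"
  shows "(\<lambda>u. \<sigma> (q u)) \<in> plots X m U"
  using assms by (auto simp: SD_def smooth_map_def o_def)

lemma SD_points:
  assumes "\<sigma> \<in> simps (SD X) n" "x \<in> points (affine_simplex n)"
  shows "\<sigma> x \<in> points X"
  using assms by (auto simp: SD_def smooth_map_def)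

lemma simplex_push_affine:
  assumes "\<theta> \<in> simplex_ops m n" "x \<in> points (affine_simplex m)"
  shows "simplex_push m \<theta> x \<in> points (affine_simplex n)"
  using assms sum_simplex_push[OF assms(1), of x] simplex_push_zero[OF assms(1)]
  by (simp add: points_affine_simplex)

lemma simplex_push_plot:
  assumes \<theta>: "\<theta> \<in> simplex_ops m n" and q: "q \<in> plots (affine_simplex m) l U"
  shows "(\<lambda>u. simplex_push m \<theta> (q u)) \<in> plots (affine_simplex n) l U"
  using q simplex_push_affine[OF \<theta>] unfolding plots_affine_simplex
  by (auto simp: simplex_push_def intro!: smooth_on_sum)

lemma act_SD: "act (SD X) m n \<theta> \<sigma> = restrict (\<sigma> \<circ> simplex_push m \<theta>) (points (affine_simplex m))"
  by (simp add: SD_def)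

lemma act_SD_eq:
  "x \<in> points (affine_simplex m) \<Longrightarrow> act (SD X) m n \<theta> \<sigma> x = \<sigma> (simplex_push m \<theta> x)"
  by (simp add: act_SD)

lemma SD_ext: "\<sigma> \<in> simps (SD X) n \<Longrightarrow> \<sigma> \<in> extensional (points (affine_simplex n))"
  by (simp add: SD_def)

lemma SD_eqI:
  assumes "\<sigma> \<in> simps (SD X) n" "\<tau> \<in> simps (SD X) n" "\<And>x. x \<in> points (affine_simplex n) \<Longrightarrow> \<sigma> x = \<tau> x"
  shows "\<sigma> = \<tau>"
  using assms by (intro extensionalityI[OF SD_ext SD_ext])

lemma simplicial_set_SD:
  assumes X: "diffeological_space X"
  shows "simplicial_set (SD X)"
proof
  show closed: "act (SD X) m n \<theta> \<sigma> \<in> simps (SD X) m"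
    if \<theta>: "\<theta> \<in> simplex_ops m n" and \<sigma>: "\<sigma> \<in> simps (SD X) n" for m n \<theta> \<sigma>
    unfolding act_SD
    by (rule restrict_in_SD[OF X])
      (use SD_points[OF \<sigma> simplex_push_affine[OF \<theta>]] SD_plots[OF \<sigma> simplex_push_plot[OF \<theta>]] in auto)
  show "act (SD X) n n (restrict id {..n}) \<sigma> = \<sigma>" if \<sigma>: "\<sigma> \<in> simps (SD X) n" for n \<sigma>
  proof (rule SD_eqI[OF closed[OF _ \<sigma>] \<sigma>])
    show "restrict id {..n} \<in> simplex_ops n n" by (rule simplex_opsI) auto
    fix x assume x: "x \<in> points (affine_simplex n)"
    then show "act (SD X) n n (restrict id {..n}) \<sigma> x = \<sigma> x"
      using simplex_push_id[of n x] by (simp add: act_SD_eq points_affine_simplex)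
  qed
  show "act (SD X) l m \<eta> (act (SD X) m n \<theta> \<sigma>) = act (SD X) l n (compose {..l} \<theta> \<eta>) \<sigma>"
    if \<theta>: "\<theta> \<in> simplex_ops m n" and \<eta>: "\<eta> \<in> simplex_ops l m" and \<sigma>: "\<sigma> \<in> simps (SD X) n" for l m n \<theta> \<eta> \<sigma>
  proof (rule SD_eqI[OF closed[OF \<eta> closed[OF \<theta> \<sigma>]] closed[OF simplex_ops_compose[OF \<theta> \<eta>] \<sigma>]])
    fix x assume x: "x \<in> points (affine_simplex l)"
    show "act (SD X) l m \<eta> (act (SD X) m n \<theta> \<sigma>) x = act (SD X) l n (compose {..l} \<theta> \<eta>) \<sigma> x"
      by (simp add: act_SD_eq[OF x] act_SD_eq[OF simplex_push_affine[OF \<eta> x]] simplex_push_compose[OF \<eta>])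
  qed
qed

lemma basepoint_affine: "x \<in> points (affine_simplex 0) \<longleftrightarrow> x = basepoint"
  by (auto simp: points_affine_simplex basepoint_def fun_eq_iff)

lemma segment_affine: "segment t \<in> points (affine_simplex 1)"
  by (simp add: points_affine_simplex segment_def)

lemma affine_segment:
  assumes "x \<in> points (affine_simplex 1)"
  shows "x = segment (x 1)"
  using assms by (auto simp: points_affine_simplex segment_def fun_eq_iff)

lemma segment_plot:
  "openin (Euclidean_space m) U \<Longrightarrow> smooth_on m U f \<Longrightarrow> (\<lambda>u. segment (f u)) \<in> plots (affine_simplex 1) m U"
  using segment_affine
  by (auto simp: plots_affine_simplex segment_def le_Suc_eq intro!: smooth_on_diff smooth_on_const)

lemma vert_SD:
  "vert (SD X) 1 0 \<sigma> = restrict (\<lambda>_. \<sigma> (segment 0)) (points (affine_simplex 0))"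
  "vert (SD X) 1 1 \<sigma> = restrict (\<lambda>_. \<sigma> (segment 1)) (points (affine_simplex 0))"
  unfolding act_SD
  by (rule restrict_ext, simp add: basepoint_affine push_basepoint del: One_nat_def)+

lemma vert_SD_eqD:
  assumes "vert (SD X) 1 0 \<sigma> = vert (SD X) 1 1 \<sigma>"
  shows "\<sigma> (segment 0) = \<sigma> (segment 1)"
  using fun_cong[OF assms, of basepoint] unfolding vert_SD by (simp add: basepoint_affine)

lemma push_edge:
  "simplex_push 1 (edge_op 0 2) x = (\<lambda>i. if i = 0 then x 0 else if i = 2 then x 1 else 0)"
  "simplex_push 1 (edge_op 1 2) x = (\<lambda>i. if i = 1 then x 0 else if i = 2 then x 1 else 0)"
proof -
  have "{i. i \<le> 1 \<and> edge_op a 2 i = j} = (if j = a then {0} else if j = 2 then {1} else {})" if "a < 2" for a j :: nat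
    using that by (auto simp: edge_op_def le_Suc_eq)
  then show "simplex_push 1 (edge_op 0 2) x = (\<lambda>i. if i = 0 then x 0 else if i = 2 then x 1 else 0)"
    "simplex_push 1 (edge_op 1 2) x = (\<lambda>i. if i = 1 then x 0 else if i = 2 then x 1 else 0)"
    by (auto simp: simplex_push_def fun_eq_iff)
qed

lemma segment_0: "segment t 0 = 1 - t" and segment_1: "segment t 1 = t"
  by (simp_all add: segment_def)

lemma face02: "act (SD X) 1 2 (edge_op 0 2) \<sigma> (segment t) = \<sigma> (\<lambda>i. if i = 0 then 1 - t else if i = 2 then t else 0)"
  and face12: "act (SD X) 1 2 (edge_op 1 2) \<sigma> (segment t) = \<sigma> (\<lambda>i. if i = 1 then 1 - t else if i = 2 then t else 0)"
  unfolding act_SD_eq[OF segment_affine] push_edge segment_0 segment_1 by (rule refl)+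

lemma smooth_map_circle_point_plot:
  assumes v: "smooth_map circle B v" and "openin (Euclidean_space m) U" "smooth_on m U f"
  shows "(\<lambda>u. v (circle_point (f u))) \<in> plots B m U"
  using v circle_point_plot[OF assms(2,3)] by (auto simp: smooth_map_def o_def)

lemma smooth_map_circle_point: "smooth_map circle B v \<Longrightarrow> v (circle_point t) \<in> points B"
  using circle_point by (auto simp: smooth_map_def)

text \<open>The coordinates in \<open>\<bbbA>\<^sup>2\<close> along which the path switches from the edge \<open>02\<close> to the edge \<open>12\<close>.\<close>

definition switch :: "real \<Rightarrow> nat \<Rightarrow> real" where
  "switch t = (\<lambda>i. if i = 0 then (1 - t) * (1 - step t) else if i = 1 then (1 - t) * step t else if i = 2 then t else 0)"

lemma sum_atMost_2: "(\<Sum>i\<le>2. f i) = f 0 + f 1 + f (2 :: nat)" for f :: "nat \<Rightarrow> real"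
  by (simp add: numeral_2_eq_2)

lemma switch_affine: "switch t \<in> points (affine_simplex 2)"
  unfolding points_affine_simplex sum_atMost_2 by (simp add: switch_def algebra_simps)

lemma switch_plot:
  assumes "openin (Euclidean_space m) U" "smooth_on m U f"
  shows "(\<lambda>u. switch (f u)) \<in> plots (affine_simplex 2) m U"
  unfolding plots_affine_simplex
proof (intro conjI allI ballI impI assms(1) switch_affine)
  fix j :: nat assume "j \<le> 2"
  then consider "j = 0" | "j = 1" | "j = 2" by linarith
  then show "smooth_on m U (\<lambda>u. switch (f u) j)"
    by cases (simp_all add: switch_def smooth_on_mult smooth_on_diff smooth_on_const smooth_on_step assms(2))
qed

section \<open>The smooth lift of a map out of the circle\<close>

lemma trivial_fibration_lifts_circle:
  assumes E: "diffeological_space E" and B: "diffeological_space B"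
    and we: "weak_equivalence E B p" and fib: "fibration E B p" and v: "smooth_map circle B v"
  obtains h where "smooth_map circle E h" "\<And>x. x \<in> points circle \<Longrightarrow> p (h x) = v x"
proof -
  interpret kan_fibration "SD E" "SD B" "SD_map p"
    using fib simplicial_set_SD[OF E] simplicial_set_SD[OF B]
    by (simp add: kan_fibration_def kan_fibration_axioms_def fibration_def)
  obtain g where g: "continuous_map (realization (SD B)) (realization (SD E)) g"
    "homotopic_with (\<lambda>_. True) (realization (SD B)) (realization (SD B))
       (realization_map (SD B) (SD_map p) \<circ> g) id"
    using we by (auto simp: weak_equivalence_def sset_weak_equivalence_def homotopy_equivalence_def)
  have coord: "smooth_on m U (\<lambda>u. q u j)" if "q \<in> plots (affine_simplex n) m U" "j \<le> n" for q n m U j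
    using that by (auto simp: plots_affine_simplex)
  have opn: "openin (Euclidean_space m) U" if "q \<in> plots (affine_simplex n) m U" for q n m U
    using that by (auto simp: plots_affine_simplex)
  define e where "e = restrict (\<lambda>x. v (circle_point (x 1))) (points (affine_simplex 1))"
  \<comment> \<open>The triangle depends on the coordinate \<open>x 2\<close> alone, so both of its
    edges that end at the vertex 2 are \<open>e\<close>.\<close>
  define y where "y = restrict (\<lambda>x. v (circle_point (x 2))) (points (affine_simplex 2))"
  have e: "e \<in> simps (SD B) 1" unfolding e_def
    by (rule restrict_in_SD[OF B smooth_map_circle_point[OF v] smooth_map_circle_point_plot[OF v]])
      (use coord opn in auto)
  have y: "y \<in> simps (SD B) 2" unfolding y_def
    by (rule restrict_in_SD[OF B smooth_map_circle_point[OF v] smooth_map_circle_point_plot[OF v]])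
      (use coord opn in auto)
  have e_segment: "e (segment t) = v (circle_point t)" for t
    using segment_affine[of t] by (simp add: e_def segment_def)
  have "vert (SD B) 1 0 e = vert (SD B) 1 1 e"
    unfolding vert_SD e_segment using circle_point_add_1[of 0] by simp
  then obtain \<epsilon> where \<epsilon>: "\<epsilon> \<in> simps (SD E) 1" "SD_map p 1 \<epsilon> = e"
    "vert (SD E) 1 0 \<epsilon> = vert (SD E) 1 1 \<epsilon>"
    using loop_lifts[OF e _ g] by blast
  have closed: "\<epsilon> (segment 0) = \<epsilon> (segment 1)" by (rule vert_SD_eqD[OF \<epsilon>(3)])
  have p\<epsilon>: "p (\<epsilon> (segment t)) = v (circle_point t)" for t
    using fun_cong[OF \<epsilon>(2), of "segment t"] segment_affine[of t] e_segment[of t] by (simp add: SD_map_def)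
  \<comment> \<open>The shift makes sense because \<open>\<epsilon>\<close> lives on the whole
    affine line. It still lifts \<open>e\<close>, since \<open>circle_point\<close> has period
    1.\<close>
  define \<epsilon>' where "\<epsilon>' = restrict (\<lambda>x. \<epsilon> (segment (x 1 - 1))) (points (affine_simplex 1))"
  have \<epsilon>': "\<epsilon>' \<in> simps (SD E) 1" unfolding \<epsilon>'_def
  proof (rule restrict_in_SD[OF E])
    show "(\<lambda>u. \<epsilon> (segment (q u 1 - 1))) \<in> plots E m U" if "q \<in> plots (affine_simplex 1) m U" for m U q
      by (rule SD_plots[OF \<epsilon>(1) segment_plot]) (use coord[OF that] opn[OF that] in \<open>auto intro: smooth_on_diff smooth_on_const\<close>)
  qed (rule SD_points[OF \<epsilon>(1) segment_affine])
  have \<epsilon>'_segment: "\<epsilon>' (segment t) = \<epsilon> (segment (t - 1))" for t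
    using segment_affine[of t] by (simp add: \<epsilon>'_def segment_def)
  have in2: "(\<lambda>i. if i = 0 then 1 - t else if i = 2 then t else 0) \<in> points (affine_simplex 2)"
    "(\<lambda>i. if i = 1 then 1 - t else if i = 2 then t else 0) \<in> points (affine_simplex 2)" for t
    unfolding points_affine_simplex sum_atMost_2 by auto
  have SD1_eqI: "\<sigma> = \<tau>" if "\<sigma> \<in> simps (SD B) 1" "\<tau> \<in> simps (SD B) 1" "\<And>t. \<sigma> (segment t) = \<tau> (segment t)" for \<sigma> \<tau>
    by (rule SD_eqI[OF that(1,2)]) (metis affine_segment that(3))
  have y_face: "y (\<lambda>i. if i = 0 then 1 - t else if i = 2 then t else 0) = e (segment t)"
    "y (\<lambda>i. if i = 1 then 1 - t else if i = 2 then t else 0) = e (segment t)" for t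
    using in2[of t] by (simp_all add: y_def e_segment del: One_nat_def)
  have face_y: "act (SD B) 1 2 (edge_op 0 2) y = e" "act (SD B) 1 2 (edge_op 1 2) y = e"
  proof -
    show "act (SD B) 1 2 (edge_op 0 2) y = e"
      by (rule SD1_eqI[OF Y.act_closed[OF edge_op y] e], simp, simp, unfold face02 y_face, rule refl)
    show "act (SD B) 1 2 (edge_op 1 2) y = e"
      by (rule SD1_eqI[OF Y.act_closed[OF edge_op y] e], simp, simp, unfold face12 y_face, rule refl)
  qed
  have "SD_map p 1 \<epsilon>' = e"
  proof (rule SD1_eqI[OF map_closed[OF \<epsilon>'] e])
    fix t
    have "SD_map p 1 \<epsilon>' (segment t) = v (circle_point (t - 1))"
      using segment_affine[of t] p\<epsilon> by (simp add: SD_map_def \<epsilon>'_segment)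
    then show "SD_map p 1 \<epsilon>' (segment t) = e (segment t)"
      using circle_point_add_1[of "t - 1"] by (simp add: e_segment)
  qed
  note lifts_e = \<epsilon>(2) this
  \<comment> \<open>The horn has its corner at the vertex 2, with \<open>\<epsilon>\<close> on the
    edge 02 and \<open>\<epsilon>'\<close> on the edge 12. Their values there are
    \<open>\<epsilon> (segment 1)\<close> and \<open>\<epsilon> (segment 0)\<close>, equal because
    \<open>\<epsilon>\<close> is closed.\<close>
  obtain K where K: "K \<in> simps (SD E) 2" "SD_map p 2 K = y"
    "\<And>i. i \<le> 2 \<Longrightarrow> i \<noteq> 2 \<Longrightarrow> act (SD E) 1 2 (coface 2 i) K = (if i = 0 then \<epsilon>' else \<epsilon>)"
  proof (rule triangle_filler[of 2 "\<lambda>i. if i = 0 then \<epsilon>' else \<epsilon>" y "vert (SD E) 1 1 \<epsilon>"])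
    fix i :: nat assume "i \<le> 2" "i \<noteq> 2"
    then have i: "i = 0 \<or> i = 1" by linarith
    show "(if i = 0 then \<epsilon>' else \<epsilon>) \<in> simps (SD E) 1" using \<epsilon>(1) \<epsilon>' by simp
    show "SD_map p 1 (if i = 0 then \<epsilon>' else \<epsilon>) = act (SD B) 1 2 (coface 2 i) y"
      using i lifts_e face_y by (elim disjE) (simp_all add: coface_small del: One_nat_def)
    have "retract_from i 2 = 1" using i by (elim disjE) (simp_all add: retract_from_def)
    moreover have "vert (SD E) 1 1 \<epsilon>' = vert (SD E) 1 1 \<epsilon>"
      unfolding vert_SD \<epsilon>'_segment using closed by simp
    ultimately show "vert (SD E) 1 (retract_from i 2) (if i = 0 then \<epsilon>' else \<epsilon>) = vert (SD E) 1 1 \<epsilon>" by simp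
  qed (use y in auto)
  have K02: "K (\<lambda>i. if i = 0 then 1 - t else if i = 2 then t else 0) = \<epsilon> (segment t)" for t
    using K(3)[of 1] face02[of E K t] coface_small by (simp del: One_nat_def)
  have K12: "K (\<lambda>i. if i = 1 then 1 - t else if i = 2 then t else 0) = \<epsilon> (segment (t - 1))" for t
    using K(3)[of 0] face12[of E K t] coface_small \<epsilon>'_segment by (simp del: One_nat_def)
  \<comment> \<open>The coordinate 2 of \<open>switch t\<close> is \<open>t\<close>, and
    \<open>y\<close> depends on it alone; so \<open>b\<close> lifts \<open>v\<close> however the
    other two coordinates move.\<close>
  define b where "b t = K (switch t)" for t
  have b_low: "b t = \<epsilon> (segment t)" if "t \<le> 1/3" for t
  proof -
    have "switch t = (\<lambda>i. if i = 0 then 1 - t else if i = 2 then t else 0)"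
      using step_low[OF that] by (auto simp: switch_def)
    then show ?thesis by (simp add: b_def K02)
  qed
  have b_high: "b t = \<epsilon> (segment (t - 1))" if "t \<ge> 2/3" for t
  proof -
    have "switch t = (\<lambda>i. if i = 1 then 1 - t else if i = 2 then t else 0)"
      using step_high[OF that] by (auto simp: switch_def)
    then show ?thesis using K12[of t] by (simp only: b_def)
  qed
  have pb: "p (b t) = v (circle_point t)" for t
    using fun_cong[OF K(2), of "switch t"] switch_affine[of t] by (simp add: b_def SD_map_def y_def switch_def)
  have b_plot: "(\<lambda>u. b (f u)) \<in> plots E m U" if "openin (Euclidean_space m) U" "smooth_on m U f" for m U f
    unfolding b_def by (rule SD_plots[OF K(1) switch_plot[OF that]])
  have b_point: "b t \<in> points E" for t unfolding b_def by (rule SD_points[OF K(1) switch_affine])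
  \<comment> \<open>Any parameter in the window will do, as \<open>h_eq\<close> shows that
    \<open>b\<close> has the same value at all of them.\<close>
  define angle where "angle x = (SOME t. -1/4 < t \<and> t < 5/4 \<and> circle_point t = x)" for x
  define h where "h x = b (angle x)" for x
  have h_eq: "h (circle_point t) = b t" if t: "-1/4 < t" "t < 5/4" for t
  proof -
    let ?s = "angle (circle_point t)"
    have s: "-1/4 < ?s \<and> ?s < 5/4 \<and> circle_point ?s = circle_point t"
      unfolding angle_def by (rule someI[of _ t]) (use t in auto)
    then obtain k :: int where k: "?s = t + of_int k" using circle_point_eqD by metis
    have "real_of_int k < 2" "- 2 < real_of_int k" using k s t by linarith+
    \<comment> \<open>The window has length 3/2, so two parameters of one point differ by at most
      one turn.\<close>
    then have k3: "k = -1 \<or> k = 0 \<or> k = 1" by linarith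
    \<comment> \<open>Here \<open>t > 3/4\<close> lies after the step and \<open>t' < 1/4\<close>
      before it, so both values are \<open>\<epsilon> (segment t')\<close>.\<close>
    have shift: "b t = b t'" if "t - 1 = t'" "t < 5/4" "-1/4 < t'" for t t'
      using b_high[of t] b_low[of t'] that by simp
    from k3 have "b ?s = b t"
    proof (elim disjE)
      assume "k = -1"
      then have "t - 1 = ?s" using k by simp
      from shift[OF this] show ?thesis using s t by simp
    next
      assume "k = 1"
      then have "?s - 1 = t" using k by simp
      from shift[OF this] show ?thesis using s t by simp
    qed (use k in simp)
    then show ?thesis by (simp add: h_def)
  qed
  have surj: "\<exists>t. -1/4 < t \<and> t < 5/4 \<and> circle_point t = x" if "x \<in> points circle" for x
  proof -
    \<comment> \<open>A point is a plot on the zero-dimensional Euclidean space, so the local angle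
      of that plot gives its parameter.\<close>
    have "(\<lambda>_. x) \<in> plots circle 0 (topspace (Euclidean_space 0))"
      by (rule plots_const[OF diffeological_space_circle openin_topspace that])
    moreover have "(\<lambda>_. 0) \<in> topspace (Euclidean_space 0)" by (simp add: topspace_Euclidean_space)
    ultimately show ?thesis by (rule circle_plot_local_angle) metis
  qed
  have "smooth_map circle E h"
    unfolding smooth_map_def
  proof (intro conjI allI ballI funcsetI)
    show "h x \<in> points E" for x by (simp add: h_def b_point)
    fix n U f assume f: "f \<in> plots circle n U"
    show "h \<circ> f \<in> plots E n U"
    proof (rule plots_local[OF E])
      fix u assume u: "u \<in> U"
      obtain V \<alpha> where V: "openin (Euclidean_space n) V" "u \<in> V" "V \<subseteq> U" "smooth_on n V \<alpha>"
        "\<And>x. x \<in> V \<Longrightarrow> f x = circle_point (\<alpha> x)" "\<And>x. x \<in> V \<Longrightarrow> -1/4 < \<alpha> x \<and> \<alpha> x < 5/4"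
        using f u by (rule circle_plot_local_angle) blast
      \<comment> \<open>The choice made by \<open>angle\<close> need not be continuous, but on
        \<open>V\<close> it disappears: there \<open>h \<circ> f\<close> is \<open>b\<close> after
        the smooth function \<open>\<alpha>\<close>.\<close>
      have "h \<circ> f \<in> plots E n V"
        by (rule plots_cong[OF E b_plot[OF V(1,4)]]) (use V(5,6) h_eq in simp)
      then show "\<exists>V. openin (Euclidean_space n) V \<and> u \<in> V \<and> V \<subseteq> U \<and> h \<circ> f \<in> plots E n V"
        using V by blast
    qed
  qed
  moreover have "p (h x) = v x" if x: "x \<in> points circle" for x
  proof -
    obtain t where "-1/4 < t" "t < 5/4" "circle_point t = x" using surj[OF x] by blast
    then show ?thesis using h_eq[of t] pb[of t] by simp
  qed
  ultimately show ?thesis by (rule that)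
qed

theorem proposition4p23:
  shows "diffeological_space circle \<and> cofibrant TYPE('e) TYPE('b) circle"
proof (rule conjI[OF diffeological_space_circle])
  \<comment> \<open>Plots of the empty space have empty domain, and the empty set is the union of
    the empty family.\<close>
  have "smooth_on n {} f" for n f using smooth_on_Union[of "{}" n f] by simp
  then have "smooth_map (empty_diffeology :: (nat \<Rightarrow> real) diffeology) circle id"
    by (auto simp: smooth_map_def empty_diffeology_def circle_plots)
  moreover have "left_lifting (empty_diffeology :: (nat \<Rightarrow> real) diffeology) circle id E B p"
    if "diffeological_space E" "diffeological_space B" "weak_equivalence E B p" "fibration E B p"
    for E :: "'e diffeology" and B :: "'b diffeology" and p
    unfolding left_lifting_def
  proof (intro allI impI)
    fix v assume "smooth_map circle B v"
    from trivial_fibration_lifts_circle[OF that this] obtain h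
      where h: "smooth_map circle E h" "\<And>x. x \<in> points circle \<Longrightarrow> p (h x) = v x" by blast
    then show "\<exists>h. smooth_map circle E h \<and> (\<forall>a\<in>points empty_diffeology. h (id a) = u a) \<and>
        (\<forall>x\<in>points circle. p (h x) = v x)" for u
      by (intro exI[of _ h]) (auto simp: empty_diffeology_def)
  qed
  ultimately show "cofibrant TYPE('e) TYPE('b) circle"
    by (simp add: cofibrant_def cofibration_def)
qed

end
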